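(* For each integer $n\ge 1$ let $W_{2n+1}=w(\pi)/n$, where $\pi\in S_{2n+1}$ is drawn uniformly at random and $w(\pi)$ is its writhe. There exists a continuous probability distribution $W$ on $\mathbb{R}$ such that $W_{2n+1}$ converges in distribution to $W$ as $n\to\infty$, and $W$ is defined (uniquely determined) by the moment generating function $$\mathcal{M}(z) \;=\; E\left[e^{Wz}\right] \;=\; \exp\left(\sum_{m=1}^{\infty}\frac{\lambda_m}{m}z^m\right)$$ for $z$ in a neighbourhood of $0$, where $\lambda_m = \dfrac{8^m(2^m-1)B_m^2}{2(m!)^2}$ for even $m$ and $\lambda_m=0$ for odd $m$, with $B_m$ denoting the $m$th Bernoulli number.
   Context: For a one-to-one function $f:\mathbb{Z}_{2n+1}\to\mathbb{R}$, where $\mathbb{Z}_{2n+1}=\mathbb{Z}/(2n+1)\mathbb{Z}$, the writhe of $f$ is $$ w(f) = \sum_{i=0}^{2n} \sum_{j=1}^{n} \mathrm{sign}\left(f(i+j)-f(i)\right), $$ where $i+j$ is taken in $\mathbb{Z}_{2n+1}$, and $\mathrm{sign}(x)=+1$ if $x>0$ and $-1$ if $x<0$. A permutation in $S_{2n+1}$ is viewed as a bijection of $\{0,\dots,2n\}$, the domain being identified with $\mathbb{Z}_{2n+1}$ and the values $0,\dots,2n$ being compared as integers. Bernoulli numbers: $x/(e^x-1)=\sum_{m\ge 0}B_m x^m/m!$. *)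

theory Defs
  imports "HOL-Probability.Probability" "HOL-Computational_Algebra.Formal_Power_Series"
begin

(* Residues modulo 2n+1 are represented by 0, ..., 2n; only the values of f there matter.
   For one-to-one f the argument of sgn is never 0. *)
definition writhe :: "nat \<Rightarrow> (nat \<Rightarrow> real) \<Rightarrow> real" where
  "writhe n f = (\<Sum>i=0..2*n. \<Sum>j=1..n. sgn (f ((i + j) mod (2*n + 1)) - f i))"

(* For n = 0 this is the point mass at 0 (division by zero); limits in n ignore it. *)
definition normalized_writhe_distr :: "nat \<Rightarrow> real measure" where
  "normalized_writhe_distr n =
     distr (measure_pmf (pmf_of_set {p. p permutes {0..2*n}})) borel
       (\<lambda>p. writhe n (\<lambda>i. real (p i)) / real n)"

(* The quotient of formal power series cancels the common factor X. *)
definition bernoulli :: "nat \<Rightarrow> real" where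
  "bernoulli m = fact m * fps_nth (fps_X / (fps_exp 1 - 1)) m"

lemma bernoulli_generating_function:
  "Abs_fps (\<lambda>m. bernoulli m / fact m) * (fps_exp 1 - 1) = fps_X"
proof -
  let ?E = "fps_exp (1::real) - 1"
  have "fps_nth ?E 1 \<noteq> 0" "fps_nth ?E 0 = 0" by simp_all
  then have E: "?E \<noteq> 0" "subdegree ?E = 1"
    by (force, intro subdegreeI) auto
  then have "?E dvd fps_X"
    by (simp add: fps_dvd_iff)
  moreover have "Abs_fps (\<lambda>m. bernoulli m / fact m) = fps_X / ?E"
    by (simp add: bernoulli_def fps_eq_iff)
  ultimately show ?thesis by simp
qed

definition writhe_lambda :: "nat \<Rightarrow> real" where
  "writhe_lambda m =
     (if even m then 8 ^ m * (2 ^ m - 1) * (bernoulli m)\<^sup>2 / (2 * (fact m)\<^sup>2) else 0)"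

(* The sum over m \<ge> 1 of writhe_lambda m / m * z ^ m is re-indexed by m = Suc k.
   Existence of the expectation and convergence of the series are part of the property. *)
definition has_writhe_mgf :: "real measure \<Rightarrow> bool" where
  "has_writhe_mgf W \<longleftrightarrow>
     (\<forall>\<^sub>F z in nhds 0.
        integrable W (\<lambda>x. exp (x * z)) \<and>
        summable (\<lambda>k. writhe_lambda (Suc k) / real (Suc k) * z ^ Suc k) \<and>
        (LINT x|W. exp (x * z)) =
          exp (\<Sum>k. writhe_lambda (Suc k) / real (Suc k) * z ^ Suc k))"

end

(*
  Replacing the random permutation by the ranks of independent uniform variables U_0, ..., U_2n turns
  w(pi) into a sum of sgn(U_b - U_i) over the n(2n+1) cyclic pairs, and subtracting the linear part
  2(U_b - U_i), whose total vanishes, makes the summands pairwise orthogonal.  The position kernel is a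
  square wave with Fourier coefficients 4/(pi j), j odd; the value kernel sgn(d) - 2d is a sawtooth with
  coefficients 2/(pi k).  Truncating both expansions costs little in L^2, uniformly in n, and the product
  of two sines makes the truncated sum diagonal:
    w / n  ~  sum over j odd, k of 4/(pi^2 j k) * (|Z_{j,-k}|^2 - |Z_{j,k}|^2) / 2n,
    Z_{j,k} = sum over b of exp(2 pi i (j b / (2n+1) + k U_b)).
  The Z_{j,k} / sqrt n become independent complex Gaussians, so each difference becomes a Laplace variable and
  the limit W has moment generating function prod 1 / (1 - (4 z / (pi^2 j k))^2).  Taking logarithms gives
  sum lambda_m z^m / m by Euler's formula for zeta(2l).
*)
theory Submission
  imports Defs "HOL-Complex_Analysis.Complex_Analysis" "HOL-Real_Asymp.Real_Asymp"
begin

section \<open>Analytic transforms of distributions\<close>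

text \<open>Two limits are taken in turn: \<open>n\<close> to infinity with the number
  \<open>m\<close> of Fourier terms fixed, then \<open>m\<close> to infinity. The exchange rests on
  Parseval: the limiting mean square error is 2 (1/3 -
  \<open>wave_energy m * sawtooth_energy m\<close>), and the two energies are partial sums of the
  squared L^2 norms 1 and 1/3 of the kernels. For fixed \<open>m\<close> the statistic is quadratic
  in asymptotically Gaussian modes. Instead of a joint weak limit, only characteristic functions of
  linear forms are used: a square in an exponent is linearized by a Gaussian average, which requires
  a parameter with positive real part and forces the detour through damped exponents. The law W is
  constructed apart from the permutations, as a limit built from finite sums of exponential
  variables, so that weak convergence to it becomes a pointwise statement about characteristic
  functions. These fix its moment generating function on the imaginary axis first; analytic
  continuation in the unit disc carries the formula to real arguments, and the same principle in a
  strip gives uniqueness.\<close>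

lemma norm_exp_diff_quotient_le:
  fixes h :: complex and x d :: real
  assumes "h \<noteq> 0" "norm h \<le> d" "d > 0"
  shows "norm ((exp (h * x) - 1) / h) \<le> (exp (2 * d * x) + exp (- 2 * d * x)) / d"
proof -
  have "norm (exp (h * x) - 1) \<le> exp \<bar>Re (h * x)\<bar> * norm (h * x)"
    using Taylor_exp[of "h * x" 0] by simp
  also have "\<dots> \<le> exp (d * \<bar>x\<bar>) * (norm h * \<bar>x\<bar>)"
  proof (rule mult_mono)
    have "\<bar>Re h\<bar> * \<bar>x\<bar> \<le> d * \<bar>x\<bar>"
      using abs_Re_le_cmod[of h] assms(2) by (intro mult_right_mono) auto
    then show "exp \<bar>Re (h * x)\<bar> \<le> exp (d * \<bar>x\<bar>)" by (simp add: abs_mult)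
  qed (auto simp: norm_mult)
  also have "\<dots> \<le> exp (d * \<bar>x\<bar>) * (norm h * (exp (d * \<bar>x\<bar>) / d))"
  proof (intro mult_left_mono)
    \<comment> \<open>The factor |x| is absorbed into an exponential, so that exponential moments
      alone make the bound integrable.\<close>
    have "d * \<bar>x\<bar> \<le> exp (d * \<bar>x\<bar>)"
      using exp_ge_add_one_self[of "d * \<bar>x\<bar>"] by linarith
    then show "\<bar>x\<bar> \<le> exp (d * \<bar>x\<bar>) / d"
      using assms(3) by (simp add: pos_le_divide_eq mult.commute)
  qed auto
  also have "\<dots> = norm h * (exp (2 * d * \<bar>x\<bar>) / d)"
    by (simp add: exp_add[symmetric])
  finally have "norm ((exp (h * x) - 1) / h) \<le> exp (2 * d * \<bar>x\<bar>) / d"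
    using assms(1) by (simp add: norm_divide field_simps)
  also have "\<dots> \<le> (exp (2 * d * x) + exp (- 2 * d * x)) / d"
    using assms(3) by (intro divide_right_mono) (auto simp: abs_if)
  finally show ?thesis .
qed

text \<open>The derivative is taken under the integral sign. Near \<open>z0\<close> the difference
  quotients are dominated by real exponentials at \<open>z0 + 2 * d\<close> and
  \<open>z0 - 2 * d\<close>, integrable because both points still lie in \<open>S\<close>. With
  \<open>g = 1\<close> this covers moment generating functions; with \<open>X\<close> a negative
  square and \<open>g\<close> a phase it covers Gaussian integrals as functions of their complex
  parameter.\<close>

lemma holomorphic_integral_exp:
  fixes M :: "'a measure" and X :: "'a \<Rightarrow> real" and g :: "'a \<Rightarrow> complex"
  assumes [measurable]: "g \<in> borel_measurable M" "X \<in> borel_measurable M"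
    and g: "\<And>x. norm (g x) \<le> B"
    and S: "open S"
    and int: "\<And>z. z \<in> S \<Longrightarrow> integrable M (\<lambda>x. exp (Re z * X x))"
  shows "(\<lambda>z. LINT x|M. g x * exp (z * X x)) holomorphic_on S"
proof -
  have "((\<lambda>z. LINT x|M. g x * exp (z * X x)) has_field_derivative
      (LINT x|M. g x * (X x * exp (z0 * X x)))) (at z0)" if z0: "z0 \<in> S" for z0 :: complex
  proof -
    obtain e where e: "e > 0" "cball z0 e \<subseteq> S"
      using S z0 open_contains_cball by blast
    define d where "d = e / 2"
    have d: "d > 0" using e by (simp add: d_def)
    have p: "z0 + 2 * d \<in> S" "z0 - 2 * d \<in> S"
      using e by (auto simp: d_def dist_norm intro!: subsetD[OF e(2)])
    have ip: "integrable M (\<lambda>x. exp ((Re z0 + 2 * d) * X x))" "integrable M (\<lambda>x. exp ((Re z0 - 2 * d) * X x))"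
      using int[OF p(1)] int[OF p(2)] by simp_all
    have B: "B \<ge> 0" using g[of undefined] norm_ge_zero order_trans by blast
    have intz: "integrable M (\<lambda>x. g x * exp (z * X x))" if "z \<in> S" for z
      by (rule Bochner_Integration.integrable_bound[OF integrable_mult_right[OF int[OF that], of B]])
         (auto simp: norm_mult B abs_mult intro!: mult_right_mono g)
    have "((\<lambda>h. ((LINT x|M. g x * exp ((z0 + h) * X x)) - (LINT x|M. g x * exp (z0 * X x))) / h)
       \<longlongrightarrow> (LINT x|M. g x * (X x * exp (z0 * X x)))) (at 0)"
      unfolding tendsto_at_iff_sequentially comp_def
    proof (intro allI impI)
      fix H :: "nat \<Rightarrow> complex"
      assume H0: "\<forall>i. H i \<in> UNIV - {0}" and H: "H \<longlonglongrightarrow> 0"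
      have ev: "\<forall>\<^sub>F i in sequentially. norm (H i) < d"
        using order_tendstoD(2)[OF tendsto_norm[OF H], of d] d by simp
      \<comment> \<open>The dominating function is valid only for increments below \<open>d\<close>
        in norm, hence the shift of the sequence by \<open>i0\<close>.\<close>
      then obtain i0 where i0: "\<And>i. i \<ge> i0 \<Longrightarrow> norm (H i) < d"
        by (auto simp: eventually_sequentially)
      have "(\<lambda>i. LINT x|M. (g x * exp ((z0 + H (i + i0)) * X x) - g x * exp (z0 * X x)) / H (i + i0))
        \<longlonglongrightarrow> (LINT x|M. g x * (X x * exp (z0 * X x)))"
      proof (rule integral_dominated_convergence[where
          w = "\<lambda>x. B * ((exp ((Re z0 + 2 * d) * X x) + exp ((Re z0 - 2 * d) * X x)) / d)"])
        show "AE x in M. (\<lambda>i. (g x * exp ((z0 + H (i + i0)) * X x) - g x * exp (z0 * X x)) / H (i + i0))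
          \<longlonglongrightarrow> g x * (X x * exp (z0 * X x))"
        proof (rule AE_I2)
          fix x
          have "((\<lambda>z. g x * exp (z * X x)) has_field_derivative g x * (X x * exp (z0 * X x))) (at z0)"
            by (auto intro!: derivative_eq_intros)
          then have "((\<lambda>h. (g x * exp ((z0 + h) * X x) - g x * exp (z0 * X x)) / h) \<longlongrightarrow> g x * (X x * exp (z0 * X x))) (at 0)"
            unfolding DERIV_def .
          then show "(\<lambda>i. (g x * exp ((z0 + H (i + i0)) * X x) - g x * exp (z0 * X x)) / H (i + i0))
            \<longlonglongrightarrow> g x * (X x * exp (z0 * X x))"
            unfolding tendsto_at_iff_sequentially comp_def
            using H0 LIMSEQ_ignore_initial_segment[OF H, of i0] by auto
        qed
        show "AE x in M. norm ((g x * exp ((z0 + H (i + i0)) * X x) - g x * exp (z0 * X x)) / H (i + i0))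
          \<le> B * ((exp ((Re z0 + 2 * d) * X x) + exp ((Re z0 - 2 * d) * X x)) / d)" for i
        proof (rule AE_I2)
          fix x
          let ?h = "H (i + i0)"
          have "(g x * exp ((z0 + ?h) * X x) - g x * exp (z0 * X x)) / ?h
            = g x * (exp (z0 * X x) * ((exp (?h * X x) - 1) / ?h))"
            by (simp add: distrib_right exp_add diff_divide_distrib algebra_simps)
          also have "norm \<dots> \<le> B * (exp (Re z0 * X x) * ((exp (2 * d * X x) + exp (- 2 * d * X x)) / d))"
            unfolding norm_mult
            using norm_exp_diff_quotient_le[of ?h d "X x"] H0 i0[of "i + i0"] d
            by (intro mult_mono g) (auto simp: B)
          also have "\<dots> = B * ((exp ((Re z0 + 2 * d) * X x) + exp ((Re z0 - 2 * d) * X x)) / d)"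
            by (simp add: distrib_right left_diff_distrib exp_add exp_diff exp_minus distrib_left divide_inverse)
          finally show "norm ((g x * exp ((z0 + ?h) * X x) - g x * exp (z0 * X x)) / ?h) \<le> \<dots>" .
        qed
        show "integrable M (\<lambda>x. B * ((exp ((Re z0 + 2 * d) * X x) + exp ((Re z0 - 2 * d) * X x)) / d))"
          by (intro integrable_mult_right integrable_divide Bochner_Integration.integrable_add ip)
      qed measurable
      moreover have "((LINT x|M. g x * exp ((z0 + H (i + i0)) * X x)) - (LINT x|M. g x * exp (z0 * X x))) / H (i + i0)
        = (LINT x|M. (g x * exp ((z0 + H (i + i0)) * X x) - g x * exp (z0 * X x)) / H (i + i0))" for i
      proof -
        have "z0 + H (i + i0) \<in> S"
          using i0[of "i + i0"] d by (intro subsetD[OF e(2)]) (auto simp: dist_norm d_def)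
        then show ?thesis by (simp add: intz z0 Bochner_Integration.integral_diff)
      qed
      ultimately have "(\<lambda>i. ((LINT x|M. g x * exp ((z0 + H (i + i0)) * X x)) - (LINT x|M. g x * exp (z0 * X x))) / H (i + i0))
        \<longlonglongrightarrow> (LINT x|M. g x * (X x * exp (z0 * X x)))" by (simp only:)
      then show "(\<lambda>i. ((LINT x|M. g x * exp ((z0 + H i) * X x)) - (LINT x|M. g x * exp (z0 * X x))) / H i)
        \<longlonglongrightarrow> (LINT x|M. g x * (X x * exp (z0 * X x)))"
        by (rule LIMSEQ_offset[where k = i0])
    qed
    then show ?thesis unfolding DERIV_def .
  qed
  then show ?thesis
    using S holomorphic_on_open by blast
qed

text \<open>Holomorphic functions are compared below on segments of the real or the imaginary axis;
  the endpoint is the accumulation point that the identity theorem asks for.\<close>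

lemma islimpt_segment:
  fixes c w :: complex
  assumes "w \<noteq> 0" "d > 0"
  shows "c islimpt ((\<lambda>t::real. c + w * t) ` {0<..<d})"
  unfolding islimpt_approachable
proof (intro allI impI)
  fix e :: real assume e: "e > 0"
  define t where "t = min (d / 2) (e / (2 * norm w))"
  have "t > 0" "t < d" "norm w * t < e"
    using assms e by (auto simp: t_def min_def field_simps)
  then show "\<exists>x'\<in>(\<lambda>t::real. c + w * t) ` {0<..<d}. x' \<noteq> c \<and> dist x' c < e"
    using assms by (intro bexI[of _ "c + w * t"]) (auto simp: norm_mult dist_norm)
qed

section \<open>Moment generating functions in a complex strip\<close>

definition complex_mgf :: "real measure \<Rightarrow> complex \<Rightarrow> complex" where
  "complex_mgf M z = (CLINT x|M. exp (z * x))"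

lemma char_eq_complex_mgf: "char M t = complex_mgf M (\<i> * t)"
  by (simp add: char_def complex_mgf_def mult.assoc)

lemma complex_mgf_of_real: "complex_mgf M (of_real z) = of_real (LINT x|M. exp (x * z))"
  unfolding complex_mgf_def integral_complex_of_real[symmetric]
  by (simp add: exp_of_real[symmetric] mult.commute del: exp_of_real)

lemma open_connected_strip:
  "open {z. \<bar>Re z\<bar> < d}" "connected {z. \<bar>Re z\<bar> < d}"
proof -
  have *: "{z. \<bar>Re z\<bar> < d} = {z. Re z < d} \<inter> {z. Re z > - d}" by auto
  show "open {z. \<bar>Re z\<bar> < d}"
    unfolding * by (intro open_Int open_halfspace_Re_lt open_halfspace_Re_gt)
  show "connected {z. \<bar>Re z\<bar> < d}"
    unfolding * by (intro convex_connected convex_Int convex_halfspace_Re_lt convex_halfspace_Re_gt)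
qed

lemma holomorphic_complex_mgf:
  assumes "real_distribution M"
    and "\<And>z. \<bar>z\<bar> < d \<Longrightarrow> integrable M (\<lambda>x. exp (x * z))"
  shows "complex_mgf M holomorphic_on {z. \<bar>Re z\<bar> < d}"
proof -
  interpret real_distribution M by fact
  have "(\<lambda>z. CLINT x|M. 1 * exp (z * x)) holomorphic_on {z. \<bar>Re z\<bar> < d}"
    by (rule holomorphic_integral_exp[where B = 1])
       (use assms(2)[of "Re _"] in \<open>auto simp: open_connected_strip mult.commute[of "Re _"]\<close>)
  then show ?thesis by (simp add: complex_mgf_def[abs_def])
qed

text \<open>Both transforms are holomorphic in the strip |Re z| < \<open>d\<close> and agree on a
  real segment, hence everywhere in it. The strip contains the imaginary axis, where they are the
  characteristic functions.\<close>

lemma real_distribution_eq_if_mgf_eq: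
  assumes M: "real_distribution M" and N: "real_distribution N" and d: "d > 0"
    and int: "\<And>z. \<bar>z\<bar> < d \<Longrightarrow> integrable M (\<lambda>x. exp (x * z))"
      "\<And>z. \<bar>z\<bar> < d \<Longrightarrow> integrable N (\<lambda>x. exp (x * z))"
    and eq: "\<And>z. \<bar>z\<bar> < d \<Longrightarrow> (LINT x|M. exp (x * z)) = (LINT x|N. exp (x * z))"
  shows "M = N"
proof (rule Levy_uniqueness[OF M N], rule ext)
  fix t :: real
  let ?f = "\<lambda>z. complex_mgf M z - complex_mgf N z"
  have "?f (\<i> * complex_of_real t) = 0"
  proof (rule analytic_continuation[where f = ?f and S = "{z. \<bar>Re z\<bar> < d}" and \<xi> = 0])
    show "0 islimpt (\<lambda>t::real. 0 + 1 * complex_of_real t) ` {0<..<d}"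
      using d by (intro islimpt_segment) auto
    show "?f holomorphic_on {z. \<bar>Re z\<bar> < d}"
      by (intro holomorphic_intros holomorphic_complex_mgf M N int)
  qed (use d in \<open>auto simp: open_connected_strip complex_mgf_of_real eq\<close>)
  then show "char M t = char N t" by (simp add: char_eq_complex_mgf)
qed

section \<open>Gaussian linearization of quadratic statistics\<close>

text \<open>The Fourier transform at \<open>x\<close> of the weight exp(-a y^2 / 2) with complex
  \<open>a\<close>. The exponent is written as \<open>a\<close> times a real function to fit
  \<open>holomorphic_integral_exp\<close>.\<close>

definition gauss_int :: "real \<Rightarrow> complex \<Rightarrow> complex" where
  "gauss_int x a = (CLINT y|lborel. iexp (x * y) * exp (a * of_real (- (y\<^sup>2) / 2)))"

lemma integrable_gaussian:
  assumes "(a::real) > 0" shows "integrable lborel (\<lambda>y. exp (a * (- (y\<^sup>2) / 2)))"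
proof -
  have "integrable lborel (\<lambda>y. sqrt (2 * pi / a) * normal_density 0 (1 / sqrt a) y)"
    using assms by (intro integrable_mult_right integrable_normal_density) auto
  also have "(\<lambda>y. sqrt (2 * pi / a) * normal_density 0 (1 / sqrt a) y) = (\<lambda>y. exp (a * (- (y\<^sup>2) / 2)))"
    using assms by (auto simp: normal_density_def fun_eq_iff power_divide real_sqrt_divide field_simps)
  finally show ?thesis .
qed

lemma holomorphic_gauss_int: "gauss_int x holomorphic_on {a. Re a > 0}"
  unfolding gauss_int_def[abs_def]
  by (rule holomorphic_integral_exp[where B = 1])
     (use integrable_gaussian in \<open>auto simp: open_halfspace_Re_gt norm_mult\<close>)

lemma gauss_int_of_real:
  assumes a: "(a::real) > 0"
  shows "gauss_int x a = sqrt (2 * pi / a) * exp (- x\<^sup>2 / (2 * a))"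
proof -
  have "gauss_int x a = \<bar>1 / sqrt a\<bar> *\<^sub>R (CLINT y|lborel. iexp (x * (0 + 1 / sqrt a * y)) * exp (complex_of_real a * of_real (- ((0 + 1 / sqrt a * y)\<^sup>2) / 2)))"
    unfolding gauss_int_def using a by (intro lborel_integral_real_affine) auto
  also have "(\<lambda>y::real. iexp (x * (0 + 1 / sqrt a * y)) * exp (complex_of_real a * of_real (- ((0 + 1 / sqrt a * y)\<^sup>2) / 2)))
    = (\<lambda>y. of_real (sqrt (2 * pi)) * (std_normal_density y *\<^sub>R iexp ((x / sqrt a) * y)))"
  proof
    fix y :: real
    have "complex_of_real a * of_real (- ((0 + 1 / sqrt a * y)\<^sup>2) / 2) = of_real (- (y\<^sup>2) / 2)"
      unfolding of_real_mult[symmetric] of_real_eq_iff using a by (simp add: power_mult_distrib power_divide)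
    then show "iexp (x * (0 + 1 / sqrt a * y)) * exp (complex_of_real a * of_real (- ((0 + 1 / sqrt a * y)\<^sup>2) / 2))
      = of_real (sqrt (2 * pi)) * (std_normal_density y *\<^sub>R iexp ((x / sqrt a) * y))"
      by (simp add: std_normal_density_def scaleR_conv_of_real exp_of_real[symmetric] del: exp_of_real)
  qed
  also have "(CLINT y|lborel. of_real (sqrt (2 * pi)) * (std_normal_density y *\<^sub>R iexp ((x / sqrt a) * y)))
    = of_real (sqrt (2 * pi)) * char std_normal_distribution (x / sqrt a)"
    unfolding char_def by (subst integral_density) (auto simp del: mult_scaleR_right simp flip: of_real_mult)
  also have "\<bar>1 / sqrt a\<bar> *\<^sub>R (of_real (sqrt (2 * pi)) * char std_normal_distribution (x / sqrt a))
     = sqrt (2 * pi / a) * exp (- x\<^sup>2 / (2 * a))"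
    using a by (simp add: char_std_normal_distribution scaleR_conv_of_real real_sqrt_divide power_divide)
  finally show ?thesis by simp
qed

text \<open>Gaussian integrals are evaluated at real parameters only; this carries the resulting
  identities to the right half-plane without moving contours.\<close>

lemma half_plane_continuation:
  fixes f :: "complex \<Rightarrow> complex" and a :: complex
  assumes "f holomorphic_on {a. Re a > 0}" "\<And>r::real. r > 0 \<Longrightarrow> f (of_real r) = 0" "Re a > 0"
  shows "f a = 0"
proof (rule analytic_continuation[where f = f and S = "{a. Re a > 0}" and \<xi> = 1])
  show "1 islimpt (\<lambda>t::real. 1 + 1 * complex_of_real t) ` {0<..<1}"
    by (intro islimpt_segment) auto
  show "f z = 0" if "z \<in> (\<lambda>t::real. 1 + 1 * complex_of_real t) ` {0<..<1}" for z
  proof -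
    from that obtain t :: real where "z = of_real (1 + t)" "t > 0" by auto
    then show ?thesis using assms(2)[of "1 + t"] by simp
  qed
qed (use assms in \<open>auto simp: open_halfspace_Re_gt convex_connected convex_halfspace_Re_gt\<close>)

text \<open>Squaring turns \<open>sqrt (2 * pi / a)\<close> into a rational function, so both sides
  are holomorphic in the half-plane and the real case continues.\<close>

lemma gauss_int_0_power2:
  fixes a :: complex
  assumes "Re a > 0" shows "(gauss_int 0 a)\<^sup>2 = 2 * pi / a"
proof -
  have "(gauss_int 0 a)\<^sup>2 - 2 * pi / a = 0"
  proof (rule half_plane_continuation[where f = "\<lambda>a. (gauss_int 0 a)\<^sup>2 - 2 * pi / a"])
    show "(gauss_int 0 (of_real r))\<^sup>2 - 2 * pi / complex_of_real r = 0" if "r > 0" for r :: real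
      using that by (simp add: gauss_int_of_real flip: of_real_power)
  qed (use assms in \<open>auto intro!: holomorphic_intros holomorphic_gauss_int\<close>)
  then show ?thesis by simp
qed

lemma gauss_int_eq:
  fixes a :: complex
  assumes "Re a > 0" shows "gauss_int x a = gauss_int 0 a * exp (- x\<^sup>2 / (2 * a))"
proof -
  have "gauss_int x a - gauss_int 0 a * exp (- x\<^sup>2 / (2 * a)) = 0"
  proof (rule half_plane_continuation[where f = "\<lambda>a. gauss_int x a - gauss_int 0 a * exp (- x\<^sup>2 / (2 * a))"])
    show "gauss_int x (of_real r) - gauss_int 0 (of_real r) * exp (- x\<^sup>2 / (2 * complex_of_real r)) = 0" if "r > 0" for r :: real
      using that by (simp add: gauss_int_of_real flip: exp_of_real)
  qed (use assms in \<open>auto intro!: holomorphic_intros holomorphic_gauss_int\<close>)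
  then show ?thesis by simp
qed

lemma norm_exp_mult_of_real: "norm (exp (a * of_real x)) = exp (Re a * x)"
  by simp

text \<open>The value at $-s$ of the moment generating function of $X^2/2$ for a standard Gaussian $X$. Only its square
  $1/(1+s)$ is ever needed, so no branch of the square root is chosen.\<close>
definition chi_mgf :: "complex \<Rightarrow> complex" where
  "chi_mgf s = gauss_int 0 (1 / s + 1) / gauss_int 0 (1 / s)"

lemma Re_inverse_pos: "Re s > 0 \<Longrightarrow> Re (1 / s) > 0"
  by (simp add: Re_divide add_pos_nonneg)

lemma chi_mgf_power2:
  assumes "Re s > 0" shows "(chi_mgf s)\<^sup>2 = 1 / (1 + s)"
proof -
  have "s \<noteq> 0" "1 + s \<noteq> 0" using assms by (auto simp: complex_eq_iff)
  then show ?thesis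
    using gauss_int_0_power2[of "1 / s + 1"] gauss_int_0_power2[of "1 / s"] Re_inverse_pos[OF assms]
    by (simp add: chi_mgf_def power_divide) (simp add: field_simps)
qed

lemma gauss_int_0_nonzero: "Re a > 0 \<Longrightarrow> gauss_int 0 a \<noteq> 0"
  using gauss_int_0_power2[of a] by auto

lemma norm_exp_neg_quadratic_le:
  assumes "\<And>r. r \<in> A \<Longrightarrow> Re (s r) \<ge> 0"
  shows "norm (exp (- (\<Sum>r\<in>A. s r * of_real ((u r)\<^sup>2 / 2)))) \<le> 1"
proof -
  have "Re (\<Sum>r\<in>A. s r * of_real ((u r)\<^sup>2 / 2)) = (\<Sum>r\<in>A. Re (s r) * ((u r)\<^sup>2 / 2))" by simp
  also have "\<dots> \<ge> 0" using assms by (intro sum_nonneg mult_nonneg_nonneg) auto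
  finally show ?thesis by simp
qed

text \<open>Known as the Hubbard-Stratonovich transformation: the square of \<open>u\<close> is
  traded for a phase linear in \<open>u\<close>, at the price of an auxiliary Gaussian variable
  \<open>y\<close>. It is \<open>gauss_int_eq\<close> at \<open>1 / s\<close>, normalized.\<close>

lemma gauss_int_linearization:
  assumes "Re s > 0"
  shows "exp (- (s * of_real (u\<^sup>2 / 2))) = (CLINT y|lborel. iexp (u * y) * exp ((1 / s) * of_real (- (y\<^sup>2) / 2))) / gauss_int 0 (1 / s)"
proof -
  have "s \<noteq> 0" using assms by auto
  then have "exp (- (complex_of_real u)\<^sup>2 / (2 * (1 / s))) = exp (- (s * of_real (u\<^sup>2 / 2)))" by (simp add: field_simps)
  then show ?thesis
    using gauss_int_eq[of "1 / s" u] gauss_int_0_nonzero[OF Re_inverse_pos[OF assms]] Re_inverse_pos[OF assms]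
    unfolding gauss_int_def[symmetric] by (simp only: nonzero_mult_div_cancel_left not_False_eq_True)
qed

text \<open>\<open>\<Phi>\<close> collects the remaining factors of the integrand. As it and the
  phase have norm at most 1, a Gaussian in \<open>y\<close> alone dominates the double integral, and
  Fubini applies on the probability space \<open>M\<close>.\<close>

lemma integral_gauss_linearization:
  fixes M :: "'a measure" and X :: "'a \<Rightarrow> real" and \<Phi> :: "'a \<Rightarrow> complex"
  assumes "prob_space M" and [measurable]: "X \<in> borel_measurable M" "\<Phi> \<in> borel_measurable M"
    and \<Phi>: "\<And>x. norm (\<Phi> x) \<le> 1" and s: "Re s > 0"
  shows "(CLINT x|M. exp (- (s * of_real ((X x)\<^sup>2 / 2))) * \<Phi> x) =
    (CLINT y|lborel. exp ((1 / s) * of_real (- (y\<^sup>2) / 2)) * (CLINT x|M. \<Phi> x * iexp (y * X x))) / gauss_int 0 (1 / s)"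
proof -
  interpret M: prob_space M by fact
  interpret P: pair_sigma_finite M "lborel :: real measure" by standard
  let ?w = "\<lambda>y::real. exp ((1 / s) * of_real (- (y\<^sup>2) / 2)) :: complex"
  let ?f = "\<lambda>(x, y). \<Phi> x * (iexp (X x * y) * ?w y)"
  have w: "norm (?w y) = exp (Re (1 / s) * (- (y\<^sup>2) / 2))" for y
    by (rule norm_exp_mult_of_real)
  have iw: "integrable lborel (\<lambda>y. exp (Re (1 / s) * (- (y\<^sup>2) / 2)))"
    by (intro integrable_gaussian Re_inverse_pos s)
  have [measurable]: "?f \<in> borel_measurable (M \<Otimes>\<^sub>M lborel)"
    by measurable
  have b: "norm (\<Phi> x * (iexp (X x * y) * ?w y)) \<le> exp (Re (1 / s) * (- (y\<^sup>2) / 2))" for x y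
    unfolding norm_mult w using \<Phi>[of x] by (simp add: mult_left_le_one_le)
  have i1: "integrable lborel (\<lambda>y. \<Phi> x * (iexp (X x * y) * ?w y))" for x
    using b[of x] by (intro Bochner_Integration.integrable_bound[OF iw]) auto
  have int: "integrable (M \<Otimes>\<^sub>M lborel) ?f"
  proof (rule P.Fubini_integrable)
    show "integrable M (\<lambda>x. LINT y|lborel. norm (?f (x, y)))"
    proof (rule M.integrable_const_bound[where B = "LINT y|lborel. exp (Re (1 / s) * (- (y\<^sup>2) / 2))"])
      show "AE x in M. norm (LINT y|lborel. norm (?f (x, y))) \<le> (LINT y|lborel. exp (Re (1 / s) * (- (y\<^sup>2) / 2)))"
        using b i1 iw by (intro AE_I2) (auto intro!: integral_mono integrable_norm simp del: norm_mult norm_exp_eq_Re)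
    qed measurable
  qed (use i1 in auto)
  have "(CLINT x|M. exp (- (s * of_real ((X x)\<^sup>2 / 2))) * \<Phi> x)
    = (CLINT x|M. (CLINT y|lborel. ?f (x, y)) / gauss_int 0 (1 / s))"
    unfolding gauss_int_linearization[OF s] by (simp only: prod.case integral_mult_right_zero times_divide_eq_right times_divide_eq_left mult.commute)
  also have "\<dots> = (CLINT x|M. (CLINT y|lborel. ?f (x, y))) / gauss_int 0 (1 / s)"
    by simp
  also have "(CLINT x|M. (CLINT y|lborel. ?f (x, y))) = (CLINT y|lborel. (CLINT x|M. ?f (x, y)))"
    using P.Fubini_integral[of "\<lambda>x y. ?f (x, y)"] int by simp
  also have "(\<lambda>y. CLINT x|M. ?f (x, y)) = (\<lambda>y. ?w y * (CLINT x|M. \<Phi> x * iexp (y * X x)))"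
    by (subst integral_mult_right_zero[symmetric]) (auto simp: mult_ac)
  finally show ?thesis .
qed

text \<open>Each factor $\exp(-s X^2/2)$ is an average of $\exp(i y X)$ over real $y$ with an integrable complex weight.
  Hence convergence of characteristic functions of linear forms suffices, and dominated convergence is available
  for every $s$ with positive real part.\<close>
lemma quadratic_laplace_limit:
  fixes M :: "nat \<Rightarrow> 'a measure" and X :: "nat \<Rightarrow> 'r \<Rightarrow> 'a \<Rightarrow> real"
  assumes prob: "\<And>n. prob_space (M n)" and R: "finite R"
    and meas[measurable]: "\<And>n r. r \<in> R \<Longrightarrow> X n r \<in> borel_measurable (M n)"
    and lim: "\<And>y. (\<lambda>n. CLINT x|M n. iexp (\<Sum>r\<in>R. y r * X n r x)) \<longlonglongrightarrow> exp (- (\<Sum>r\<in>R. (y r)\<^sup>2) / 2)"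
    and A: "A \<subseteq> R" and s: "\<And>r. r \<in> A \<Longrightarrow> Re (s r) > 0"
    and y: "\<And>r. r \<in> A \<Longrightarrow> y r = 0"
  shows "(\<lambda>n. CLINT x|M n. exp (- (\<Sum>r\<in>A. s r * of_real ((X n r x)\<^sup>2 / 2))) * iexp (\<Sum>r\<in>R. y r * X n r x))
    \<longlonglongrightarrow> (\<Prod>r\<in>A. chi_mgf (s r)) * exp (- (\<Sum>r\<in>R. (y r)\<^sup>2) / 2)"
  using finite_subset[OF A R] A s y
proof (induction A arbitrary: y)
  case empty
  then show ?case using lim[of y] by simp
next
  case (insert r0 A)
  interpret prob_space "M n" for n by (rule prob)
  have r0: "r0 \<in> R" "Re (s r0) > 0" "y r0 = 0" and AR: "A \<subseteq> R" using insert.prems by auto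
  let ?a = "1 / s r0"
  have a: "Re ?a > 0" using r0 by (intro Re_inverse_pos)
  define Q where "Q n x = exp (- (\<Sum>r\<in>A. s r * of_real ((X n r x)\<^sup>2 / 2)))" for n x
  \<comment> \<open>The mode \<open>r0\<close> leaves the quadratic part and returns as a linear
    phase with frequency \<open>\<eta>\<close>. This is why the induction varies \<open>y\<close>,
    and why \<open>y\<close> has to vanish on the modes that are still quadratic.\<close>
  define I where "I n \<eta> = (CLINT x|M n. Q n x * iexp (\<Sum>r\<in>R. (y(r0 := \<eta>)) r * X n r x))" for n \<eta>
  have [measurable]: "Q n \<in> borel_measurable (M n)" for n
    unfolding Q_def using subsetD[OF AR] by measurable
  have Qle: "norm (Q n x) \<le> 1" for n x
    unfolding Q_def by (rule norm_exp_neg_quadratic_le) (use insert.prems in \<open>auto intro: less_imp_le\<close>)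
  have upd: "(\<Sum>r\<in>R. (y(r0 := \<eta>)) r * f r) = (\<Sum>r\<in>R. y r * f r) + \<eta> * f r0" for \<eta> and f :: "'r \<Rightarrow> real"
    using R r0 by (simp add: sum.remove[of R r0] cong: sum.cong_simp)
  have upd2: "(\<Sum>r\<in>R. ((y(r0 := \<eta>)) r)\<^sup>2) = (\<Sum>r\<in>R. (y r)\<^sup>2) + \<eta>\<^sup>2" for \<eta> :: real
    using R r0 by (simp add: sum.remove[of R r0] cong: sum.cong_simp)
  define E where "E = exp (- (\<Sum>r\<in>R. (y r)\<^sup>2) / 2)"
  have IH: "(\<lambda>n. I n \<eta>) \<longlonglongrightarrow> (\<Prod>r\<in>A. chi_mgf (s r)) * exp (- (\<Sum>r\<in>R. ((y(r0 := \<eta>)) r)\<^sup>2) / 2)" for \<eta>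
    unfolding I_def Q_def by (rule insert.IH) (use insert in auto)
  have I_le: "norm (I n \<eta>) \<le> 1" for n \<eta>
  proof -
    have "norm (I n \<eta>) \<le> (LINT x|M n. norm (Q n x * iexp (\<Sum>r\<in>R. (y(r0 := \<eta>)) r * X n r x)))"
      unfolding I_def by (rule integral_norm_bound)
    also have "\<dots> \<le> (LINT x|M n. 1)"
      by (rule integral_mono') (auto simp: norm_mult Qle)
    finally show ?thesis by (simp add: prob_space)
  qed
  have [measurable]: "I n \<in> borel_measurable lborel" for n
    using r0(1) prob_space_imp_sigma_finite[OF prob] unfolding I_def upd
    by (intro sigma_finite_measure.borel_measurable_lebesgue_integral) (auto intro: prob_space_imp_sigma_finite[OF prob])
  have "(CLINT x|M n. exp (- (\<Sum>r\<in>insert r0 A. s r * of_real ((X n r x)\<^sup>2 / 2))) * iexp (\<Sum>r\<in>R. y r * X n r x))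
    = (CLINT \<eta>|lborel. exp (?a * of_real (- (\<eta>\<^sup>2) / 2)) * I n \<eta>) / gauss_int 0 ?a" for n
  proof -
    have "(CLINT x|M n. exp (- (\<Sum>r\<in>insert r0 A. s r * of_real ((X n r x)\<^sup>2 / 2))) * iexp (\<Sum>r\<in>R. y r * X n r x))
      = (CLINT x|M n. exp (- (s r0 * of_real ((X n r0 x)\<^sup>2 / 2))) * (Q n x * iexp (\<Sum>r\<in>R. y r * X n r x)))"
      by (simp only: Q_def sum.insert[OF insert.hyps] minus_add_distrib exp_add mult.assoc)
    also have "\<dots> = (CLINT \<eta>|lborel. exp (?a * of_real (- (\<eta>\<^sup>2) / 2)) *
        (CLINT x|M n. (Q n x * iexp (\<Sum>r\<in>R. y r * X n r x)) * iexp (\<eta> * X n r0 x))) / gauss_int 0 ?a"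
      by (rule integral_gauss_linearization[OF prob])
         (use r0 Qle in \<open>auto simp: norm_mult intro!: borel_measurable_times\<close>)
    also have "(\<lambda>\<eta>. CLINT x|M n. (Q n x * iexp (\<Sum>r\<in>R. y r * X n r x)) * iexp (\<eta> * X n r0 x)) = I n"
      unfolding I_def upd by (simp add: exp_add[symmetric] algebra_simps)
    finally show ?thesis .
  qed
  moreover have "(\<lambda>n. CLINT \<eta>|lborel. exp (?a * of_real (- (\<eta>\<^sup>2) / 2)) * I n \<eta>)
      \<longlonglongrightarrow> (CLINT \<eta>|lborel. exp (?a * of_real (- (\<eta>\<^sup>2) / 2)) *
           ((\<Prod>r\<in>A. chi_mgf (s r)) * exp (- (\<Sum>r\<in>R. ((y(r0 := \<eta>)) r)\<^sup>2) / 2)))"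
  proof (rule integral_dominated_convergence[where w = "\<lambda>\<eta>. exp (Re ?a * (- (\<eta>\<^sup>2) / 2))"])
    show "integrable lborel (\<lambda>\<eta>. exp (Re ?a * (- (\<eta>\<^sup>2) / 2)))"
      by (rule integrable_gaussian[OF a])
    show "AE \<eta> in lborel. norm (exp (?a * of_real (- (\<eta>\<^sup>2) / 2)) * I n \<eta>) \<le> exp (Re ?a * (- (\<eta>\<^sup>2) / 2))" for n
      unfolding norm_mult norm_exp_mult_of_real using I_le by (intro AE_I2 mult_left_le) auto
    show "AE \<eta> in lborel. (\<lambda>n. exp (?a * of_real (- (\<eta>\<^sup>2) / 2)) * I n \<eta>) \<longlonglongrightarrow> exp (?a * of_real (- (\<eta>\<^sup>2) / 2)) *
           ((\<Prod>r\<in>A. chi_mgf (s r)) * exp (- (\<Sum>r\<in>R. ((y(r0 := \<eta>)) r)\<^sup>2) / 2))"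
      by (intro AE_I2 tendsto_mult_left IH)
  qed (unfold upd2, measurable)
  \<comment> \<open>The weight with parameter \<open>?a\<close> meets the limit factor exp(-\<eta>^2
    / 2), which raises the parameter to \<open>?a + 1\<close>: the numerator of
    \<open>chi_mgf\<close>.\<close>
  moreover have "(CLINT \<eta>|lborel. exp (?a * of_real (- (\<eta>\<^sup>2) / 2)) *
           ((\<Prod>r\<in>A. chi_mgf (s r)) * exp (- (\<Sum>r\<in>R. ((y(r0 := \<eta>)) r)\<^sup>2) / 2)))
     = (\<Prod>r\<in>A. chi_mgf (s r)) * of_real E * gauss_int 0 (?a + 1)"
  proof -
    have "exp (?a * of_real (- (\<eta>\<^sup>2) / 2)) * ((\<Prod>r\<in>A. chi_mgf (s r)) * exp (- (\<Sum>r\<in>R. ((y(r0 := \<eta>)) r)\<^sup>2) / 2))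
      = ((\<Prod>r\<in>A. chi_mgf (s r)) * of_real E) * (iexp (0 * \<eta>) * exp ((?a + 1) * of_real (- (\<eta>\<^sup>2) / 2)))" for \<eta>
    proof -
      have "exp (- ((\<Sum>r\<in>R. (y r)\<^sup>2) + \<eta>\<^sup>2) / 2) = E * exp (- (\<eta>\<^sup>2) / 2)"
        unfolding E_def exp_add[symmetric] by (simp add: field_simps)
      then show ?thesis
        unfolding upd2 distrib_right exp_add by (simp add: exp_of_real[symmetric] mult_ac del: exp_of_real)
    qed
    then show ?thesis unfolding gauss_int_def by (simp only: integral_mult_right_zero)
  qed
  ultimately have "(\<lambda>n. CLINT x|M n. exp (- (\<Sum>r\<in>insert r0 A. s r * of_real ((X n r x)\<^sup>2 / 2))) * iexp (\<Sum>r\<in>R. y r * X n r x))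
     \<longlonglongrightarrow> (\<Prod>r\<in>A. chi_mgf (s r)) * of_real E * gauss_int 0 (?a + 1) / gauss_int 0 ?a"
    by (simp add: tendsto_divide gauss_int_0_nonzero[OF a])
  then show ?case
    using insert.hyps by (simp add: E_def chi_mgf_def mult_ac)
qed

text \<open>A damping $\varepsilon X^2/2$ moves the imaginary parameters into the right half-plane; its effect is bounded by
  the second moments, uniformly in $n$.\<close>
lemma quadratic_char_limit:
  fixes M :: "nat \<Rightarrow> 'a measure" and X :: "nat \<Rightarrow> 'r \<Rightarrow> 'a \<Rightarrow> real" and \<tau> :: "'r \<Rightarrow> real"
  assumes prob: "\<And>n. prob_space (M n)" and R: "finite R"
    and meas[measurable]: "\<And>n r. r \<in> R \<Longrightarrow> X n r \<in> borel_measurable (M n)"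
    and lim: "\<And>y. (\<lambda>n. CLINT x|M n. iexp (\<Sum>r\<in>R. y r * X n r x)) \<longlonglongrightarrow> exp (- (\<Sum>r\<in>R. (y r)\<^sup>2) / 2)"
    and sq: "\<And>n r. r \<in> R \<Longrightarrow> integrable (M n) (\<lambda>x. (X n r x)\<^sup>2)"
      "\<And>n r. r \<in> R \<Longrightarrow> (LINT x|M n. (X n r x)\<^sup>2) \<le> K"
    and L: "((\<lambda>\<epsilon>. \<Prod>r\<in>R. chi_mgf (of_real \<epsilon> - \<i> * \<tau> r)) \<longlongrightarrow> L) (at_right (0::real))"
  shows "(\<lambda>n. CLINT x|M n. iexp (\<Sum>r\<in>R. \<tau> r * ((X n r x)\<^sup>2 / 2))) \<longlonglongrightarrow> L"
proof (rule tendstoI)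
  interpret prob_space "M n" for n by (rule prob)
  fix e :: real assume e: "e > 0"
  define S where "S n x = (\<Sum>r\<in>R. (X n r x)\<^sup>2 / 2)" for n x
  define Z where "Z n x = (\<Sum>r\<in>R. \<tau> r * ((X n r x)\<^sup>2 / 2))" for n x
  have [measurable]: "S n \<in> borel_measurable (M n)" "Z n \<in> borel_measurable (M n)" for n
    unfolding S_def Z_def by measurable
  have S0: "S n x \<ge> 0" for n x unfolding S_def by (intro sum_nonneg) auto
  have iS: "integrable (M n) (S n)" for n
    unfolding S_def by (intro Bochner_Integration.integrable_sum integrable_divide sq)
  define B where "B = (\<Sum>r\<in>R. K / 2)"
  have SB: "(LINT x|M n. S n x) \<le> B" for n
  proof -
    have "(LINT x|M n. S n x) = (\<Sum>r\<in>R. (LINT x|M n. (X n r x)\<^sup>2) / 2)"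
      unfolding S_def by (subst Bochner_Integration.integral_sum) (auto intro!: integrable_divide sq)
    also have "\<dots> \<le> B" unfolding B_def by (intro sum_mono divide_right_mono sq) auto
    finally show ?thesis .
  qed
  have B0: "B \<ge> 0"
    by (rule order_trans[OF _ SB[of 0]]) (intro integral_nonneg_AE AE_I2 S0)
  have "\<forall>\<^sub>F \<epsilon> in at_right (0::real). dist (\<Prod>r\<in>R. chi_mgf (of_real \<epsilon> - \<i> * \<tau> r)) L < e / 3"
    using L e by (intro tendstoD) auto
  \<comment> \<open>The 1 in \<open>B + 1\<close> keeps the denominator positive when
    \<open>B = 0\<close>.\<close>
  moreover have "\<forall>\<^sub>F \<epsilon> in at_right (0::real). \<epsilon> < e / (3 * (B + 1))"
    using e B0 by (intro eventually_at_rightI[of 0 "e / (3 * (B + 1))"]) auto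
  moreover have "\<forall>\<^sub>F \<epsilon> in at_right (0::real). \<epsilon> > 0"
    by (rule eventually_at_right_less)
  ultimately have "\<forall>\<^sub>F \<epsilon> in at_right (0::real). dist (\<Prod>r\<in>R. chi_mgf (of_real \<epsilon> - \<i> * \<tau> r)) L < e / 3
      \<and> \<epsilon> < e / (3 * (B + 1)) \<and> \<epsilon> > 0"
    by eventually_elim auto
  then obtain \<epsilon> :: real where \<epsilon>: "dist (\<Prod>r\<in>R. chi_mgf (of_real \<epsilon> - \<i> * \<tau> r)) L < e / 3"
      "\<epsilon> < e / (3 * (B + 1))" "\<epsilon> > 0"
    using eventually_happens'[OF trivial_limit_at_right_real] by blast
  have \<epsilon>B: "\<epsilon> * B < e / 3"
  proof -
    have "\<epsilon> * B \<le> \<epsilon> * (B + 1)" using \<epsilon> by simp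
    also have "\<dots> < e / (3 * (B + 1)) * (B + 1)" using \<epsilon> B0 by (intro mult_strict_right_mono) auto
    also have "\<dots> = e / 3"
    proof -
      have "e / (3 * c) * c = e / 3" if "c \<noteq> 0" for c :: real using that by simp
      then show ?thesis using B0 by (metis add_nonneg_eq_0_iff zero_le_one zero_neq_one)
    qed
    finally show ?thesis .
  qed
  have "(\<lambda>n. CLINT x|M n. exp (- (\<Sum>r\<in>R. (of_real \<epsilon> - \<i> * \<tau> r) * of_real ((X n r x)\<^sup>2 / 2))) * iexp (\<Sum>r\<in>R. 0 * X n r x))
    \<longlonglongrightarrow> (\<Prod>r\<in>R. chi_mgf (of_real \<epsilon> - \<i> * \<tau> r)) * of_real (exp (- (\<Sum>r\<in>R. (0::real)\<^sup>2) / 2))"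
    by (rule quadratic_laplace_limit[OF prob R meas lim, where y = "\<lambda>_. 0"]) (use \<epsilon> in auto)
  moreover have "exp (- (\<Sum>r\<in>R. (of_real \<epsilon> - \<i> * \<tau> r) * of_real ((X n r x)\<^sup>2 / 2))) * iexp (\<Sum>r\<in>R. 0 * X n r x)
     = of_real (exp (- (\<epsilon> * S n x))) * iexp (Z n x)" for n x
    unfolding S_def Z_def
    by (simp add: left_diff_distrib sum_subtractf diff_divide_distrib sum_distrib_left exp_of_real[symmetric] exp_add[symmetric] mult.assoc del: exp_of_real)
  ultimately have "(\<lambda>n. CLINT x|M n. of_real (exp (- (\<epsilon> * S n x))) * iexp (Z n x)) \<longlonglongrightarrow> (\<Prod>r\<in>R. chi_mgf (of_real \<epsilon> - \<i> * \<tau> r))"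
    by (simp only:) simp
  then have "\<forall>\<^sub>F n in sequentially. dist (CLINT x|M n. of_real (exp (- (\<epsilon> * S n x))) * iexp (Z n x)) (\<Prod>r\<in>R. chi_mgf (of_real \<epsilon> - \<i> * \<tau> r)) < e / 3"
    using e by (intro tendstoD) auto
  then show "\<forall>\<^sub>F n in sequentially. dist (CLINT x|M n. iexp (\<Sum>r\<in>R. \<tau> r * ((X n r x)\<^sup>2 / 2))) L < e"
  proof eventually_elim
    case (elim n)
    have i1: "integrable (M n) (\<lambda>x. iexp (Z n x))"
      by (intro integrable_const_bound[where B = 1]) auto
    have e1: "exp (- (\<epsilon> * S n x)) \<le> 1" for x using \<epsilon>(3) S0[of n x] by simp
    have i2: "integrable (M n) (\<lambda>x. of_real (exp (- (\<epsilon> * S n x))) * iexp (Z n x))"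
      by (intro integrable_const_bound[where B = 1]) (auto simp: norm_mult intro!: AE_I2 mult_nonneg_nonneg S0 less_imp_le[OF \<epsilon>(3)])
    have "norm ((CLINT x|M n. iexp (Z n x)) - (CLINT x|M n. of_real (exp (- (\<epsilon> * S n x))) * iexp (Z n x)))
      = norm (CLINT x|M n. iexp (Z n x) - of_real (exp (- (\<epsilon> * S n x))) * iexp (Z n x))"
      by (subst Bochner_Integration.integral_diff[OF i1 i2]) simp
    also have "\<dots> \<le> (LINT x|M n. norm (iexp (Z n x) - of_real (exp (- (\<epsilon> * S n x))) * iexp (Z n x)))"
      by (rule integral_norm_bound)
    also have "\<dots> \<le> (LINT x|M n. \<epsilon> * S n x)"
    proof (rule integral_mono')
      show "integrable (M n) (\<lambda>x. \<epsilon> * S n x)" using iS by simp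
      fix x
      show "0 \<le> \<epsilon> * S n x" by (intro mult_nonneg_nonneg S0 less_imp_le[OF \<epsilon>(3)])
      have "iexp (Z n x) - of_real (exp (- (\<epsilon> * S n x))) * iexp (Z n x)
        = of_real (1 - exp (- (\<epsilon> * S n x))) * iexp (Z n x)" by (simp add: algebra_simps)
      also have "norm \<dots> = 1 - exp (- (\<epsilon> * S n x))"
        unfolding norm_mult norm_of_real using e1[of x] by simp
      also have "\<dots> \<le> \<epsilon> * S n x"
        using exp_ge_add_one_self[of "- (\<epsilon> * S n x)"] by linarith
      finally show "norm (iexp (Z n x) - of_real (exp (- (\<epsilon> * S n x))) * iexp (Z n x)) \<le> \<epsilon> * S n x" .
    qed
    also have "\<dots> \<le> \<epsilon> * B" using SB[of n] \<epsilon>(3) by simp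
    also note \<epsilon>B
    finally have "dist (CLINT x|M n. iexp (Z n x)) (CLINT x|M n. of_real (exp (- (\<epsilon> * S n x))) * iexp (Z n x)) < e / 3"
      by (simp add: dist_norm)
    with elim \<epsilon>(1) have "dist (CLINT x|M n. iexp (Z n x)) L < e / 3 + e / 3 + e / 3"
      by (smt (verit) dist_triangle)
    then show ?case by (simp add: Z_def)
  qed
qed

section \<open>Sums of independent exponential variables\<close>

lemma real_distribution_convolution:
  assumes "real_distribution M" "real_distribution N"
  shows "real_distribution (M \<star> N)"
proof -
  interpret M: real_distribution M by fact
  interpret N: real_distribution N by fact
  interpret P: pair_prob_space M N ..
  show ?thesis unfolding convolution_def by (rule P.real_distribution_distr) simp
qed

lemma convolution_mgf:
  assumes "real_distribution M" "real_distribution N"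
    and iM: "integrable M (\<lambda>x. exp (Re z * x))" and iN: "integrable N (\<lambda>x. exp (Re z * x))"
  shows "integrable (M \<star> N) (\<lambda>x. exp (Re z * x))"
    and "complex_mgf (M \<star> N) z = complex_mgf M z * complex_mgf N z"
proof -
  interpret M: real_distribution M by fact
  interpret N: real_distribution N by fact
  interpret MN: real_distribution "M \<star> N" by (rule real_distribution_convolution) fact+
  interpret P: pair_prob_space M N ..
  have sets: "sets (M \<star> N) = sets borel" by (simp add: convolution_def)
  show int: "integrable (M \<star> N) (\<lambda>x. exp (Re z * x))"
  proof (rule integrableI_bounded)
    have "(\<integral>\<^sup>+ x. ennreal (norm (exp (Re z * x))) \<partial>(M \<star> N)) = (\<integral>\<^sup>+x. \<integral>\<^sup>+y. ennreal (exp (Re z * (x + y))) \<partial>N \<partial>M)"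
      by (subst nn_integral_convolution) (auto intro: M.finite_measure_axioms N.finite_measure_axioms)
    also have "\<dots> = (\<integral>\<^sup>+x. \<integral>\<^sup>+y. ennreal (exp (Re z * x)) * ennreal (exp (Re z * y)) \<partial>N \<partial>M)"
      by (simp add: distrib_left exp_add ennreal_mult')
    also have "\<dots> = (\<integral>\<^sup>+x. ennreal (exp (Re z * x)) \<partial>M) * (\<integral>\<^sup>+y. ennreal (exp (Re z * y)) \<partial>N)"
      by (simp add: nn_integral_cmult nn_integral_multc)
    also have "\<dots> < \<infinity>"
      using iM iN by (simp add: nn_integral_eq_integral ennreal_mult_less_top)
    finally show "(\<integral>\<^sup>+ x. ennreal (norm (exp (Re z * x))) \<partial>(M \<star> N)) < \<infinity>" .
  qed (simp add: sets)
  have "integrable (M \<star> N) (\<lambda>x. exp (z * of_real x))"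
    by (rule Bochner_Integration.integrable_bound[OF int]) (auto simp: sets)
  then have i: "integrable (M \<Otimes>\<^sub>M N) (\<lambda>(x, y). exp (z * of_real (x + y)))"
    unfolding convolution_def by (subst (asm) integrable_distr_eq) (auto simp: case_prod_unfold)
  have "complex_mgf (M \<star> N) z = (CLINT p|(M \<Otimes>\<^sub>M N). (case p of (x, y) \<Rightarrow> exp (z * of_real (x + y))))"
    unfolding convolution_def complex_mgf_def
    by (subst integral_distr) (auto simp: case_prod_unfold)
  also have "\<dots> = (CLINT x|M. CLINT y|N. exp (z * of_real (x + y)))"
    using P.integral_fst[OF i] by simp
  also have "\<dots> = complex_mgf M z * complex_mgf N z"
    by (simp add: complex_mgf_def distrib_left exp_add)
  finally show "complex_mgf (M \<star> N) z = complex_mgf M z * complex_mgf N z" .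
qed

text \<open>Negative \<open>a\<close> occur as well: independent variables for \<open>a\<close> and
  \<open>- a\<close> add up to a Laplace variable.\<close>

definition scaled_exponential :: "real \<Rightarrow> real measure" where
  "scaled_exponential a = distr (density lborel (exponential_density 1)) borel (\<lambda>x. a * x)"

lemma real_distribution_scaled_exponential: "real_distribution (scaled_exponential a)"
proof -
  interpret prob_space "density lborel (exponential_density 1)"
    by (rule prob_space_exponential_density) simp
  show ?thesis unfolding scaled_exponential_def by (rule real_distribution_distr) simp
qed

lemma exponential_density_nonneg': "l > 0 \<Longrightarrow> exponential_density l x \<ge> 0"
  by (simp add: exponential_density_def)

text \<open>Tilting the density of rate 1 by exp(r x) gives 1 / (1 - r) times the density of rate 1
  - r, whose total mass is 1.\<close>

lemma exponential_mgf_real: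
  assumes "r < 1"
  shows "has_bochner_integral (density lborel (exponential_density 1)) (\<lambda>x. exp (r * x)) (1 / (1 - r))"
proof (rule has_bochner_integral_density)
  interpret E: prob_space "density lborel (exponential_density (1 - r))"
    using assms by (intro prob_space_exponential_density) simp
  have "integrable (density lborel (exponential_density (1 - r))) (\<lambda>x. 1::real)"
    "(LINT x|density lborel (exponential_density (1 - r)). (1::real)) = 1"
    using E.prob_space by simp_all
  then have "has_bochner_integral lborel (\<lambda>x. exponential_density (1 - r) x *\<^sub>R (1::real)) 1"
    using assms unfolding has_bochner_integral_iff
    by (subst (asm) integrable_density, simp, simp add: exponential_density_nonneg', simp)
       (subst (asm) integral_density, auto simp: exponential_density_nonneg')
  then have "has_bochner_integral lborel (\<lambda>x. (1 / (1 - r)) * (exponential_density (1 - r) x *\<^sub>R (1::real))) ((1 / (1 - r)) * 1)"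
    by (rule has_bochner_integral_mult_right)
  also have "(\<lambda>x. (1 / (1 - r)) * (exponential_density (1 - r) x *\<^sub>R (1::real))) = (\<lambda>x. exponential_density 1 x *\<^sub>R exp (r * x))"
  proof
    fix x
    have "exp (- x * (1 - r)) = exp (- x) * exp (r * x)"
      by (simp add: exp_add[symmetric] algebra_simps)
    then show "(1 / (1 - r)) * (exponential_density (1 - r) x *\<^sub>R (1::real)) = exponential_density 1 x *\<^sub>R exp (r * x)"
      using assms by (simp add: exponential_density_def)
  qed
  finally show "has_bochner_integral lborel (\<lambda>x. exponential_density 1 x *\<^sub>R exp (r * x)) (1 / (1 - r))" by simp
qed (auto simp: exponential_density_nonneg')

text \<open>After scaling, the formula is known at real arguments in (0, 1) and continues to the
  half-plane Re w < 1, where the pole at 1 is avoided.\<close>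

lemma scaled_exponential_mgf:
  assumes "Re z * a < 1"
  shows "integrable (scaled_exponential a) (\<lambda>x. exp (Re z * x))"
    and "complex_mgf (scaled_exponential a) z = 1 / (1 - of_real a * z)"
proof -
  let ?E = "density lborel (exponential_density 1)"
  have int: "integrable ?E (\<lambda>x. exp (r * x))" if "r < 1" for r
    using exponential_mgf_real[OF that] by (simp add: has_bochner_integral_iff)
  show "integrable (scaled_exponential a) (\<lambda>x. exp (Re z * x))"
    unfolding scaled_exponential_def using int[of "Re z * a"] assms
    by (subst integrable_distr_eq) (auto simp: mult.assoc)
  define f where "f w = (CLINT x|?E. 1 * exp (w * of_real x)) - 1 / (1 - w)" for w
  have ne: "1 - w \<noteq> 0" if "Re w < 1" for w using that by auto
  have "f (of_real a * z) = 0"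
  proof (rule analytic_continuation[where f = f and S = "{w. Re w < 1}" and \<xi> = 0])
    show "0 islimpt (\<lambda>t::real. 0 + 1 * complex_of_real t) ` {0<..<1}"
      by (intro islimpt_segment) auto
    show "f holomorphic_on {w. Re w < 1}"
      unfolding f_def
      by (intro holomorphic_intros holomorphic_integral_exp[where B = 1] open_halfspace_Re_lt)
         (use ne int in auto)
    show "f w = 0" if "w \<in> (\<lambda>t::real. 0 + 1 * complex_of_real t) ` {0<..<1}" for w
    proof -
      from that obtain t :: real where t: "w = of_real t" "t < 1" by auto
      have "(CLINT x|?E. 1 * exp (w * of_real x)) = of_real (LINT x|?E. exp (t * x))"
        unfolding integral_complex_of_real[symmetric] by (simp add: t exp_of_real[symmetric] del: exp_of_real)
      also have "(LINT x|?E. exp (t * x)) = 1 / (1 - t)"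
        using exponential_mgf_real[OF t(2)] by (simp add: has_bochner_integral_iff)
      finally show ?thesis using t(2) by (simp add: f_def t(1))
    qed
  qed (use assms in \<open>auto simp: open_halfspace_Re_lt convex_connected convex_halfspace_Re_lt mult.commute\<close>)
  then have "(CLINT x|?E. exp (of_real a * z * of_real x)) = 1 / (1 - of_real a * z)" by (simp add: f_def)
  moreover have "complex_mgf (scaled_exponential a) z = (CLINT x|?E. exp (of_real a * z * of_real x))"
    unfolding complex_mgf_def scaled_exponential_def by (subst integral_distr) (auto simp: mult_ac)
  ultimately show "complex_mgf (scaled_exponential a) z = 1 / (1 - of_real a * z)" by simp
qed

lemma exists_exponential_sum_distribution:
  fixes a :: "'q \<Rightarrow> real"
  assumes "finite Q"
  shows "\<exists>\<mu>. real_distribution \<mu> \<and> (\<forall>z. (\<forall>q\<in>Q. Re z * a q < 1) \<longrightarrow>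
     integrable \<mu> (\<lambda>x. exp (Re z * x)) \<and> complex_mgf \<mu> z = (\<Prod>q\<in>Q. 1 / (1 - of_real (a q) * z)))"
  using assms
proof induction
  case empty
  interpret prob_space "return borel (0::real)" by (rule prob_space_return) simp
  have "real_distribution (return borel (0::real))"
    using real_distribution_distr[of "\<lambda>x. x"] by (simp add: distr_return)
  then show ?case
    by (intro exI[of _ "return borel 0"]) (auto simp: complex_mgf_def integral_return
         intro!: integrable_const_bound[where B = 1] simp: AE_return)
next
  case (insert q Q)
  then obtain \<mu> where \<mu>: "real_distribution \<mu>"
    "\<And>z. (\<forall>q\<in>Q. Re z * a q < 1) \<Longrightarrow> integrable \<mu> (\<lambda>x. exp (Re z * x)) \<and> complex_mgf \<mu> z = (\<Prod>q\<in>Q. 1 / (1 - of_real (a q) * z))"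
    by blast
  show ?case
  proof (intro exI[of _ "\<mu> \<star> scaled_exponential (a q)"] conjI allI impI)
    show "real_distribution (\<mu> \<star> scaled_exponential (a q))"
      by (intro real_distribution_convolution \<mu> real_distribution_scaled_exponential)
    fix z assume z: "\<forall>q\<in>insert q Q. Re z * a q < 1"
    note * = \<mu>(1) real_distribution_scaled_exponential \<mu>(2)[THEN conjunct1] scaled_exponential_mgf(1)
    show "integrable (\<mu> \<star> scaled_exponential (a q)) (\<lambda>x. exp (Re z * x))"
      using z by (intro convolution_mgf *) auto
    have "complex_mgf (\<mu> \<star> scaled_exponential (a q)) z = complex_mgf \<mu> z * complex_mgf (scaled_exponential (a q)) z"
      using z by (intro convolution_mgf *) auto
    then show "complex_mgf (\<mu> \<star> scaled_exponential (a q)) z = (\<Prod>q\<in>insert q Q. 1 / (1 - of_real (a q) * z))"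
      using z \<mu>(2)[of z] insert.hyps by (simp add: scaled_exponential_mgf)
  qed
qed

text \<open>For each fixed value of the first summand, the set of \<open>y\<close> with x + a y in a
  null set is again null, so the smooth summand hits it with probability 0. Nothing is asked of the
  regularity of \<open>M\<close>.\<close>

lemma absolutely_continuous_convolution_scaled_exponential:
  assumes "real_distribution M" "a \<noteq> 0"
  shows "absolutely_continuous lborel (M \<star> scaled_exponential a)"
  unfolding absolutely_continuous_def
proof
  interpret M: real_distribution M by fact
  interpret S: real_distribution "scaled_exponential a" by (rule real_distribution_scaled_exponential)
  fix A :: "real set" assume A: "A \<in> null_sets lborel"
  then have [measurable]: "A \<in> sets borel" by auto
  have em: "emeasure (M \<star> scaled_exponential a) A = (\<integral>\<^sup>+x. \<integral>\<^sup>+y. indicator A (x + y) \<partial>scaled_exponential a \<partial>M)"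
    by (rule convolution_emeasure') (auto intro: M.finite_measure_axioms S.finite_measure_axioms)
  have inner: "(\<integral>\<^sup>+y. indicator A (x + y) \<partial>scaled_exponential a) = 0" for x
  proof -
    have "ennreal \<bar>a\<bar> * (\<integral>\<^sup>+y. indicator A (x + a * y) \<partial>lborel) = (\<integral>\<^sup>+y. indicator A y \<partial>lborel)"
      by (rule nn_integral_real_affine[symmetric]) (use assms in auto)
    also have "\<dots> = 0" using A by auto
    finally have "(\<integral>\<^sup>+y. indicator A (x + a * y) \<partial>lborel) = 0" using assms by simp
    then have "AE y in lborel. indicator A (x + a * y) = (0::ennreal)"
      by (subst (asm) nn_integral_0_iff_AE) auto
    then have "AE y in lborel. ennreal (exponential_density 1 y) * indicator A (x + a * y) = 0" by auto
    moreover have "(\<integral>\<^sup>+y. indicator A (x + y) \<partial>scaled_exponential a) = (\<integral>\<^sup>+y. ennreal (exponential_density 1 y) * indicator A (x + a * y) \<partial>lborel)"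
      unfolding scaled_exponential_def by (subst nn_integral_distr) (auto simp: nn_integral_density)
    ultimately show ?thesis by (simp add: nn_integral_0_iff_AE)
  qed
  show "A \<in> null_sets (M \<star> scaled_exponential a)"
    using em[unfolded inner] by (intro null_setsI) (simp, simp add: convolution_def)
qed

section \<open>Tightness and weak limits\<close>

lemma tight_if_exponential_moments_bounded:
  assumes \<mu>: "\<And>m. real_distribution (\<mu> m)" and d: "d > 0"
    and int: "\<And>m z. \<bar>z\<bar> \<le> d \<Longrightarrow> integrable (\<mu> m) (\<lambda>x. exp (z * x))"
    and K: "\<And>m z. \<bar>z\<bar> \<le> d \<Longrightarrow> (LINT x|\<mu> m. exp (z * x)) \<le> K"
  shows "tight \<mu>"
  unfolding tight_def
proof (intro conjI allI impI \<mu>)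
  fix e :: real assume e: "e > 0"
  have K0: "K \<ge> 0"
    by (rule order_trans[OF _ K[of 0 0]]) (use d in \<open>auto intro: integral_nonneg_AE\<close>)
  \<comment> \<open>\<open>T\<close> is chosen for Markov's inequality with exp(d x) + exp(-d x):
    the tail is at most 2 K / exp(d T). The 1 in 2 K + 1 keeps the logarithm defined and the final
    inequality strict.\<close>
  define T where "T = max 1 (ln ((2 * K + 1) / e) / d)"
  have T: "T > 0" "ln ((2 * K + 1) / e) \<le> d * T" using d by (auto simp: T_def field_simps max_def)
  have eT: "(2 * K + 1) / e \<le> exp (d * T)"
  proof -
    have "(2 * K + 1) / e > 0" using e K0 by simp
    then have "(2 * K + 1) / e = exp (ln ((2 * K + 1) / e))" by simp
    also have "\<dots> \<le> exp (d * T)" using T(2) by simp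
    finally show ?thesis .
  qed
  show "\<exists>a b. a < b \<and> (\<forall>n. 1 - e < measure (\<mu> n) {a<..b})"
  proof (rule exI[of _ "- T"], rule exI[of _ T], intro conjI allI)
    show "- T < T" using T by simp
    fix m
    interpret real_distribution "\<mu> m" by (rule \<mu>)
    let ?f = "\<lambda>x. exp (d * x) + exp (- d * x)"
    have i: "integrable (\<mu> m) ?f" using int[of d m] int[of "- d" m] d by auto
    have "measure (\<mu> m) (- {- T<..T}) * exp (d * T) = (LINT x|\<mu> m. indicator (- {- T<..T}) x * exp (d * T))"
      by simp
    also have "\<dots> \<le> (LINT x|\<mu> m. ?f x)"
    proof (rule integral_mono)
      show "indicator (- {- T<..T}) x * exp (d * T) \<le> ?f x" for x
      proof (cases "x \<in> {- T<..T}")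
        case False
        then have "x \<le> - T \<or> x \<ge> T" by auto
        then have "d * T \<le> d * x \<or> d * T \<le> - d * x"
          using mult_left_mono[of T x d] mult_left_mono[of T "- x" d] d by auto
        then have "exp (d * T) \<le> exp (d * x) \<or> exp (d * T) \<le> exp (- d * x)" by simp
        then show ?thesis using False by (auto simp: add_increasing add_increasing2)
      qed (simp add: add_nonneg_nonneg)
    qed (use i in \<open>auto intro!: integrable_const_bound[where B = 1] AE_I2 simp: indicator_def\<close>)
    also have "\<dots> = (LINT x|\<mu> m. exp (d * x)) + (LINT x|\<mu> m. exp (- d * x))"
      using int[of d m] int[of "- d" m] d by simp
    also have "\<dots> \<le> 2 * K" using K[of d m] K[of "- d" m] d by simp
    finally have "measure (\<mu> m) (- {- T<..T}) \<le> 2 * K / exp (d * T)" by (simp add: field_simps)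
    also have "\<dots> < e"
    proof -
      have "2 * K < (2 * K + 1)" by simp
      also have "\<dots> \<le> e * exp (d * T)" using eT e by (simp add: field_simps)
      finally show ?thesis by (simp add: field_simps)
    qed
    finally have "measure (\<mu> m) (- {- T<..T}) < e" .
    moreover have "measure (\<mu> m) (- {- T<..T}) = 1 - measure (\<mu> m) {- T<..T}"
      using prob_compl[of "{- T<..T}"] by (simp add: Compl_eq_Diff_UNIV)
    ultimately show "1 - e < measure (\<mu> m) {- T<..T}" by simp
  qed
qed

text \<open>Weak convergence controls bounded continuous functions only. The exponential is
  therefore cut off at the level \<open>L\<close>, the bound passes to the limit, and monotone
  convergence in \<open>L\<close> removes the cut.\<close>

lemma weak_limit_exponential_moments:
  assumes \<mu>: "\<And>m. real_distribution (\<mu> m)" and R: "real_distribution R" and w: "weak_conv_m \<mu> R"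
    and int: "\<And>m. integrable (\<mu> m) (\<lambda>x. exp (z * x))"
    and K: "\<And>m. (LINT x|\<mu> m. exp (z * x)) \<le> K"
  shows "integrable R (\<lambda>x. exp (z * x))"
proof -
  interpret R: real_distribution R by fact
  define f where "f L x = min (exp (z * x)) (real L)" for L :: nat and x :: real
  have f0: "0 \<le> f L x" "f L x \<le> L" for L x by (auto simp: f_def)
  have meas: "f L \<in> borel_measurable borel" for L unfolding f_def by measurable
  have le: "(LINT x|R. f L x) \<le> K" for L
  proof -
    have "(\<lambda>m. LINT x|\<mu> m. f L x) \<longlonglongrightarrow> (LINT x|R. f L x)"
      by (rule weak_conv_imp_integral_bdd_continuous_conv[OF \<mu> R w, where B = L])
         (use f0 in \<open>auto simp: f_def intro!: continuous_intros\<close>)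
    then show ?thesis
    proof (rule LIMSEQ_le_const2, intro exI[of _ 0] allI impI)
      fix m
      interpret real_distribution "\<mu> m" by (rule \<mu>)
      have "(LINT x|\<mu> m. f L x) \<le> (LINT x|\<mu> m. exp (z * x))"
        by (rule integral_mono') (use int in \<open>auto simp: f_def\<close>)
      then show "(LINT x|\<mu> m. f L x) \<le> K" using K[of m] by simp
    qed
  qed
  have fi: "integrable R (f L)" for L
    by (rule R.integrable_const_bound[where B = L]) (use f0 meas in auto)
  have inc: "incseq (\<lambda>L. LINT x|R. f L x)"
    by (intro incseq_SucI integral_mono fi) (auto simp: f_def)
  obtain l where l: "(\<lambda>L. LINT x|R. f L x) \<longlonglongrightarrow> l"
    using incseq_convergent[OF inc, of K] le by blast
  show ?thesis
  proof (rule integrable_monotone_convergence[OF fi _ _ l])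
    show "AE x in R. mono (\<lambda>L. f L x)" by (intro AE_I2) (auto simp: mono_def f_def)
    show "AE x in R. (\<lambda>L. f L x) \<longlonglongrightarrow> exp (z * x)"
    proof (intro AE_I2)
      fix x
      obtain L0 :: nat where "exp (z * x) \<le> L0" using real_arch_simple by blast
      then have "\<forall>\<^sub>F L in sequentially. f L x = exp (z * x)"
        by (intro eventually_sequentiallyI[of L0]) (auto simp: f_def min_def)
      then show "(\<lambda>L. f L x) \<longlonglongrightarrow> exp (z * x)" by (rule tendsto_eventually)
    qed
  qed simp
qed

text \<open>A factor 1 / (1 + (c t)^2) is the characteristic function of a Laplace variable of scale
  c; the product belongs to an independent sum over a finite box of indices.\<close>

definition box_cf :: "(nat \<times> nat \<Rightarrow> real) \<Rightarrow> nat \<Rightarrow> real \<Rightarrow> real" where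
  "box_cf c m t = (\<Prod>q\<in>{..<m}\<times>{..<m}. 1 / (1 + (c q * t)\<^sup>2))"

text \<open>The factors lie in (0, 1] and the boxes grow, so the products decrease. Convergence of
  the full sequence lets a limit found along a subsequence identify it.\<close>

lemma box_cf_convergent: "convergent (\<lambda>m. box_cf c m t)"
proof (rule Bseq_monoseq_convergent)
  have f: "0 < 1 / (1 + (c q * t)\<^sup>2)" "1 / (1 + (c q * t)\<^sup>2) \<le> 1" for q
    by (simp_all add: add_pos_nonneg)
  have pos: "0 \<le> box_cf c m t" for m unfolding box_cf_def using f less_imp_le by (intro prod_nonneg) auto
  have dec: "box_cf c (Suc m) t \<le> box_cf c m t" for m
  proof -
    let ?g = "\<lambda>q. 1 / (1 + (c q * t)\<^sup>2)" and ?B = "\<lambda>m::nat. {..<m} \<times> {..<m}"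
    have "prod ?g (?B (Suc m)) = prod ?g (?B (Suc m) - ?B m) * prod ?g (?B m)"
      by (rule prod.subset_diff) auto
    also have "\<dots> \<le> 1 * prod ?g (?B m)"
      using f by (intro mult_right_mono prod_le_1 prod_nonneg) (auto intro: less_imp_le)
    finally show ?thesis by (simp add: box_cf_def)
  qed
  show "monoseq (\<lambda>m. box_cf c m t)" using dec by (simp add: monoseq_Suc)
  have "box_cf c m t \<le> 1" for m unfolding box_cf_def using f by (intro prod_le_1) (auto intro: less_imp_le)
  then show "Bseq (\<lambda>m. box_cf c m t)" using pos by (intro BseqI'[of _ 1]) auto
qed

lemma inverse_one_minus_le_exp:
  assumes "0 \<le> x" "x \<le> 1 / 2" shows "1 / (1 - x) \<le> exp (2 * x :: real)"
proof -
  have "1 \<le> (1 - x) * (1 + 2 * x)"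
    using mult_left_mono[OF assms(2) assms(1)] by (simp add: algebra_simps)
  also have "\<dots> \<le> (1 - x) * exp (2 * x)"
    using assms by (intro mult_left_mono exp_ge_add_one_self) auto
  finally show ?thesis using assms by (simp add: field_simps)
qed

text \<open>One exponential variable is left out of the sums and convolved back after the passage to the weak limit; this
  is what gives the limit a density.\<close>
lemma exists_limit_law:
  fixes c :: "nat \<times> nat \<Rightarrow> real"
  assumes c: "\<And>q. 0 \<le> c q" "\<And>q. c q \<le> 1 / 2" "c (0, 0) > 0"
    and S: "\<And>m. (\<Sum>q\<in>{..<m}\<times>{..<m}. (c q)\<^sup>2) \<le> S"
  shows "\<exists>W. real_distribution W \<and> absolutely_continuous lborel W \<and>
    (\<forall>z. \<bar>z\<bar> \<le> 1 \<longrightarrow> integrable W (\<lambda>x. exp (z * x))) \<and>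
    (\<forall>t. (\<lambda>m. complex_of_real (box_cf c m t)) \<longlonglongrightarrow> char W t)"
proof -
  define B where "B m = {..<m} \<times> {..<m}" for m :: nat
  define a where "a = (\<lambda>(q, b). if b then c q else - c q)"
  \<comment> \<open>With \<open>Suc m\<close> in place of \<open>m\<close> the box contains (0, 0)
    for every \<open>m\<close>, so the positive exponential variable at (0, 0) can always be left
    out.\<close>
  define Q where "Q m = B (Suc m) \<times> (UNIV :: bool set) - {((0, 0), True)}" for m
  have a_le: "Re z * a q < 1" if "\<bar>Re z\<bar> \<le> 1" for z q
  proof -
    have "\<bar>a q\<bar> \<le> 1 / 2" using c by (auto simp: a_def split: prod.splits)
    then have "\<bar>Re z\<bar> * \<bar>a q\<bar> \<le> 1 * (1 / 2)" using that by (intro mult_mono) auto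
    then show ?thesis by (simp add: abs_mult[symmetric])
  qed
  have "\<exists>\<mu>. real_distribution \<mu> \<and> (\<forall>z. (\<forall>q\<in>Q m. Re z * a q < 1) \<longrightarrow>
     integrable \<mu> (\<lambda>x. exp (Re z * x)) \<and> complex_mgf \<mu> z = (\<Prod>q\<in>Q m. 1 / (1 - of_real (a q) * z)))" for m
    by (rule exists_exponential_sum_distribution) (auto simp: Q_def B_def)
  then obtain \<mu> where \<mu>: "\<And>m. real_distribution (\<mu> m)"
    and int: "\<And>m z. \<bar>Re z\<bar> \<le> 1 \<Longrightarrow> integrable (\<mu> m) (\<lambda>x. exp (Re z * x))"
    and mgf: "\<And>m z. \<bar>Re z\<bar> \<le> 1 \<Longrightarrow> complex_mgf (\<mu> m) z = (\<Prod>q\<in>Q m. 1 / (1 - of_real (a q) * z))"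
    using choice[of "\<lambda>m \<mu>. real_distribution \<mu> \<and> (\<forall>z. (\<forall>q\<in>Q m. Re z * a q < 1) \<longrightarrow>
     integrable \<mu> (\<lambda>x. exp (Re z * x)) \<and> complex_mgf \<mu> z = (\<Prod>q\<in>Q m. 1 / (1 - of_real (a q) * z)))"] a_le
    by blast
  have factor: "complex_mgf (\<mu> m) z = (1 - c (0, 0) * z) * (\<Prod>q\<in>B (Suc m). 1 / (1 - (c q * z)\<^sup>2))"
    if z: "\<bar>Re z\<bar> \<le> 1" for z :: complex and m
  proof -
    let ?g = "\<lambda>q. 1 / (1 - of_real (a q) * z)"
    have "(\<Prod>q\<in>B (Suc m) \<times> UNIV. ?g q) = ?g ((0, 0), True) * (\<Prod>q\<in>Q m. ?g q)"
      unfolding Q_def by (rule prod.remove) (auto simp: B_def)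
    moreover have "(\<Prod>q\<in>B (Suc m) \<times> UNIV. ?g q) = (\<Prod>q\<in>B (Suc m). \<Prod>b\<in>UNIV. ?g (q, b))"
      by (subst prod.cartesian_product) (auto simp: case_prod_unfold)
    moreover have "(\<Prod>b\<in>UNIV. ?g (q, b)) = 1 / (1 - (c q * z)\<^sup>2)" for q
      by (simp add: UNIV_bool a_def power2_eq_square algebra_simps)
    moreover have nz: "1 - c (0, 0) * z \<noteq> 0"
    proof
      assume "1 - c (0, 0) * z = 0"
      then have "Re (c (0, 0) * z) = 1" by simp
      then show False using a_le[OF z, of "((0, 0), True)"] by (simp add: a_def mult.commute)
    qed
    ultimately have "(\<Prod>q\<in>Q m. ?g q) / (1 - c (0, 0) * z) = (\<Prod>q\<in>B (Suc m). 1 / (1 - (c q * z)\<^sup>2))"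
      by (simp add: a_def)
    then show ?thesis unfolding mgf[OF z, of m] nonzero_divide_eq_eq[OF nz] by (simp only: mult.commute)
  qed
  \<comment> \<open>The bound is uniform in \<open>m\<close>: 2 covers the factor of the omitted
    variable, and 1 / (1 - x) <= exp(2 x) turns the product into the exponential of a sum of
    squares, bounded by \<open>S\<close>.\<close>
  have K: "(LINT x|\<mu> m. exp (z * x)) \<le> 2 * exp (2 * S)" if z: "\<bar>z\<bar> \<le> 1" for z m
  proof -
    have "of_real (LINT x|\<mu> m. exp (x * z)) = complex_mgf (\<mu> m) (of_real z)"
      by (simp add: complex_mgf_of_real)
    also have "\<dots> = of_real ((1 - c (0, 0) * z) * (\<Prod>q\<in>B (Suc m). 1 / (1 - (c q * z)\<^sup>2)))"
      using z by (subst factor) auto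
    finally have "(LINT x|\<mu> m. exp (x * z)) = (1 - c (0, 0) * z) * (\<Prod>q\<in>B (Suc m). 1 / (1 - (c q * z)\<^sup>2))"
      by (simp only: of_real_eq_iff)
    also have "\<dots> \<le> 2 * exp (2 * S)"
    proof (rule mult_mono)
      have "\<bar>c (0, 0) * z\<bar> \<le> 1 * 1" unfolding abs_mult using c(1,2)[of "(0, 0)"] z by (intro mult_mono) auto
      then show "1 - c (0, 0) * z \<le> 2" by (simp add: abs_le_iff)
      have sq: "(c q * z)\<^sup>2 \<le> (c q)\<^sup>2" "(c q)\<^sup>2 \<le> 1 / 2" for q
      proof -
        have "(c q * z)\<^sup>2 = (c q)\<^sup>2 * z\<^sup>2" by (simp add: power_mult_distrib)
        also have "\<dots> \<le> (c q)\<^sup>2 * 1"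
          using z by (intro mult_left_mono) (auto simp: abs_square_le_1)
        finally show "(c q * z)\<^sup>2 \<le> (c q)\<^sup>2" by simp
        have "(c q)\<^sup>2 \<le> (1 / 2)\<^sup>2" using c by (intro power_mono) auto
        then show "(c q)\<^sup>2 \<le> 1 / 2" by (simp add: power2_eq_square)
      qed
      have h: "0 \<le> 1 - (c q * z)\<^sup>2" for q using sq[of q] by linarith
      have "1 / (1 - (c q * z)\<^sup>2) \<le> exp (2 * (c q)\<^sup>2)" for q
        using inverse_one_minus_le_exp[of "(c q * z)\<^sup>2"] sq[of q] by (auto intro: order_trans)
      then have "(\<Prod>q\<in>B (Suc m). 1 / (1 - (c q * z)\<^sup>2)) \<le> (\<Prod>q\<in>B (Suc m). exp (2 * (c q)\<^sup>2))"
        using h by (intro prod_mono conjI) auto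
      also have "\<dots> = exp (2 * (\<Sum>q\<in>B (Suc m). (c q)\<^sup>2))"
        by (simp add: exp_sum[symmetric] sum_distrib_left B_def)
      also have "\<dots> \<le> exp (2 * S)" using S[of "Suc m"] by (simp add: B_def)
      finally show "(\<Prod>q\<in>B (Suc m). 1 / (1 - (c q * z)\<^sup>2)) \<le> exp (2 * S)" .
      show "0 \<le> (\<Prod>q\<in>B (Suc m). 1 / (1 - (c q * z)\<^sup>2))" using h by (intro prod_nonneg) auto
    qed auto
    finally show ?thesis by (simp add: mult.commute)
  qed
  have int': "integrable (\<mu> m) (\<lambda>x. exp (z * x))" if "\<bar>z\<bar> \<le> 1" for z m
    using int[of "of_real z" m] that by simp
  have "tight \<mu>"
    by (rule tight_if_exponential_moments_bounded[OF \<mu>, of 1]) (use int' K in auto)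
  then obtain r R where r: "strict_mono (r :: nat \<Rightarrow> nat)" and R: "real_distribution R" and w: "weak_conv_m (\<mu> \<circ> id \<circ> r) R"
    using tight_imp_convergent_subsubsequence[of \<mu> id] by (auto simp: strict_mono_def)
  have w: "weak_conv_m (\<lambda>m. \<mu> (r m)) R" using w by (simp add: comp_def)
  have iR: "integrable R (\<lambda>x. exp (z * x))" if "\<bar>z\<bar> \<le> 1" for z
    by (rule weak_limit_exponential_moments[OF _ R w]) (use \<mu> int' K that in auto)
  define W where "W = (R \<star> scaled_exponential (c (0, 0)))"
  have cW: "integrable W (\<lambda>x. exp (Re z * x)) \<and> complex_mgf W z = complex_mgf R z * (1 / (1 - c (0, 0) * z))"
    if "\<bar>Re z\<bar> \<le> 1" for z :: complex
  proof -
    have "Re z * c (0, 0) < 1" using a_le[OF that, of "((0, 0), True)"] by (simp add: a_def)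
    note s = scaled_exponential_mgf[OF this]
    show ?thesis
      unfolding W_def using convolution_mgf[OF R real_distribution_scaled_exponential iR[OF that] s(1)] s(2)
      by simp
  qed
  show ?thesis
  proof (intro exI[of _ W] conjI allI impI)
    show "real_distribution W" unfolding W_def
      by (intro real_distribution_convolution R real_distribution_scaled_exponential)
    show "absolutely_continuous lborel W" unfolding W_def
      using c by (intro absolutely_continuous_convolution_scaled_exponential R) auto
    show "integrable W (\<lambda>x. exp (z * x))" if "\<bar>z\<bar> \<le> 1" for z using cW[of "of_real z"] that by simp
    fix t :: real
    have nz: "1 - c (0, 0) * (\<i> * t) \<noteq> 0" by (auto simp: complex_eq_iff)
    have "(\<lambda>m. char (\<mu> (r m)) t * (1 / (1 - c (0, 0) * (\<i> * t)))) \<longlonglongrightarrow> char R t * (1 / (1 - c (0, 0) * (\<i> * t)))"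
      by (intro tendsto_mult_right levy_continuity1[OF _ R w] \<mu>)
    also have "char R t * (1 / (1 - c (0, 0) * (\<i> * t))) = char W t"
      using cW[of "\<i> * t"] by (simp add: char_eq_complex_mgf)
    also have "(\<lambda>m. char (\<mu> (r m)) t * (1 / (1 - c (0, 0) * (\<i> * t)))) = (\<lambda>m. complex_of_real (box_cf c (Suc (r m)) t))"
      using nz by (simp add: char_eq_complex_mgf factor box_cf_def B_def power_mult_distrib)
    finally have sub: "(\<lambda>m. complex_of_real (box_cf c (Suc (r m)) t)) \<longlonglongrightarrow> char W t" .
    \<comment> \<open>Compactness gave the limit along \<open>r\<close> only; monotonicity of the
      products makes it the limit of the whole sequence.\<close>
    obtain l where l: "(\<lambda>m. box_cf c m t) \<longlonglongrightarrow> l"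
      using box_cf_convergent[of c t] unfolding convergent_def by blast
    then have l': "(\<lambda>m. complex_of_real (box_cf c m t)) \<longlonglongrightarrow> of_real l" by (rule tendsto_of_real)
    have "strict_mono (\<lambda>m. Suc (r m))" using r by (auto simp: strict_mono_def)
    from LIMSEQ_subseq_LIMSEQ[OF l' this] have "of_real l = char W t"
      using sub by (intro LIMSEQ_unique) (auto simp: comp_def)
    then show "(\<lambda>m. complex_of_real (box_cf c m t)) \<longlonglongrightarrow> char W t" using l' by simp
  qed
qed

section \<open>Even zeta values and Bernoulli numbers\<close>

lemma ln_one_plus_sums:
  assumes "\<bar>x\<bar> < (1::real)"
  shows "(\<lambda>l. (-1) ^ l * x ^ Suc l / real (Suc l)) sums ln (1 + x)"
proof -
  have "summable (\<lambda>n. (-1) ^ n * (1 / real (n + 1)) * x ^ Suc n)"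
  proof (rule summable_comparison_test[OF _ summable_geometric[of "\<bar>x\<bar>"]], intro exI allI impI)
    fix n :: nat
    have "norm ((-1) ^ n * (1 / real (n + 1)) * x ^ Suc n) = \<bar>x\<bar> ^ n * (\<bar>x\<bar> / real (Suc n))"
      by (simp add: abs_mult power_abs)
    also have "\<dots> \<le> \<bar>x\<bar> ^ n * 1" using assms by (intro mult_left_mono) (auto simp: divide_le_eq)
    finally show "norm ((-1) ^ n * (1 / real (n + 1)) * x ^ Suc n) \<le> \<bar>x\<bar> ^ n" by simp
  qed (use assms in auto)
  then have "(\<lambda>n. (-1) ^ n * (1 / real (n + 1)) * x ^ Suc n) sums ln (1 + x)"
    using ln_series[of "1 + x"] assms by (simp add: sums_iff)
  then show ?thesis by (simp add: field_simps)
qed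

text \<open>The logarithm of the product is a power series in \<open>t\<close> whose coefficients
  are power sums of \<open>c\<close>. Since c^(2 l + 2) <= c^2 \<rho>^(2 l), the l-th term is at
  most t^2 S (\<rho> t)^(2 l) for every \<open>m\<close>, and Tannery's theorem exchanges the limit
  with the series. It serves both the sine product and the limit law.\<close>

lemma prod_one_plus_square_tendsto:
  fixes c :: "'q \<Rightarrow> real" and B :: "nat \<Rightarrow> 'q set"
  assumes B: "\<And>m. finite (B m)" and c: "\<And>q. 0 \<le> c q" "\<And>q. c q \<le> \<rho>" and t: "\<rho> * \<bar>t\<bar> < 1"
    and S: "\<And>m. (\<Sum>q\<in>B m. (c q)\<^sup>2) \<le> S"
    and s: "\<And>l. (\<lambda>m. \<Sum>q\<in>B m. c q ^ (2 * Suc l)) \<longlonglongrightarrow> s l"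
  shows "summable (\<lambda>l. norm ((-1) ^ l * t ^ (2 * Suc l) / real (Suc l) * s l))"
    and "(\<lambda>m. \<Prod>q\<in>B m. 1 + (c q * t)\<^sup>2) \<longlonglongrightarrow> exp (\<Sum>l. (-1) ^ l * t ^ (2 * Suc l) / real (Suc l) * s l)"
proof -
  define a where "a l m = (-1) ^ l * t ^ (2 * Suc l) / real (Suc l) * (\<Sum>q\<in>B m. c q ^ (2 * Suc l))" for l m
  have \<rho>: "\<rho> \<ge> 0" using c[of undefined] by linarith
  have lt: "(c q * t)\<^sup>2 < 1" for q
  proof -
    have "\<bar>c q * t\<bar> \<le> \<rho> * \<bar>t\<bar>" unfolding abs_mult using c by (intro mult_right_mono) auto
    then show ?thesis using t abs_square_less_1[of "c q * t"] by linarith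
  qed
  have ln: "ln (\<Prod>q\<in>B m. 1 + (c q * t)\<^sup>2) = (\<Sum>l. a l m)" for m
  proof -
    have "ln (\<Prod>q\<in>B m. 1 + (c q * t)\<^sup>2) = (\<Sum>q\<in>B m. ln (1 + (c q * t)\<^sup>2))"
      using B by (intro ln_prod) (auto simp: add_nonneg_eq_0_iff)
    moreover have "(\<lambda>l. \<Sum>q\<in>B m. (-1) ^ l * ((c q * t)\<^sup>2) ^ Suc l / real (Suc l)) sums (\<Sum>q\<in>B m. ln (1 + (c q * t)\<^sup>2))"
      using lt by (intro sums_sum ln_one_plus_sums) auto
    moreover have "(\<Sum>q\<in>B m. (-1) ^ l * ((c q * t)\<^sup>2) ^ Suc l / real (Suc l)) = a l m" for l
      unfolding a_def sum_distrib_left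
      by (intro sum.cong refl)
         (simp only: power_mult_distrib power_mult[symmetric] times_divide_eq_left times_divide_eq_right mult_ac)
    ultimately show ?thesis by (simp add: sums_iff)
  qed
  have T: "(\<forall>\<^sub>F m in sequentially. summable (\<lambda>l. norm (a l m))) \<and>
     summable (\<lambda>l. norm ((-1) ^ l * t ^ (2 * Suc l) / real (Suc l) * s l)) \<and>
     (\<lambda>m. \<Sum>l. a l m) \<longlonglongrightarrow> (\<Sum>l. (-1) ^ l * t ^ (2 * Suc l) / real (Suc l) * s l)"
  proof (rule tannerys_theorem[where M = "\<lambda>l. (t\<^sup>2 * S) * ((\<rho> * t)\<^sup>2) ^ l"])
    show "((\<lambda>m. a l m) \<longlongrightarrow> (-1) ^ l * t ^ (2 * Suc l) / real (Suc l) * s l) sequentially" for l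
      unfolding a_def by (intro tendsto_mult_left s)
    have "norm (a l m) \<le> (t\<^sup>2 * S) * ((\<rho> * t)\<^sup>2) ^ l" for l m
    proof -
      have "(\<Sum>q\<in>B m. c q ^ (2 * Suc l)) \<le> (\<Sum>q\<in>B m. (c q)\<^sup>2 * \<rho> ^ (2 * l))"
      proof (rule sum_mono)
        fix q
        have "c q ^ (2 * Suc l) = (c q)\<^sup>2 * c q ^ (2 * l)" by (simp add: power_add[symmetric])
        also have "\<dots> \<le> (c q)\<^sup>2 * \<rho> ^ (2 * l)" using c by (intro mult_left_mono power_mono) auto
        finally show "c q ^ (2 * Suc l) \<le> (c q)\<^sup>2 * \<rho> ^ (2 * l)" .
      qed
      also have "\<dots> \<le> S * \<rho> ^ (2 * l)" unfolding sum_distrib_right[symmetric]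
        using S[of m] \<rho> by (intro mult_right_mono) auto
      finally have le: "(\<Sum>q\<in>B m. c q ^ (2 * Suc l)) \<le> S * \<rho> ^ (2 * l)" .
      have nn: "0 \<le> (\<Sum>q\<in>B m. c q ^ (2 * Suc l))" using c by (intro sum_nonneg) auto
      have "norm (a l m) = \<bar>t\<bar> ^ (2 * Suc l) / real (Suc l) * (\<Sum>q\<in>B m. c q ^ (2 * Suc l))"
        unfolding a_def using nn by (simp add: abs_mult power_abs del: power_Suc mult_Suc_right)
      also have "\<dots> \<le> \<bar>t\<bar> ^ (2 * Suc l) * (S * \<rho> ^ (2 * l))"
      proof (rule mult_mono[OF _ le])
        have "\<bar>t\<bar> ^ (2 * Suc l) * 1 \<le> \<bar>t\<bar> ^ (2 * Suc l) * real (Suc l)"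
          by (intro mult_left_mono) auto
        then show "\<bar>t\<bar> ^ (2 * Suc l) / real (Suc l) \<le> \<bar>t\<bar> ^ (2 * Suc l)"
          by (simp only: pos_divide_le_eq of_nat_0_less_iff zero_less_Suc mult_1_right)
      qed (use nn in auto)
      also have "\<dots> = (t\<^sup>2 * S) * ((\<rho> * t)\<^sup>2) ^ l"
      proof -
        have "\<bar>t\<bar> ^ (2 * Suc l) = t\<^sup>2 * (t\<^sup>2) ^ l" "\<rho> ^ (2 * l) = (\<rho>\<^sup>2) ^ l"
          by (simp_all only: power_mult power2_abs power_Suc)
        then show ?thesis by (simp add: power_mult_distrib mult_ac)
      qed
      finally show ?thesis .
    qed
    then show "\<forall>\<^sub>F (l, m) in sequentially \<times>\<^sub>F sequentially. norm (a l m) \<le> (t\<^sup>2 * S) * ((\<rho> * t)\<^sup>2) ^ l"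
      by (intro always_eventually) auto
    have "\<bar>\<rho> * t\<bar> < 1" using t \<rho> by (simp add: abs_mult)
    then show "summable (\<lambda>l. (t\<^sup>2 * S) * ((\<rho> * t)\<^sup>2) ^ l)"
      by (intro summable_mult summable_geometric) (simp add: abs_square_less_1)
  qed simp
  then show "summable (\<lambda>l. norm ((-1) ^ l * t ^ (2 * Suc l) / real (Suc l) * s l))" by simp
  have "(\<lambda>m. exp (\<Sum>l. a l m)) \<longlonglongrightarrow> exp (\<Sum>l. (-1) ^ l * t ^ (2 * Suc l) / real (Suc l) * s l)"
    using T by (intro tendsto_exp) auto
  moreover have "exp (\<Sum>l. a l m) = (\<Prod>q\<in>B m. 1 + (c q * t)\<^sup>2)" for m
    unfolding ln[symmetric] by (intro exp_ln prod_pos) (auto simp: add_pos_nonneg)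
  ultimately show "(\<lambda>m. \<Prod>q\<in>B m. 1 + (c q * t)\<^sup>2) \<longlonglongrightarrow> exp (\<Sum>l. (-1) ^ l * t ^ (2 * Suc l) / real (Suc l) * s l)"
    by simp
qed

text \<open>This is zeta(2 l), indexed from 0. At \<open>l = 0\<close> the series diverges and the
  value has no meaning.\<close>

definition even_zeta :: "nat \<Rightarrow> real" where
  "even_zeta l = (\<Sum>q. (1 / (real q + 1)) ^ (2 * l))"

lemma sums_inverse_Suc_square: "(\<lambda>q. (1 / (real q + 1))\<^sup>2) sums (pi\<^sup>2 / 6)"
  using inverse_squares_sums by (simp add: power_divide add.commute)

lemma even_zeta_sums:
  assumes "l > 0" shows "(\<lambda>q. (1 / (real q + 1)) ^ (2 * l)) sums even_zeta l"
proof -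
  have "summable (\<lambda>q. (1 / (real q + 1)) ^ (2 * l))"
  proof (rule summable_comparison_test[OF _ sums_summable[OF sums_inverse_Suc_square]], intro exI allI impI)
    fix q :: nat
    have "(1 / (real q + 1)) ^ (2 * l) \<le> (1 / (real q + 1)) ^ 2"
      using assms by (intro power_decreasing) auto
    then show "norm ((1 / (real q + 1)) ^ (2 * l)) \<le> (1 / (real q + 1))\<^sup>2" by simp
  qed
  then show ?thesis unfolding even_zeta_def by (rule summable_sums)
qed

lemma even_zeta_partial_le:
  "(\<Sum>q<m. (1 / (real q + 1))\<^sup>2) \<le> pi\<^sup>2 / 6"
  using sum_le_suminf[OF sums_summable[OF sums_inverse_Suc_square], of "{..<m}"] sums_inverse_Suc_square
  by (simp add: sums_iff)

text \<open>Among the first 2 m reciprocals the even ones are 1/2 times the first m, which gives an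
  exact identity between partial sums before any limit is taken.\<close>

lemma odd_zeta_limit:
  assumes "l > 0"
  shows "(\<lambda>m. \<Sum>p<m. (1 / (2 * real p + 1)) ^ (2 * l)) \<longlonglongrightarrow> (1 - (1 / 2) ^ (2 * l)) * even_zeta l"
proof -
  let ?f = "\<lambda>q. (1 / (real q + 1)) ^ (2 * l)"
  have "(\<Sum>p<m. (1 / (2 * real p + 1)) ^ (2 * l)) = (\<Sum>q<2 * m. ?f q) - (1 / 2) ^ (2 * l) * (\<Sum>q<m. ?f q)" for m
  proof (induction m)
    case (Suc m)
    have "?f (2 * m + 1) = (1 / 2) ^ (2 * l) * ?f m"
      unfolding power_mult_distrib[symmetric] by (simp add: field_simps)
    then show ?case using Suc by (simp add: algebra_simps)
  qed simp
  moreover have f: "(\<lambda>m. \<Sum>q<m. ?f q) \<longlonglongrightarrow> even_zeta l"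
    using even_zeta_sums[OF assms] by (simp add: sums_def)
  moreover have "(\<lambda>m. \<Sum>q<2 * m. ?f q) \<longlonglongrightarrow> even_zeta l"
    using LIMSEQ_subseq_LIMSEQ[OF f, of "\<lambda>m. 2 * m"] by (simp add: comp_def strict_mono_def)
  ultimately have "(\<lambda>m. \<Sum>p<m. (1 / (2 * real p + 1)) ^ (2 * l)) \<longlonglongrightarrow> even_zeta l - (1 / 2) ^ (2 * l) * even_zeta l"
    by (simp only:) (intro tendsto_intros)
  then show ?thesis by (simp add: algebra_simps)
qed

lemma even_zeta_abs_le: "l > 0 \<Longrightarrow> \<bar>even_zeta l\<bar> \<le> pi\<^sup>2 / 6"
proof -
  assume l: "l > 0"
  have "even_zeta l \<le> pi\<^sup>2 / 6"
  proof (rule sums_le[OF _ even_zeta_sums[OF l] sums_inverse_Suc_square])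
    show "(1 / (real q + 1)) ^ (2 * l) \<le> (1 / (real q + 1))\<^sup>2" for q
      using l by (intro power_decreasing) auto
  qed
  moreover have "0 \<le> even_zeta l"
    by (rule sums_le[OF _ sums_zero even_zeta_sums[OF l]]) auto
  ultimately show ?thesis by simp
qed

text \<open>Euler's product for the sine at the imaginary point i x gives sinh(pi x) = pi x prod (1
  + x^2 / k^2). Its logarithm is expanded in power sums, which are the even zeta values.\<close>

lemma sinh_eq_exp_series:
  assumes x: "\<bar>x\<bar> < (1::real)"
  shows "exp (pi * x) - exp (- (pi * x)) =
    2 * pi * x * exp (\<Sum>l. (-1) ^ l * x ^ (2 * Suc l) / real (Suc l) * even_zeta (Suc l))"
proof -
  let ?P = "\<lambda>m. \<Prod>k = 1..m. 1 + x\<^sup>2 / (real k)\<^sup>2"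
  have "(\<lambda>m. \<Prod>q\<in>{..<m}. 1 + (1 / (real q + 1) * x)\<^sup>2) \<longlonglongrightarrow>
      exp (\<Sum>l. (-1) ^ l * x ^ (2 * Suc l) / real (Suc l) * even_zeta (Suc l))"
  proof (rule prod_one_plus_square_tendsto(2)[where \<rho> = 1 and S = "pi\<^sup>2 / 6"])
    show "(\<lambda>m. \<Sum>q\<in>{..<m}. (1 / (real q + 1)) ^ (2 * Suc l)) \<longlonglongrightarrow> even_zeta (Suc l)" for l
      using even_zeta_sums[of "Suc l"] by (simp add: sums_def)
  qed (use x even_zeta_partial_le in auto)
  moreover have "(\<Prod>q\<in>{..<m}. 1 + (1 / (real q + 1) * x)\<^sup>2) = ?P m" for m
    by (rule prod.reindex_bij_witness[of _ "\<lambda>k. k - 1" Suc]) (auto simp: power_divide add.commute)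
  ultimately have P: "?P \<longlonglongrightarrow> exp (\<Sum>l. (-1) ^ l * x ^ (2 * Suc l) / real (Suc l) * even_zeta (Suc l))" by simp
  have "(\<lambda>m. of_real pi * (\<i> * x) * (\<Prod>k = 1..m. 1 - (\<i> * x)\<^sup>2 / (of_nat k)\<^sup>2)) \<longlonglongrightarrow> sin (of_real pi * (\<i> * x))"
    by (rule sin_product_formula_complex)
  moreover have "of_real pi * (\<i> * x) * (\<Prod>k = 1..m. 1 - (\<i> * x)\<^sup>2 / (of_nat k)\<^sup>2) = \<i> * of_real (pi * x * ?P m)" for m
    by (simp add: power_mult_distrib)
  ultimately have "(\<lambda>m. \<i> * of_real (pi * x * ?P m)) \<longlonglongrightarrow> sin (of_real pi * (\<i> * x))" by (simp only:)
  then have "(\<lambda>m. Im (\<i> * of_real (pi * x * ?P m))) \<longlonglongrightarrow> Im (sin (of_real pi * (\<i> * x)))"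
    by (rule tendsto_Im)
  moreover have "Im (sin (of_real pi * (\<i> * x))) = (exp (pi * x) - exp (- (pi * x))) / 2"
    by (simp add: Im_sin)
  moreover have "Im (\<i> * of_real r) = r" for r by simp
  ultimately have "(\<lambda>m. pi * x * ?P m) \<longlonglongrightarrow> (exp (pi * x) - exp (- (pi * x))) / 2" by (simp only:)
  from LIMSEQ_unique[OF this tendsto_mult_left[OF P]] show ?thesis by simp
qed

text \<open>A nonzero convergent power series has no zeros in some punctured disc around 0. This
  turns an identity of functions on a real interval into one of coefficients.\<close>

lemma real_fps_eq_zero:
  fixes F :: "real fps"
  assumes r: "fps_conv_radius F > 0" and d: "d > 0" and z: "\<And>x. 0 \<le> x \<Longrightarrow> x < d \<Longrightarrow> eval_fps F x = 0"
  shows "F = 0"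
proof (rule ccontr)
  assume "F \<noteq> 0"
  then obtain m where m: "fps_nth F m \<noteq> 0" by (auto simp: fps_eq_iff)
  have "fps_nth F 0 = 0" using z[of 0] d by (simp add: eval_fps_at_0)
  then have "m > 0" using m by (cases m) auto
  obtain e where e: "0 < e" "ereal e < fps_conv_radius F"
    using ereal_dense2[OF r] by (auto simp: zero_ereal_def)
  obtain s where s: "0 < s" "\<And>x. x \<in> cball 0 s - {0} \<Longrightarrow> eval_fps F x \<noteq> 0"
  proof (rule powser_0_nonzero[where a = "fps_nth F" and f = "eval_fps F" and \<xi> = 0 and r = e and m = m])
    show "(\<lambda>n. fps_nth F n * (x - 0) ^ n) sums eval_fps F x" if "norm (x - 0) < e" for x
      using that e by (auto intro!: sums_eval_fps elim: order_less_trans[rotated] intro: less_ereal.simps(1)[THEN iffD2, THEN order_less_trans])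
  qed (use e z[of 0] d m \<open>m > 0\<close> in auto)
  define y where "y = min (d / 2) s"
  have "0 < y" "y < d" "y \<le> s" using s(1) d by (auto simp: y_def)
  then show False using s(2)[of y] z[of y] by auto
qed

text \<open>Taylor coefficients of $\log(\sinh(\pi x)/(\pi x))$.\<close>
definition zeta_log_coeff :: "nat \<Rightarrow> real" where
  "zeta_log_coeff n = (if even n \<and> n > 0 then (-1) ^ (n div 2 - 1) * 2 * even_zeta (n div 2) / real n else 0)"

lemma zeta_log_coeff_sums:
  assumes x: "\<bar>x\<bar> < (1::real)"
  shows "(\<lambda>n. zeta_log_coeff n * x ^ n) sums
    (\<Sum>l. (-1) ^ l * x ^ (2 * Suc l) / real (Suc l) * even_zeta (Suc l))"
proof -
  have "summable (\<lambda>l. norm ((-1) ^ l * x ^ (2 * Suc l) / real (Suc l) * even_zeta (Suc l)))"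
  proof (rule prod_one_plus_square_tendsto(1)[where \<rho> = 1 and S = "pi\<^sup>2 / 6" and B = "\<lambda>m. {..<m}" and c = "\<lambda>q. 1 / (real q + 1)"])
    show "(\<lambda>m. \<Sum>q\<in>{..<m}. (1 / (real q + 1)) ^ (2 * Suc l)) \<longlonglongrightarrow> even_zeta (Suc l)" for l
      using even_zeta_sums[of "Suc l"] by (simp add: sums_def)
  qed (use x even_zeta_partial_le in auto)
  then have "summable (\<lambda>l. (-1) ^ l * x ^ (2 * Suc l) / real (Suc l) * even_zeta (Suc l))"
    by (rule summable_norm_cancel)
  then have "(\<lambda>l. (-1) ^ l * x ^ (2 * Suc l) / real (Suc l) * even_zeta (Suc l)) sums
      (\<Sum>l. (-1) ^ l * x ^ (2 * Suc l) / real (Suc l) * even_zeta (Suc l))" by (rule summable_sums)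
  moreover have eq: "(-1) ^ l * x ^ (2 * Suc l) / real (Suc l) * even_zeta (Suc l) = zeta_log_coeff (2 * Suc l) * x ^ (2 * Suc l)" for l
    by (auto simp: zeta_log_coeff_def field_simps)
  ultimately have *: "(\<lambda>l. zeta_log_coeff (2 * Suc l) * x ^ (2 * Suc l)) sums
      (\<Sum>l. zeta_log_coeff (2 * Suc l) * x ^ (2 * Suc l))" by (simp only:)
  have "zeta_log_coeff n = 0" if "n \<notin> range (\<lambda>l. 2 * Suc l)" for n
  proof (rule ccontr)
    assume "zeta_log_coeff n \<noteq> 0"
    then have "even n" "n > 0" by (auto simp: zeta_log_coeff_def split: if_splits)
    then have "n = 2 * Suc (n div 2 - 1)" by auto
    with that show False by blast
  qed
  then show ?thesis
    unfolding eq
    using sums_mono_reindex[of "\<lambda>l. 2 * Suc l" "\<lambda>n. zeta_log_coeff n * x ^ n"] *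
    by (simp only: strict_mono_def mult_zero_left) auto
qed

text \<open>The operator x d/dx applied to log(sinh(pi x) / (pi x)), that is, the expansion of pi x
  coth(pi x) - 1.\<close>

definition zeta_fps :: "real fps" where
  "zeta_fps = Abs_fps (\<lambda>n. real n * zeta_log_coeff n)"

lemma zeta_fps_conv_radius: "fps_conv_radius zeta_fps \<ge> 1"
  unfolding fps_conv_radius_def
proof (rule conv_radius_geI_ex')
  fix r :: real assume r: "0 < r" "ereal r < 1"
  then have r1: "r < 1" by simp
  have s1: "summable (\<lambda>n. (2 * (pi\<^sup>2 / 6)) * r ^ n)"
    using r r1 by (intro summable_mult summable_geometric) auto
  have s2: "norm (fps_nth zeta_fps n * r ^ n) \<le> (2 * (pi\<^sup>2 / 6)) * r ^ n" for n
  proof -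
    have "\<bar>real n * zeta_log_coeff n\<bar> \<le> 2 * (pi\<^sup>2 / 6)"
      using even_zeta_abs_le[of "n div 2"]
      by (auto simp: zeta_log_coeff_def abs_mult elim!: evenE)
    then show ?thesis using r by (auto simp: zeta_fps_def abs_mult intro!: mult_right_mono)
  qed
  have "summable (\<lambda>n. fps_nth zeta_fps n * r ^ n)"
    by (rule summable_comparison_test'[OF s1, of 0]) (rule s2)
  then show "summable (\<lambda>n. fps_nth zeta_fps n * of_real r ^ n)" by simp
qed

text \<open>Logarithmic differentiation of the product formula, written without quotients so that x
  = 0 is included.\<close>

lemma sinh_log_derivative:
  assumes x: "\<bar>x\<bar> < (1::real)"
  shows "pi * x * (exp (pi * x) + exp (- (pi * x))) = (1 + eval_fps zeta_fps x) * (exp (pi * x) - exp (- (pi * x)))"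
proof -
  define H where "H y = (\<Sum>n. zeta_log_coeff n * y ^ n)" for y
  have eq: "exp (pi * y) - exp (- (pi * y)) = 2 * pi * y * exp (H y)" if "\<bar>y\<bar> < 1" for y
    using sinh_eq_exp_series[OF that] zeta_log_coeff_sums[OF that] by (simp add: H_def sums_iff)
  define D where "D = (\<Sum>n. diffs zeta_log_coeff n * x ^ n)"
  have DH: "(H has_field_derivative D) (at x)"
    unfolding H_def D_def
    by (rule termdiffs_strong'[where K = 1]) (use x zeta_log_coeff_sums sums_summable in auto)
  have sD: "summable (\<lambda>n. diffs zeta_log_coeff n * x ^ n)"
    by (rule termdiff_converges[where K = 1]) (use x zeta_log_coeff_sums sums_summable in auto)
  have xD: "x * D = eval_fps zeta_fps x"
  proof -
    have "(\<lambda>n. diffs zeta_log_coeff n * x ^ n) sums D" using sD by (simp add: D_def summable_sums)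
    then have "(\<lambda>n. x * (diffs zeta_log_coeff n * x ^ n)) sums (x * D)" by (rule sums_mult)
    then have "(\<lambda>n. fps_nth zeta_fps (Suc n) * x ^ Suc n) sums (x * D)"
      by (simp add: zeta_fps_def diffs_def mult_ac)
    then have "(\<lambda>n. fps_nth zeta_fps n * x ^ n) sums (x * D)"
      by (subst (asm) sums_Suc_iff) (simp add: zeta_fps_def)
    then show ?thesis by (simp add: eval_fps_def sums_iff)
  qed
  have "((\<lambda>y. 2 * pi * y * exp (H y)) has_field_derivative 2 * pi * exp (H x) + 2 * pi * x * (exp (H x) * D)) (at x)"
    by (auto intro!: derivative_eq_intros DH)
  moreover have "((\<lambda>y. exp (pi * y) - exp (- (pi * y))) has_field_derivative pi * (exp (pi * x) + exp (- (pi * x)))) (at x)"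
    by (auto intro!: derivative_eq_intros simp: algebra_simps)
  then have "((\<lambda>y. 2 * pi * y * exp (H y)) has_field_derivative pi * (exp (pi * x) + exp (- (pi * x)))) (at x)"
    by (rule has_field_derivative_transform_within_open[where S = "{-1<..<1}"]) (use x eq in auto)
  ultimately have "pi * (exp (pi * x) + exp (- (pi * x))) = 2 * pi * exp (H x) + 2 * pi * x * (exp (H x) * D)"
    by (rule DERIV_unique[rotated])
  then have "x * (pi * (exp (pi * x) + exp (- (pi * x)))) = x * (2 * pi * exp (H x) + 2 * pi * x * (exp (H x) * D))"
    by (simp only:)
  then have "pi * x * (exp (pi * x) + exp (- (pi * x))) = (1 + x * D) * (2 * pi * x * exp (H x))"
    by (simp add: algebra_simps)
  then show ?thesis using eq[OF x] xD by simp
qed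

text \<open>Euler's formula. The generating function of the Bernoulli numbers at 2 pi x, increased
  by pi x, equals pi x coth(pi x), whose expansion is \<open>1 + zeta_fps\<close>. Denominators are
  cleared with sinh and cancelled in the ring of formal series. The correction pi x is odd and
  leaves even coefficients alone.\<close>

lemma bernoulli_eq_even_zeta:
  assumes "l > 0"
  shows "bernoulli (2 * l) / fact (2 * l) * (2 * pi) ^ (2 * l) = 2 * (-1) ^ (l - 1) * even_zeta l"
proof -
  let ?A = "fps_exp pi :: real fps" and ?B = "fps_exp (- pi) :: real fps"
  let ?F = "fps_const pi * fps_X * (?A + ?B) - (1 + zeta_fps) * (?A - ?B)"
  have z: "eval_fps zeta_fps has_fps_expansion zeta_fps"
    using zeta_fps_conv_radius by (intro eval_fps_has_fps_expansion) (auto intro: less_le_trans[rotated])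
  have "(\<lambda>x. pi * x * (exp (pi * x) + exp (- pi * x)) - (1 + eval_fps zeta_fps x) * (exp (pi * x) - exp (- pi * x)))
     has_fps_expansion ?F"
    by (intro fps_expansion_intros z)
  then have F: "fps_conv_radius ?F > 0" "\<forall>\<^sub>F x in nhds 0. eval_fps ?F x =
      pi * x * (exp (pi * x) + exp (- pi * x)) - (1 + eval_fps zeta_fps x) * (exp (pi * x) - exp (- pi * x))"
    by (auto simp: has_fps_expansion_def)
  then obtain d where d: "d > 0" "\<And>x. \<bar>x\<bar> < d \<Longrightarrow> eval_fps ?F x =
      pi * x * (exp (pi * x) + exp (- pi * x)) - (1 + eval_fps zeta_fps x) * (exp (pi * x) - exp (- pi * x))"
    by (auto simp: eventually_nhds_metric dist_norm)
  have "?F = 0"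
  proof (rule real_fps_eq_zero[OF F(1), of "min d 1"])
    show "eval_fps ?F x = 0" if "0 \<le> x" "x < min d 1" for x
      using d(2)[of x] sinh_log_derivative[of x] that by simp
  qed (use d in auto)
  then have 1: "fps_const pi * fps_X * (?A + ?B) = (1 + zeta_fps) * (?A - ?B)" by simp
  define b where "b = Abs_fps (\<lambda>m. bernoulli m / fact m)"
  let ?L = "fps_const (2 * pi) * fps_X :: real fps"
  have "(b * (fps_exp 1 - 1)) oo ?L = fps_X oo ?L"
    using bernoulli_generating_function by (simp add: b_def)
  then have "(b oo ?L) * (fps_exp (2 * pi) - 1) = ?L"
    by (simp add: fps_compose_mult_distrib fps_compose_sub_distrib fps_exp_compose_linear)
  \<comment> \<open>Multiplication by exp(-pi x) symmetrizes exp(2 pi x) - 1 into exp(pi x) -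
    exp(-pi x).\<close>
  then have "(b oo ?L) * (fps_exp (2 * pi) - 1) * ?B = ?L * ?B" by (simp only:)
  moreover have "(b oo ?L) * (fps_exp (2 * pi) - 1) * ?B = (b oo ?L) * (fps_exp (2 * pi) * ?B - ?B)"
    by (simp add: algebra_simps)
  moreover have "fps_exp (2 * pi) * ?B = ?A" by (simp add: fps_exp_add_mult[symmetric])
  ultimately have cAB: "(b oo ?L) * (?A - ?B) = ?L * ?B" by (simp only:)
  then have "((b oo ?L) + fps_const pi * fps_X) * (?A - ?B) = fps_const pi * fps_X * (?A + ?B)"
  proof -
    have two: "?L = fps_const pi * fps_X + fps_const pi * fps_X" by (simp add: fps_eq_iff)
    have "(c + P) * (A - B) = P * (A + B)" if "c * (A - B) = (P + P) * B" for c P A B :: "real fps"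
      using that by (simp add: algebra_simps)
    from this[of "b oo ?L" ?A ?B] show ?thesis
      using trans[OF cAB arg_cong[OF two, of "\<lambda>x. x * ?B"]] by blast
  qed
  then have "((b oo ?L) + fps_const pi * fps_X) * (?A - ?B) = (1 + zeta_fps) * (?A - ?B)"
    using 1 by simp
  moreover have "?A - ?B \<noteq> 0"
  proof
    assume "?A - ?B = 0"
    then have "fps_nth (?A - ?B) 1 = 0" by simp
    then show False by simp
  qed
  ultimately have "(b oo ?L) + fps_const pi * fps_X = 1 + zeta_fps" by simp
  then have "fps_nth ((b oo ?L) + fps_const pi * fps_X) (2 * l) = fps_nth (1 + zeta_fps) (2 * l)" by simp
  moreover have "fps_nth (fps_const pi * fps_X) (2 * l) = 0" by simp
  moreover have "fps_nth (b oo ?L) (2 * l) = (2 * pi) ^ (2 * l) * fps_nth b (2 * l)"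
    by (simp only: fps_compose_linear fps_nth_Abs_fps)
  ultimately show ?thesis
    using assms by (simp add: b_def zeta_fps_def zeta_log_coeff_def mult_ac)
qed

section \<open>The limit law\<close>

definition writhe_scale :: "nat \<times> nat \<Rightarrow> real" where
  "writhe_scale = (\<lambda>(p, q). 4 / pi\<^sup>2 * (1 / (2 * real p + 1)) * (1 / (real q + 1)))"

lemma four_over_pi_square_le: "4 / pi\<^sup>2 \<le> 1 / 2"
proof -
  have "3 * 3 \<le> pi * pi" using pi_gt3 by (intro mult_mono) auto
  then show ?thesis by (simp add: power2_eq_square field_simps)
qed

lemma writhe_scale_nonneg: "0 \<le> writhe_scale q"
  by (simp add: writhe_scale_def split: prod.splits)

lemma writhe_scale_le: "writhe_scale q \<le> 1 / 2"
proof (cases q)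
  case (Pair p k)
  have "4 / pi\<^sup>2 * (1 / (2 * real p + 1)) * (1 / (real k + 1)) \<le> (1 / 2) * 1 * 1"
    using four_over_pi_square_le by (intro mult_mono) auto
  then show ?thesis by (simp add: Pair writhe_scale_def)
qed

lemma writhe_scale_power_sum:
  "(\<Sum>q\<in>{..<m}\<times>{..<m}. writhe_scale q ^ k) =
    (4 / pi\<^sup>2) ^ k * ((\<Sum>p<m. (1 / (2 * real p + 1)) ^ k) * (\<Sum>q<m. (1 / (real q + 1)) ^ k))"
proof -
  have "(\<Sum>q\<in>{..<m}\<times>{..<m}. writhe_scale q ^ k)
    = (\<Sum>(p, q)\<in>{..<m}\<times>{..<m}. (4 / pi\<^sup>2) ^ k * ((1 / (2 * real p + 1)) ^ k * (1 / (real q + 1)) ^ k))"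
    by (intro sum.cong refl) (auto simp only: writhe_scale_def prod.case power_mult_distrib mult.assoc)
  also have "\<dots> = (\<Sum>p<m. \<Sum>q<m. (4 / pi\<^sup>2) ^ k * ((1 / (2 * real p + 1)) ^ k * (1 / (real q + 1)) ^ k))"
    by (rule sum.cartesian_product[symmetric])
  also have "\<dots> = (4 / pi\<^sup>2) ^ k * ((\<Sum>p<m. (1 / (2 * real p + 1)) ^ k) * (\<Sum>q<m. (1 / (real q + 1)) ^ k))"
    unfolding sum_product by (simp only: sum_distrib_left)
  finally show ?thesis .
qed

lemma writhe_scale_square_sum_le:
  "(\<Sum>q\<in>{..<m}\<times>{..<m}. (writhe_scale q)\<^sup>2) \<le> (pi\<^sup>2 / 6) * (pi\<^sup>2 / 6)"
proof -
  have "(\<Sum>p<m. (1 / (2 * real p + 1))\<^sup>2) \<le> (\<Sum>p<m. (1 / (real p + 1))\<^sup>2)"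
    by (intro sum_mono power_mono divide_left_mono) auto
  then have odd: "(\<Sum>p<m. (1 / (2 * real p + 1))\<^sup>2) \<le> pi\<^sup>2 / 6"
    using even_zeta_partial_le[of m] by linarith
  have "(4 / pi\<^sup>2)\<^sup>2 \<le> 1"
    using four_over_pi_square_le by (intro power_le_one) auto
  then have "(4 / pi\<^sup>2)\<^sup>2 * ((\<Sum>p<m. (1 / (2 * real p + 1))\<^sup>2) * (\<Sum>q<m. (1 / (real q + 1))\<^sup>2))
    \<le> 1 * ((pi\<^sup>2 / 6) * (pi\<^sup>2 / 6))"
    using odd even_zeta_partial_le[of m] by (intro mult_mono) (auto intro!: sum_nonneg mult_nonneg_nonneg)
  then show ?thesis unfolding writhe_scale_power_sum by simp
qed

definition lambda_half :: "nat \<Rightarrow> real" where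
  "lambda_half l = (4 / pi\<^sup>2) ^ (2 * l) * ((1 - (1 / 2) ^ (2 * l)) * even_zeta l * even_zeta l)"

lemma writhe_scale_power_sum_tendsto:
  "(\<lambda>m. \<Sum>q\<in>{..<m}\<times>{..<m}. writhe_scale q ^ (2 * Suc l)) \<longlonglongrightarrow> lambda_half (Suc l)"
  unfolding writhe_scale_power_sum lambda_half_def
  using odd_zeta_limit[of "Suc l"] even_zeta_sums[of "Suc l"]
  by (intro tendsto_mult_left tendsto_mult) (auto simp: sums_def)

text \<open>The logarithm of prod 1 / (1 - (c z)^2) is the sum over l of
  \<open>lambda_half l\<close> z^(2 l) / l. Comparison with lambda_m z^m / m at m = 2 l produces the
  factor 2. Euler's formula turns the squared zeta value into a squared Bernoulli number, and the
  odd part 1 - 2^(-2 l) yields 2^m - 1.\<close>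

lemma writhe_lambda_even:
  assumes "l > 0" shows "writhe_lambda (2 * l) = 2 * lambda_half l"
proof -
  define P where "P = (2 * pi) ^ (2 * l)"
  have P: "P > 0" by (simp add: P_def)
  have b: "bernoulli (2 * l) / fact (2 * l) = 2 * (-1) ^ (l - 1) * even_zeta l / P"
    using bernoulli_eq_even_zeta[OF assms] P by (simp add: P_def field_simps)
  have "writhe_lambda (2 * l) = 8 ^ (2 * l) * (2 ^ (2 * l) - 1) / 2 * (bernoulli (2 * l) / fact (2 * l))\<^sup>2"
    by (simp add: writhe_lambda_def power_divide)
  also have "(bernoulli (2 * l) / fact (2 * l))\<^sup>2 = 4 * (even_zeta l)\<^sup>2 / P\<^sup>2"
    unfolding b by (simp add: power_mult_distrib power_divide flip: power_mult)
  also have "8 ^ (2 * l) * (2 ^ (2 * l) - 1) / 2 * (4 * (even_zeta l)\<^sup>2 / P\<^sup>2) = 2 * lambda_half l"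
  proof -
    \<comment> \<open>All powers are expressed through a = 4^l and y = (pi^2)^l, which leaves a
      rational identity.\<close>
    have sq: "(x ^ 2) ^ l = (x ^ l)\<^sup>2" for x :: real
      by (simp only: power_mult[symmetric] mult.commute)
    have e: "(8::real) ^ (2 * l) = 64 ^ l" "(2::real) ^ (2 * l) = 4 ^ l" "(1 / 2 :: real) ^ (2 * l) = 1 / 4 ^ l"
      by (simp_all add: power_mult power_divide)
    have s16: "(16::real) ^ l = (4 ^ l)\<^sup>2" using sq[of 4] by simp
    have e2: "(4 / pi\<^sup>2) ^ (2 * l) = 16 ^ l / ((pi\<^sup>2) ^ l)\<^sup>2"
      unfolding power_mult sq[of "4 / pi\<^sup>2"] s16 by (simp only: power_divide)
    have e3: "P\<^sup>2 = 16 ^ l * ((pi\<^sup>2) ^ l)\<^sup>2"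
      unfolding P_def power_mult s16 by (simp add: power_mult_distrib)
    have f: "(64::real) ^ l = 16 ^ l * 4 ^ l" by (simp add: power_mult_distrib[symmetric])
    have "a\<^sup>2 * a * (a - 1) / 2 * (4 * z\<^sup>2 / (a\<^sup>2 * y\<^sup>2)) = 2 * (a\<^sup>2 / y\<^sup>2 * ((1 - 1 / a) * z * z))"
      if "a > 0" "y > 0" for a y z :: real
      using that by (simp add: field_simps power2_eq_square)
    from this[of "4 ^ l" "(pi\<^sup>2) ^ l" "even_zeta l"] show ?thesis
      unfolding lambda_half_def e e2 e3 f s16 by (simp only: mult.assoc) simp
  qed
  finally show ?thesis .
qed

lemma lambda_coeff_summable:
  fixes z :: complex
  assumes "norm z \<le> 1"
  shows "summable (\<lambda>l. of_real (lambda_half (Suc l) / real (Suc l)) * z ^ (2 * Suc l))"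
proof (rule summable_comparison_test[OF _ prod_one_plus_square_tendsto(1)[where c = writhe_scale
      and B = "\<lambda>m. {..<m}\<times>{..<m}" and \<rho> = "1 / 2" and t = 1, OF _ writhe_scale_nonneg writhe_scale_le _
        writhe_scale_square_sum_le writhe_scale_power_sum_tendsto]], intro exI allI impI)
  fix l
  have "norm z ^ (2 * Suc l) \<le> 1" using assms by (intro power_le_one) auto
  then show "norm (of_real (lambda_half (Suc l) / real (Suc l)) * z ^ (2 * Suc l)) \<le> norm ((-1) ^ l * 1 ^ (2 * Suc l) / real (Suc l) * lambda_half (Suc l))"
    unfolding norm_mult norm_divide norm_power norm_of_real
    by (simp add: mult_left_le divide_right_mono del: power_Suc)
qed auto

lemma writhe_lambda_series:
  fixes z :: complex
  assumes "norm z \<le> 1"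
  shows "(\<lambda>n. of_real (writhe_lambda n / real n) * z ^ n) sums (\<Sum>l. of_real (lambda_half (Suc l) / real (Suc l)) * z ^ (2 * Suc l))"
proof -
  let ?f = "\<lambda>n. of_real (writhe_lambda n / real n) * z ^ n"
  have "(\<lambda>l. of_real (lambda_half (Suc l) / real (Suc l)) * z ^ (2 * Suc l)) sums (\<Sum>l. of_real (lambda_half (Suc l) / real (Suc l)) * z ^ (2 * Suc l))"
    using lambda_coeff_summable[OF assms] by (simp add: summable_sums)
  moreover have eq: "of_real (lambda_half (Suc l) / real (Suc l)) * z ^ (2 * Suc l) = ?f (2 * Suc l)" for l
  proof -
    have "writhe_lambda (2 * Suc l) / real (2 * Suc l) = lambda_half (Suc l) / real (Suc l)"
      using writhe_lambda_even[of "Suc l"] by (simp add: field_simps)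
    then show ?thesis by (simp only:)
  qed
  ultimately have *: "(\<lambda>l. ?f (2 * Suc l)) sums (\<Sum>l. ?f (2 * Suc l))" by (simp only:)
  \<comment> \<open>The index n = 0 is covered as well: there the quotient is a division by zero,
    with value 0.\<close>
  have "writhe_lambda n / real n = 0" if "n \<notin> range (\<lambda>l. 2 * Suc l)" for n
  proof (rule ccontr)
    assume "writhe_lambda n / real n \<noteq> 0"
    then have "even n" "n > 0" by (auto simp: writhe_lambda_def split: if_splits)
    then have "n = 2 * Suc (n div 2 - 1)" by auto
    with that show False by blast
  qed
  then show ?thesis
    unfolding eq
    using sums_mono_reindex[of "\<lambda>l. 2 * Suc l" ?f] *
    by (simp only: strict_mono_def mult_zero_left of_real_0) auto
qed

definition writhe_log_mgf :: "complex \<Rightarrow> complex" where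
  "writhe_log_mgf z = (\<Sum>n. of_real (writhe_lambda n / real n) * z ^ n)"

text \<open>At z = i t one has z^2 = -t^2, so the series of log(1 + (c t)^2) with its alternating
  signs is minus the even series in z.\<close>

lemma box_cf_tendsto_exp:
  assumes "\<bar>t\<bar> \<le> 1"
  shows "(\<lambda>m. complex_of_real (box_cf writhe_scale m t)) \<longlonglongrightarrow> exp (writhe_log_mgf (\<i> * t))"
proof -
  let ?S = "\<Sum>l. (-1) ^ l * t ^ (2 * Suc l) / real (Suc l) * lambda_half (Suc l)"
  have t2: "1 / 2 * \<bar>t\<bar> < 1" using assms by simp
  note lim = prod_one_plus_square_tendsto[where c = writhe_scale
      and B = "\<lambda>m. {..<m}\<times>{..<m}" and \<rho> = "1 / 2" and t = t, OF _ writhe_scale_nonneg writhe_scale_le t2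
        writhe_scale_square_sum_le writhe_scale_power_sum_tendsto]
  have "(\<lambda>m. inverse (\<Prod>q\<in>{..<m}\<times>{..<m}. 1 + (writhe_scale q * t)\<^sup>2)) \<longlonglongrightarrow> inverse (exp ?S)"
    by (intro tendsto_inverse lim) auto
  then have "(\<lambda>m. box_cf writhe_scale m t) \<longlonglongrightarrow> exp (- ?S)"
    by (simp add: box_cf_def prod_dividef exp_minus inverse_eq_divide)
  then have "(\<lambda>m. complex_of_real (box_cf writhe_scale m t)) \<longlonglongrightarrow> of_real (exp (- ?S))"
    by (rule tendsto_of_real)
  also have "complex_of_real (exp (- ?S)) = exp (writhe_log_mgf (\<i> * t))"
  proof -
    have S: "summable (\<lambda>l. (-1) ^ l * t ^ (2 * Suc l) / real (Suc l) * lambda_half (Suc l))"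
      by (rule summable_norm_cancel, rule lim(1)) auto
    have "writhe_log_mgf (\<i> * t) = (\<Sum>l. of_real (lambda_half (Suc l) / real (Suc l)) * (\<i> * t) ^ (2 * Suc l))"
      unfolding writhe_log_mgf_def using writhe_lambda_series[of "\<i> * t"] assms by (simp add: sums_iff norm_mult)
    also have "(\<lambda>l. of_real (lambda_half (Suc l) / real (Suc l)) * (\<i> * t) ^ (2 * Suc l))
      = (\<lambda>l. - complex_of_real ((-1) ^ l * t ^ (2 * Suc l) / real (Suc l) * lambda_half (Suc l)))"
    proof
      fix l
      have "(\<i> * complex_of_real t) ^ (2 * Suc l) = - ((-1) ^ l * of_real t ^ (2 * Suc l))"
        by (simp only: power_mult power_mult_distrib i_squared) simp
      then show "of_real (lambda_half (Suc l) / real (Suc l)) * (\<i> * t) ^ (2 * Suc l) =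
        - complex_of_real ((-1) ^ l * t ^ (2 * Suc l) / real (Suc l) * lambda_half (Suc l))"
        by (simp del: power_Suc mult_Suc_right)
    qed
    also have "(\<Sum>l. - complex_of_real ((-1) ^ l * t ^ (2 * Suc l) / real (Suc l) * lambda_half (Suc l))) = - of_real ?S"
      unfolding suminf_minus[OF summable_of_real[OF S]] suminf_of_real[OF S, symmetric] ..
    finally show ?thesis by (simp add: exp_of_real[symmetric] del: exp_of_real)
  qed
  finally show ?thesis .
qed

lemma holomorphic_writhe_log_mgf: "writhe_log_mgf holomorphic_on ball 0 1"
proof (rule power_series_holomorphic[where a = "\<lambda>n. of_real (writhe_lambda n / real n)"])
  fix w :: complex assume "w \<in> ball 0 1"
  then show "(\<lambda>n. of_real (writhe_lambda n / real n) * (w - 0) ^ n) sums writhe_log_mgf w"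
    using writhe_lambda_series[of w] by (simp add: writhe_log_mgf_def sums_iff)
qed

lemma writhe_log_mgf_of_real:
  assumes "\<bar>z\<bar> < 1"
  shows "summable (\<lambda>k. writhe_lambda (Suc k) / real (Suc k) * z ^ Suc k)"
    and "writhe_log_mgf (of_real z) = of_real (\<Sum>k. writhe_lambda (Suc k) / real (Suc k) * z ^ Suc k)"
proof -
  have "summable (\<lambda>n. complex_of_real (writhe_lambda n / real n) * of_real z ^ n)"
    using writhe_lambda_series[of "of_real z"] assms by (auto intro: sums_summable)
  then have "summable (\<lambda>n. complex_of_real (writhe_lambda n / real n * z ^ n))" by simp
  then have s: "summable (\<lambda>n. writhe_lambda n / real n * z ^ n)"
    using summable_Re by fastforce
  then show "summable (\<lambda>k. writhe_lambda (Suc k) / real (Suc k) * z ^ Suc k)"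
    by (subst summable_Suc_iff)
  have "writhe_log_mgf (of_real z) = of_real (\<Sum>n. writhe_lambda n / real n * z ^ n)"
    unfolding writhe_log_mgf_def suminf_of_real[OF s] by simp
  also have "(\<Sum>n. writhe_lambda n / real n * z ^ n) = (\<Sum>k. writhe_lambda (Suc k) / real (Suc k) * z ^ Suc k)"
    by (subst suminf_split_head[OF s]) simp
  finally show "writhe_log_mgf (of_real z) = of_real (\<Sum>k. writhe_lambda (Suc k) / real (Suc k) * z ^ Suc k)" .
qed

text \<open>The limit of the characteristic functions gives the transform of W on an imaginary
  segment; both sides are holomorphic in the unit disc, so the formula reaches the real points near
  0. The last conjunct is the link to the characteristic functions of the truncated writhe.\<close>

lemma exists_writhe_limit_law:
  "\<exists>W. real_distribution W \<and> absolutely_continuous lborel W \<and> has_writhe_mgf W \<and>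
    (\<forall>W'. real_distribution W' \<and> has_writhe_mgf W' \<longrightarrow> W' = W) \<and>
    (\<forall>t. (\<lambda>m. complex_of_real (box_cf writhe_scale m t)) \<longlonglongrightarrow> char W t)"
proof -
  have "writhe_scale (0, 0) > 0" by (simp add: writhe_scale_def)
  from exists_limit_law[OF writhe_scale_nonneg writhe_scale_le this writhe_scale_square_sum_le]
  obtain W where W: "real_distribution W" "absolutely_continuous lborel W"
    and iW: "\<And>z. \<bar>z\<bar> \<le> 1 \<Longrightarrow> integrable W (\<lambda>x. exp (z * x))"
    and cf: "\<And>t. (\<lambda>m. complex_of_real (box_cf writhe_scale m t)) \<longlonglongrightarrow> char W t" by blast
  have iW': "integrable W (\<lambda>x. exp (x * z))" if "\<bar>z\<bar> < 1" for z
    using iW[of z] that by (simp add: mult.commute)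
  have H: "complex_mgf W z = exp (writhe_log_mgf z)" if z: "norm z < 1" for z
  proof -
    let ?f = "\<lambda>z. complex_mgf W z - exp (writhe_log_mgf z)"
    have "?f z = 0"
    proof (rule analytic_continuation[where f = ?f and S = "ball 0 1" and \<xi> = 0])
      show "0 islimpt (\<lambda>t::real. 0 + \<i> * complex_of_real t) ` {0<..<1}"
        by (intro islimpt_segment) auto
      have "complex_mgf W holomorphic_on ball 0 1"
        by (rule holomorphic_on_subset[OF holomorphic_complex_mgf[OF W(1) iW']])
           (auto intro: le_less_trans[OF abs_Re_le_cmod])
      then show "?f holomorphic_on ball 0 1"
        by (intro holomorphic_intros holomorphic_writhe_log_mgf)
      show "?f w = 0" if "w \<in> (\<lambda>t::real. 0 + \<i> * complex_of_real t) ` {0<..<1}" for w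
      proof -
        from that obtain t :: real where t: "w = \<i> * t" "\<bar>t\<bar> \<le> 1" by auto
        have "char W t = exp (writhe_log_mgf (\<i> * t))"
          using LIMSEQ_unique[OF cf box_cf_tendsto_exp[OF t(2)]] .
        then show ?thesis by (simp add: t char_eq_complex_mgf)
      qed
    qed (use z in \<open>auto simp: norm_mult\<close>)
    then show ?thesis by simp
  qed
  have mgf: "(LINT x|W. exp (x * z)) = exp (\<Sum>k. writhe_lambda (Suc k) / real (Suc k) * z ^ Suc k)" if "\<bar>z\<bar> < 1" for z
  proof -
    have "complex_of_real (LINT x|W. exp (x * z)) = of_real (exp (\<Sum>k. writhe_lambda (Suc k) / real (Suc k) * z ^ Suc k))"
      using H[of "of_real z"] that unfolding complex_mgf_of_real
      by (simp add: writhe_log_mgf_of_real exp_of_real del: power_Suc)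
    then show ?thesis by (simp only: of_real_eq_iff)
  qed
  have ev: "\<forall>\<^sub>F z in nhds 0. \<bar>z\<bar> < (1::real)"
    by (rule eventually_nhds_in_open[of "{-1<..<1}", THEN eventually_mono]) auto
  have has: "has_writhe_mgf W"
    unfolding has_writhe_mgf_def
    by (rule eventually_mono[OF ev]) (use iW' mgf writhe_log_mgf_of_real(1) in blast)
  have "W' = W" if W': "real_distribution W'" "has_writhe_mgf W'" for W'
  proof -
    have "\<forall>\<^sub>F z in nhds 0. (integrable W (\<lambda>x. exp (x * z)) \<and> integrable W' (\<lambda>x. exp (x * z))) \<and>
        (LINT x|W'. exp (x * z)) = (LINT x|W. exp (x * z))"
      using has W'(2) unfolding has_writhe_mgf_def by eventually_elim auto
    then obtain d where "d > 0" "\<And>z. \<bar>z\<bar> < d \<Longrightarrow> (integrable W (\<lambda>x. exp (x * z)) \<and> integrable W' (\<lambda>x. exp (x * z))) \<and>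
        (LINT x|W'. exp (x * z)) = (LINT x|W. exp (x * z))"
      by (auto simp: eventually_nhds_metric dist_norm)
    then show ?thesis by (intro real_distribution_eq_if_mgf_eq[OF W'(1) W(1)]) auto
  qed
  then show ?thesis using W has cf by blast
qed

section \<open>Random permutations and independent uniform variables\<close>

definition unif :: "real measure" where
  "unif = restrict_space lborel {0..1}"

lemma space_unif: "space unif = {0..1}"
  by (simp add: unif_def space_restrict_space)

lemma prob_space_unif: "prob_space unif"
  by (rule prob_spaceI) (simp add: unif_def space_restrict_space emeasure_restrict_space)

interpretation unif: prob_space unif by (rule prob_space_unif)

lemma measurable_unif_borel [measurable]: "(\<lambda>x. x) \<in> unif \<rightarrow>\<^sub>M borel"
  unfolding unif_def by (rule measurable_restrict_space1) simp

lemma borel_measurable_unif: "f \<in> borel_measurable borel \<Longrightarrow> f \<in> borel_measurable unif"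
  unfolding unif_def by (rule measurable_restrict_space1) simp

lemma integral_unif:
  fixes f :: "real \<Rightarrow> real"
  assumes f: "f \<in> borel_measurable borel" and B: "\<And>x. x \<in> {0..1} \<Longrightarrow> \<bar>f x\<bar> \<le> B"
    and I: "(f has_integral I) {0..1}"
  shows "(LINT x|unif. f x) = I"
proof -
  have "set_integrable lborel {0..1} f"
    unfolding set_integrable_def using f B
    by (intro integrableI_bounded_set_indicator[where B = B]) (auto intro!: AE_I2)
  from set_borel_integral_eq_integral(2)[OF this] have "(LINT x:{0..1}|lborel. f x) = I"
    using I by (simp add: integral_unique)
  then show ?thesis
    unfolding unif_def set_lebesgue_integral_def by (subst integral_restrict_space) auto
qed

definition sample :: "nat \<Rightarrow> (nat \<Rightarrow> real) measure" where
  "sample n = PiM {0..2*n} (\<lambda>_. unif)"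

lemma prob_space_sample: "prob_space (sample n)"
  unfolding sample_def by (intro prob_space_PiM prob_space_unif)

interpretation sample: prob_space "sample n" for n by (rule prob_space_sample)

interpretation unif_product: product_sigma_finite "\<lambda>_::nat. unif"
  by standard

lemma sample_space: "x \<in> space (sample n) \<Longrightarrow> i \<le> 2 * n \<Longrightarrow> x i \<in> {0..1}"
  by (auto simp: sample_def space_PiM space_unif PiE_def Pi_def)

lemma measurable_sample_component [measurable]:
  "i \<le> 2 * n \<Longrightarrow> (\<lambda>x. x i) \<in> borel_measurable (sample n)"
  unfolding sample_def
  by (rule measurable_compose[of "\<lambda>x. x i" _ unif, OF measurable_component_singleton measurable_unif_borel]) auto

text \<open>Replacing one coordinate by a fresh uniform variable preserves expectations. The inner
  integral is constant in coordinate \<open>i\<close>, so integrating over that coordinate once more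
  restores the full product. This is how single coordinates are integrated out below.\<close>

lemma sample_resample:
  fixes f :: "(nat \<Rightarrow> real) \<Rightarrow> 'b :: {banach, second_countable_topology}"
  assumes i: "i \<le> 2 * n" and f [measurable]: "f \<in> borel_measurable (sample n)"
    and B: "\<And>x. x \<in> space (sample n) \<Longrightarrow> norm (f x) \<le> B"
  shows "(LINT x|sample n. f x) = (LINT x|sample n. LINT u|unif. f (x(i := u)))"
proof -
  define I' where "I' = {0..2 * n} - {i}"
  have I: "{0..2 * n} = insert i I'" "i \<notin> I'" "finite I'" using i by (auto simp: I'_def)
  have S: "sample n = PiM (insert i I') (\<lambda>_. unif)" by (simp add: sample_def I)
  define g where "g x = (LINT u|unif. f (x(i := u)))" for x
  have up: "x(i := u) \<in> space (sample n)" if "x \<in> space (sample n)" "u \<in> {0..1}" for x u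
    using that i by (auto simp: sample_def space_PiM space_unif PiE_def extensional_def Pi_def)
  have [measurable]: "(\<lambda>(x, u). x(i := u)) \<in> sample n \<Otimes>\<^sub>M unif \<rightarrow>\<^sub>M sample n"
    using measurable_add_dim[of i "insert i I'" "\<lambda>_. unif"] unfolding S by simp
  have m: "(\<lambda>p. f ((fst p)(i := snd p))) \<in> borel_measurable (sample n \<Otimes>\<^sub>M unif)"
    using measurable_compose[OF \<open>(\<lambda>(x, u). x(i := u)) \<in> sample n \<Otimes>\<^sub>M unif \<rightarrow>\<^sub>M sample n\<close> f]
    by (simp add: case_prod_unfold)
  have gm: "g \<in> borel_measurable (sample n)"
    unfolding g_def using m
    by (intro unif.borel_measurable_lebesgue_integral) (simp add: case_prod_unfold)
  have gB: "norm (g x) \<le> B" if x: "x \<in> space (sample n)" for x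
  proof -
    have "norm (g x) \<le> (LINT u|unif. norm (f (x(i := u))))"
      unfolding g_def by (rule integral_norm_bound)
    also have "\<dots> \<le> (LINT u|unif. B)"
    proof (rule integral_mono')
      fix u assume "u \<in> space unif"
      then show "norm (f (x(i := u))) \<le> B" "0 \<le> B"
        using B[OF up[OF x]] by (auto simp: space_unif intro: order_trans[OF norm_ge_zero])
    qed simp
    finally show ?thesis by (simp add: unif.prob_space)
  qed
  have intf: "integrable (sample n) f"
    by (rule sample.integrable_const_bound[where B = B]) (use B in \<open>auto intro: AE_I2\<close>)
  have intg: "integrable (sample n) g"
    by (rule sample.integrable_const_bound[where B = B]) (use gB gm in \<open>auto intro: AE_I2\<close>)
  have "(LINT x|sample n. f x) = (LINT x|PiM I' (\<lambda>_. unif). g x)"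
    unfolding g_def S using intf I unfolding S by (intro unif_product.product_integral_insert) auto
  also have "\<dots> = (LINT x|PiM I' (\<lambda>_. unif). LINT u|unif. g (x(i := u)))"
    by (simp add: g_def unif.prob_space)
  also have "\<dots> = (LINT x|sample n. g x)"
    unfolding S using intg I unfolding S by (intro unif_product.product_integral_insert[symmetric]) auto
  finally show ?thesis by (simp add: g_def)
qed

text \<open>With \<open>x j\<close> held fixed, the resampled coordinate \<open>i\<close> has to hit
  a single point.\<close>

lemma sample_distinct:
  assumes "i \<le> 2 * n" "j \<le> 2 * n" "i \<noteq> j"
  shows "AE x in sample n. x i \<noteq> x j"
proof -
  let ?f = "\<lambda>x. indicator {0::real} (x i - x j) :: real"
  have [measurable]: "?f \<in> borel_measurable (sample n)" using assms by measurable
  have int: "integrable (sample n) ?f"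
    by (rule sample.integrable_const_bound[where B = 1]) auto
  have z: "(LINT u|unif. ?f (x(i := u))) = 0" for x
  proof -
    have "(LINT u|unif. ?f (x(i := u))) = (LINT u|unif. indicator {x j} u)"
      using assms by (intro Bochner_Integration.integral_cong) (auto simp: indicator_def)
    also have "\<dots> = 0"
      unfolding unif_def by (subst integral_restrict_space)
        (auto intro!: integral_eq_zero_AE AE_I'[of "{x j}"] simp: indicator_def)
    finally show ?thesis .
  qed
  have "(LINT x|sample n. ?f x) = 0"
    by (subst sample_resample[OF assms(1), where B = 1]) (auto simp del: fun_upd_apply simp: z)
  then have "AE x in sample n. ?f x = 0"
    by (subst (asm) integral_nonneg_eq_0_iff_AE[OF int]) auto
  then show ?thesis by (auto simp: indicator_def elim!: AE_mp intro!: AE_I2)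
qed

section \<open>Ranks and exchangeability\<close>

lemma writhe_cong:
  assumes "\<And>i j. i \<le> 2 * n \<Longrightarrow> j \<le> 2 * n \<Longrightarrow> sgn (f i - f j) = sgn (g i - g j)"
  shows "writhe n f = writhe n g"
  unfolding writhe_def by (intro sum.cong refl assms) (auto intro: order.trans[OF less_Suc_eq_le[THEN iffD1]])

text \<open>For a sample without ties this is the permutation with the same order pattern; outside
  the index range it is the identity, as \<open>permutes\<close> demands.\<close>

definition rank_perm :: "nat \<Rightarrow> (nat \<Rightarrow> real) \<Rightarrow> nat \<Rightarrow> nat" where
  "rank_perm n x i = (if i \<le> 2 * n then card {j \<in> {0..2*n}. x j < x i} else i)"

lemma rank_perm_less:
  assumes "i \<le> 2 * n" "j \<le> 2 * n" "x i < x j"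
  shows "rank_perm n x i < rank_perm n x j"
proof -
  have "{k \<in> {0..2*n}. x k < x i} \<subset> {k \<in> {0..2*n}. x k < x j}" using assms by force
  then have "card {k \<in> {0..2*n}. x k < x i} < card {k \<in> {0..2*n}. x k < x j}"
    by (intro psubset_card_mono) auto
  then show ?thesis using assms by (simp add: rank_perm_def)
qed

lemma rank_perm_permutes:
  assumes "inj_on x {0..2*n}"
  shows "rank_perm n x permutes {0..2*n}"
proof (rule bij_imp_permutes)
  have inj: "inj_on (rank_perm n x) {0..2*n}"
  proof (rule inj_onI)
    fix i j assume ij: "i \<in> {0..2*n}" "j \<in> {0..2*n}" "rank_perm n x i = rank_perm n x j"
    then have "\<not> x i < x j" "\<not> x j < x i"
      using rank_perm_less[of i n j x] rank_perm_less[of j n i x] by auto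
    then have "x i = x j" by simp
    then show "i = j" using assms ij by (auto dest: inj_onD)
  qed
  have "rank_perm n x i \<in> {0..2*n}" if "i \<in> {0..2*n}" for i
  proof -
    have "card {j \<in> {0..2*n}. x j < x i} \<le> card ({0..2*n} - {i})"
      by (intro card_mono) auto
    also have "\<dots> = 2 * n" using that by simp
    finally have "card {j \<in> {0..2*n}. x j < x i} \<le> 2 * n" .
    then show ?thesis using that by (simp add: rank_perm_def)
  qed
  then have "rank_perm n x ` {0..2*n} \<subseteq> {0..2*n}" by (rule image_subsetI)
  from endo_inj_surj[OF _ this inj] inj show "bij_betw (rank_perm n x) {0..2*n} {0..2*n}"
    unfolding bij_betw_def by blast
qed (auto simp: rank_perm_def)

lemma writhe_rank_perm:
  assumes x: "inj_on x {0..2*n}" and p: "p permutes {0..2*n}"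
  shows "writhe n (\<lambda>i. x (p i)) = writhe n (\<lambda>i. real ((rank_perm n x \<circ> p) i))"
proof (rule writhe_cong)
  fix i j assume "i \<le> 2 * n" "j \<le> 2 * n"
  then have pij: "p i \<le> 2 * n" "p j \<le> 2 * n"
    using permutes_in_image[OF p, of i] permutes_in_image[OF p, of j] by auto
  consider "x (p i) < x (p j)" | "x (p j) < x (p i)" | "x (p i) = x (p j)" by linarith
  then show "sgn (x (p i) - x (p j)) = sgn (real ((rank_perm n x \<circ> p) i) - real ((rank_perm n x \<circ> p) j))"
  proof cases
    case 1
    then show ?thesis using rank_perm_less[of "p i" n "p j" x] pij by (simp add: sgn_if)
  next
    case 2
    then show ?thesis using rank_perm_less[of "p j" n "p i" x] pij by (simp add: sgn_if)
  next
    case 3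
    then have "p i = p j" using x pij by (auto dest: inj_onD)
    then show ?thesis by simp
  qed
qed

text \<open>The writhe sees only the order of the values, so \<open>x\<close> may be replaced by its
  ranks; left composition with the rank permutation then merely reorders the sum.\<close>

lemma sum_permutations_writhe:
  fixes F :: "real \<Rightarrow> complex"
  assumes "inj_on x {0..2*n}"
  shows "(\<Sum>p | p permutes {0..2*n}. F (writhe n (\<lambda>i. x (p i)))) = (\<Sum>p | p permutes {0..2*n}. F (writhe n (\<lambda>i. real (p i))))"
proof -
  have "(\<Sum>p | p permutes {0..2*n}. F (writhe n (\<lambda>i. x (p i)))) = (\<Sum>p | p permutes {0..2*n}. F (writhe n (\<lambda>i. real ((rank_perm n x \<circ> p) i))))"
    using assms by (intro sum.cong refl) (simp add: writhe_rank_perm)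
  also have "\<dots> = (\<Sum>p | p permutes {0..2*n}. F (writhe n (\<lambda>i. real (p i))))"
    by (rule setum_permutations_compose_left[OF rank_perm_permutes[OF assms], symmetric])
  finally show ?thesis .
qed

lemma borel_measurable_writhe [measurable]: "writhe n \<in> borel_measurable (sample n)"
  unfolding writhe_def[abs_def]
  by (intro borel_measurable_sum borel_measurable_sgn borel_measurable_diff measurable_sample_component)
     (auto intro: order.trans[OF less_Suc_eq_le[THEN iffD1]])

lemma sample_permute:
  fixes f :: "(nat \<Rightarrow> real) \<Rightarrow> complex"
  assumes p: "p permutes {0..2*n}" and [measurable]: "f \<in> borel_measurable (sample n)"
  shows "(CLINT x|sample n. f (\<lambda>i\<in>{0..2*n}. x (p i))) = (CLINT x|sample n. f x)"
proof -
  have pI: "inj_on p {0..2*n}" "p \<in> {0..2*n} \<rightarrow> {0..2*n}"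
    using permutes_inj_on[OF p] permutes_in_image[OF p] by auto
  have m: "(\<lambda>x. \<lambda>i\<in>{0..2*n}. x (p i)) \<in> sample n \<rightarrow>\<^sub>M sample n"
    unfolding sample_def using pI by (intro measurable_restrict measurable_component_singleton) auto
  have "distr (sample n) (sample n) (\<lambda>x. \<lambda>i\<in>{0..2*n}. x (p i)) = sample n"
    using distr_PiM_reindex[of "{0..2*n}" "\<lambda>_. unif" p "{0..2*n}"] pI prob_space_unif by (simp add: sample_def)
  then have "(CLINT x|sample n. f x) = (CLINT x|distr (sample n) (sample n) (\<lambda>x. \<lambda>i\<in>{0..2*n}. x (p i)). f x)" by simp
  also have "\<dots> = (CLINT x|sample n. f (\<lambda>i\<in>{0..2*n}. x (p i)))"
    by (rule integral_distr[OF m]) simp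
  finally show ?thesis ..
qed

text \<open>Uniformity of the ranks is obtained by averaging: exchangeability gives every
  rearrangement of the sample the same expectation, while for a sample without ties the sum over all
  rearrangements is a constant, namely the sum over permutations.\<close>

lemma expectation_writhe_permutation:
  fixes F :: "real \<Rightarrow> complex"
  assumes [measurable]: "F \<in> borel_measurable borel" and B: "\<And>x. norm (F x) \<le> B"
  shows "(CLINT x|sample n. F (writhe n x)) = (CLINT p|measure_pmf (pmf_of_set {p. p permutes {0..2*n}}). F (writhe n (\<lambda>i. real (p i))))"
proof -
  let ?P = "{p. p permutes {0..2*n}}"
  have fin: "finite ?P" "?P \<noteq> {}" by (auto simp: finite_permutations intro: permutes_id)
  have c: "of_nat (card ?P) \<noteq> (0::complex)" using fin by (simp add: card_gt_0_iff)
  have eq: "writhe n (\<lambda>i\<in>{0..2*n}. x (p i)) = writhe n (\<lambda>i. x (p i))" for x :: "nat \<Rightarrow> real" and p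
    by (rule writhe_cong) auto
  have m: "(\<lambda>x. F (writhe n (\<lambda>i. x (p i)))) \<in> borel_measurable (sample n)" if "p \<in> ?P" for p
  proof -
    have "(\<lambda>x. writhe n (\<lambda>i. x (p i))) \<in> borel_measurable (sample n)"
      unfolding writhe_def[abs_def] using permutes_in_image[of p "{0..2*n}"] that
      by (intro borel_measurable_sum borel_measurable_sgn borel_measurable_diff measurable_sample_component)
         (auto simp: less_Suc_eq_le[symmetric])
    then show ?thesis by measurable
  qed
  have i: "integrable (sample n) (\<lambda>x. F (writhe n (\<lambda>i. x (p i))))" if "p \<in> ?P" for p
    by (rule sample.integrable_const_bound[where B = B]) (use m[OF that] B in auto)
  have exch: "(CLINT x|sample n. F (writhe n (\<lambda>i. x (p i)))) = (CLINT x|sample n. F (writhe n x))" if "p \<in> ?P" for p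
    using sample_permute[of p n "\<lambda>x. F (writhe n x)"] that by (simp add: eq)
  have "of_nat (card ?P) * (CLINT x|sample n. F (writhe n x)) = (\<Sum>p\<in>?P. CLINT x|sample n. F (writhe n (\<lambda>i. x (p i))))"
  proof -
    have "(\<Sum>p\<in>?P. CLINT x|sample n. F (writhe n (\<lambda>i. x (p i)))) = (\<Sum>p\<in>?P. CLINT x|sample n. F (writhe n x))"
      by (intro sum.cong refl exch)
    then show ?thesis by simp
  qed
  also have "\<dots> = (CLINT x|sample n. (\<Sum>p\<in>?P. F (writhe n (\<lambda>i. x (p i)))))"
    by (rule Bochner_Integration.integral_sum[symmetric]) (rule i)
  also have "\<dots> = (CLINT x|sample n. (\<Sum>p\<in>?P. F (writhe n (\<lambda>i. real (p i)))))"
  proof (rule integral_cong_AE)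
    have "AE x in sample n. \<forall>i\<in>{0..2*n}. \<forall>j\<in>{0..2*n}. i \<noteq> j \<longrightarrow> x i \<noteq> x j"
      by (intro AE_finite_allI) (auto intro: sample_distinct)
    then show "AE x in sample n. (\<Sum>p\<in>?P. F (writhe n (\<lambda>i. x (p i)))) = (\<Sum>p\<in>?P. F (writhe n (\<lambda>i. real (p i))))"
      by eventually_elim (rule sum_permutations_writhe, auto simp: inj_on_def)
  qed (auto intro!: borel_measurable_sum m)
  also have "\<dots> = (\<Sum>p\<in>?P. F (writhe n (\<lambda>i. real (p i))))" by (simp add: sample.prob_space)
  finally have "(CLINT x|sample n. F (writhe n x)) = (\<Sum>p\<in>?P. F (writhe n (\<lambda>i. real (p i)))) / of_nat (card ?P)"
    using c by (simp add: field_simps)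
  moreover have "(CLINT p|measure_pmf (pmf_of_set ?P). F (writhe n (\<lambda>i. real (p i)))) = (\<Sum>p\<in>?P. F (writhe n (\<lambda>i. real (p i)))) / of_nat (card ?P)"
    using fin by (subst integral_measure_pmf[of ?P]) (auto simp: scaleR_conv_of_real sum_divide_distrib)
  ultimately show ?thesis by simp
qed

section \<open>Fourier truncation of the writhe\<close>

lemma integrable_unif:
  fixes f :: "real \<Rightarrow> real"
  assumes "f \<in> borel_measurable borel" "\<And>x. x \<in> {0..1} \<Longrightarrow> \<bar>f x\<bar> \<le> B"
  shows "integrable unif f"
  by (rule unif.integrable_const_bound[where B = B])
     (use assms in \<open>auto simp: space_unif borel_measurable_unif intro!: AE_I2\<close>)

lemma integral_unif_FTC:
  fixes f :: "real \<Rightarrow> real"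
  assumes f: "continuous_on UNIV f" and F: "\<And>x. (F has_real_derivative f x) (at x)"
  shows "(LINT x|unif. f x) = F 1 - F 0"
proof -
  have "compact (f ` {0..1})"
    by (intro compact_continuous_image continuous_on_subset[OF f]) auto
  from compact_imp_bounded[OF this] obtain B where "\<forall>y\<in>f ` {0..1}. norm y \<le> B"
    unfolding bounded_iff by blast
  then have B: "\<bar>f x\<bar> \<le> B" if "x \<in> {0..1}" for x using that by auto
  show ?thesis
  proof (rule integral_unif[OF _ B])
    show "f \<in> borel_measurable borel" using f by (rule borel_measurable_continuous_onI)
    show "(f has_integral F 1 - F 0) {0..1}"
      using F by (intro fundamental_theorem_of_calculus)
        (auto simp: has_real_derivative_iff_has_vector_derivative[symmetric] intro: DERIV_subset)
  qed
qed

lemma integral_unif_cos: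
  "(LINT x|unif. cos (2 * pi * (\<theta> + of_int m * x))) = (if m = 0 then cos (2 * pi * \<theta>) else 0)"
proof (cases "m = 0")
  case False
  let ?F = "\<lambda>x. sin (2 * pi * (\<theta> + of_int m * x)) / (2 * pi * of_int m)"
  have "(LINT x|unif. cos (2 * pi * (\<theta> + of_int m * x))) = ?F 1 - ?F 0"
    by (rule integral_unif_FTC)
       (use False in \<open>auto intro!: continuous_intros derivative_eq_intros simp: field_simps\<close>)
  also have "sin (2 * pi * (\<theta> + of_int m * 1)) = sin (2 * pi * \<theta>)"
    using sin.plus_of_int[of "2 * pi * \<theta>" m] by (simp add: algebra_simps)
  finally show ?thesis using False by simp
qed (simp add: unif.prob_space)

text \<open>Made for kernels in v - u that jump at v = u: two antiderivatives are used, and the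
  value at the single point \<open>u\<close> does not affect the integral.\<close>

lemma integral_unif_piecewise:
  fixes f :: "real \<Rightarrow> real"
  assumes u: "u \<in> {0..1}" and f: "f \<in> borel_measurable borel" and B: "\<And>x. x \<in> {0..1} \<Longrightarrow> \<bar>f x\<bar> \<le> B"
    and FL: "\<And>x. (FL has_real_derivative fl x) (at x)" and FR: "\<And>x. (FR has_real_derivative fr x) (at x)"
    and fl: "\<And>x. x < u \<Longrightarrow> f x = fl x" and fr: "\<And>x. x > u \<Longrightarrow> f x = fr x"
  shows "(LINT x|unif. f x) = (FL u - FL 0) + (FR 1 - FR u)"
proof (rule integral_unif[OF f B])
  have "(fl has_integral FL u - FL 0) {0..u}"
    using u FL by (intro fundamental_theorem_of_calculus)
      (auto simp: has_real_derivative_iff_has_vector_derivative[symmetric] intro: DERIV_subset)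
  then have 1: "(f has_integral FL u - FL 0) {0..u}"
    by (rule has_integral_spike_finite[where S = "{u}", rotated 2]) (auto intro!: fl)
  have "(fr has_integral FR 1 - FR u) {u..1}"
    using u FR by (intro fundamental_theorem_of_calculus)
      (auto simp: has_real_derivative_iff_has_vector_derivative[symmetric] intro: DERIV_subset)
  then have 2: "(f has_integral FR 1 - FR u) {u..1}"
    by (rule has_integral_spike_finite[where S = "{u}", rotated 2]) (auto intro!: fr)
  show "(f has_integral (FL u - FL 0) + (FR 1 - FR u)) {0..1}"
    using u by (intro has_integral_combine[OF _ _ 1 2]) auto
qed

section \<open>The value kernel and its sine series\<close>

definition sawtooth :: "real \<Rightarrow> real" where
  "sawtooth d = sgn d - 2 * d"

text \<open>On (-1, 1) the sawtooth agrees with the 1-periodic function that equals 1 - 2 d on (0,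
  1); these are its first \<open>m\<close> Fourier terms.\<close>

definition sawtooth_trunc :: "nat \<Rightarrow> real \<Rightarrow> real" where
  "sawtooth_trunc m d = (\<Sum>q<m. 2 / (pi * real (Suc q)) * sin (2 * pi * real (Suc q) * d))"

lemma borel_measurable_sawtooth [measurable]: "sawtooth \<in> borel_measurable borel"
  unfolding sawtooth_def[abs_def] by measurable

lemma borel_measurable_sawtooth_trunc [measurable]: "sawtooth_trunc m \<in> borel_measurable borel"
  unfolding sawtooth_trunc_def[abs_def] by measurable

lemma sawtooth_abs_le: "\<bar>d\<bar> \<le> 1 \<Longrightarrow> \<bar>sawtooth d\<bar> \<le> 3"
  by (auto simp: sawtooth_def sgn_if abs_if split: if_splits)

lemma sawtooth_minus: "sawtooth (- d) = - sawtooth d"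
  by (simp add: sawtooth_def sgn_minus)

lemma sawtooth_trunc_minus: "sawtooth_trunc m (- d) = - sawtooth_trunc m d"
  by (simp add: sawtooth_trunc_def sum_negf)

lemma sawtooth_trunc_abs_le: "\<bar>sawtooth_trunc m d\<bar> \<le> real m"
proof -
  have "\<bar>sawtooth_trunc m d\<bar> \<le> (\<Sum>q<m. \<bar>2 / (pi * real (Suc q)) * sin (2 * pi * real (Suc q) * d)\<bar>)"
    unfolding sawtooth_trunc_def by (rule sum_abs)
  also have "\<dots> \<le> (\<Sum>q<m. 1)"
  proof (rule sum_mono)
    fix q
    have "2 * 1 \<le> pi * real (Suc q)" using pi_gt3 by (intro mult_mono) auto
    then have "\<bar>2 / (pi * real (Suc q))\<bar> \<le> 1" by (simp add: field_simps)
    then show "\<bar>2 / (pi * real (Suc q)) * sin (2 * pi * real (Suc q) * d)\<bar> \<le> 1"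
      unfolding abs_mult by (intro mult_le_one) auto
  qed
  finally show ?thesis by simp
qed

lemma diff_unit: "u \<in> {0..1} \<Longrightarrow> v \<in> {0..1} \<Longrightarrow> \<bar>v - u\<bar> \<le> (1::real)"
  by auto

lemma integral_sawtooth:
  assumes u: "u \<in> {0..1}"
  shows "(LINT v|unif. sawtooth (v - u)) = 0"
proof -
  have "(LINT v|unif. sawtooth (v - u)) =
    ((\<lambda>v. - (v - u) - (v - u)\<^sup>2) u - (\<lambda>v. - (v - u) - (v - u)\<^sup>2) 0)
     + ((\<lambda>v. (v - u) - (v - u)\<^sup>2) 1 - (\<lambda>v. (v - u) - (v - u)\<^sup>2) u)"
  proof (rule integral_unif_piecewise[OF u, where B = 3 and fl = "\<lambda>v. - 1 - 2 * (v - u)" and fr = "\<lambda>v. 1 - 2 * (v - u)"])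
    show "\<bar>sawtooth (x - u)\<bar> \<le> 3" if "x \<in> {0..1}" for x
      by (rule sawtooth_abs_le[OF diff_unit[OF u that]])
  qed (auto intro!: derivative_eq_intros simp: sawtooth_def)
  also have "\<dots> = 0" by (simp add: power2_eq_square algebra_simps)
  finally show ?thesis .
qed

lemma integral_sawtooth_square:
  assumes u: "u \<in> {0..1}"
  shows "(LINT v|unif. (sawtooth (v - u))\<^sup>2) = 1 / 3"
proof -
  have "(LINT v|unif. (sawtooth (v - u))\<^sup>2) =
    ((\<lambda>v. (1 + 2 * (v - u)) ^ 3 / 6) u - (\<lambda>v. (1 + 2 * (v - u)) ^ 3 / 6) 0)
     + ((\<lambda>v. - ((1 - 2 * (v - u)) ^ 3 / 6)) 1 - (\<lambda>v. - ((1 - 2 * (v - u)) ^ 3 / 6)) u)"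
  proof (rule integral_unif_piecewise[OF u, where B = "3\<^sup>2" and fl = "\<lambda>v. (1 + 2 * (v - u))\<^sup>2" and fr = "\<lambda>v. (1 - 2 * (v - u))\<^sup>2"])
    show "abs ((sawtooth (x - u))\<^sup>2) \<le> 3\<^sup>2" if "x \<in> {0..1}" for x
      using sawtooth_abs_le[OF diff_unit[OF u that]] abs_le_square_iff[of "sawtooth (x - u)" 3] by simp
    show "(sawtooth (x - u))\<^sup>2 = (1 + 2 * (x - u))\<^sup>2" if "x < u" for x
      using that by (simp add: sawtooth_def power2_eq_square algebra_simps)
    show "(sawtooth (x - u))\<^sup>2 = (1 - 2 * (x - u))\<^sup>2" if "x > u" for x
      using that by (simp add: sawtooth_def)
  qed (auto intro!: derivative_eq_intros simp: power2_eq_square)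
  also have "\<dots> = 1 / 3" by (simp add: power3_eq_cube field_simps)
  finally show ?thesis .
qed

lemma integral_sawtooth_sin:
  assumes u: "u \<in> {0..1}" and k: "k > 0"
  shows "(LINT v|unif. sawtooth (v - u) * sin (2 * pi * real k * (v - u))) = 1 / (pi * real k)"
proof -
  define a where "a = 2 * pi * real k"
  have a: "a > 0" using k by (simp add: a_def)
  let ?G1 = "\<lambda>v. (1 + 2 * (v - u)) * cos (a * (v - u)) / a - 2 * sin (a * (v - u)) / a\<^sup>2"
  let ?G2 = "\<lambda>v. - ((1 - 2 * (v - u)) * cos (a * (v - u))) / a - 2 * sin (a * (v - u)) / a\<^sup>2"
  have "(LINT v|unif. sawtooth (v - u) * sin (a * (v - u))) = (?G1 u - ?G1 0) + (?G2 1 - ?G2 u)"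
  proof (rule integral_unif_piecewise[OF u, where B = "3 * 1" and fl = "\<lambda>v. (- 1 - 2 * (v - u)) * sin (a * (v - u))"
      and fr = "\<lambda>v. (1 - 2 * (v - u)) * sin (a * (v - u))"])
    show "\<bar>sawtooth (x - u) * sin (a * (x - u))\<bar> \<le> 3 * 1" if "x \<in> {0..1}" for x
      unfolding abs_mult using sawtooth_abs_le[OF diff_unit[OF u that]] by (intro mult_mono) auto
    show "(?G1 has_real_derivative (- 1 - 2 * (x - u)) * sin (a * (x - u))) (at x)" for x
      using a by (auto intro!: derivative_eq_intros simp: field_simps power2_eq_square)
    show "(?G2 has_real_derivative (1 - 2 * (x - u)) * sin (a * (x - u))) (at x)" for x
      using a by (auto intro!: derivative_eq_intros simp: field_simps power2_eq_square)
  qed (auto simp: sawtooth_def)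
  moreover have "cos (a * (1 - u)) = cos (a * u)" "sin (a * (1 - u)) = - sin (a * u)"
  proof -
    have "a * (1 - u) = - (a * u) + of_int (int k) * (2 * pi)" by (simp add: a_def algebra_simps)
    then show "cos (a * (1 - u)) = cos (a * u)" "sin (a * (1 - u)) = - sin (a * u)"
      using cos.plus_of_int[of "- (a * u)" "int k"] sin.plus_of_int[of "- (a * u)" "int k"] by simp_all
  qed
  ultimately have "(LINT v|unif. sawtooth (v - u) * sin (a * (v - u))) = 2 / a"
    using a by (simp add: field_simps)
  then show ?thesis by (simp add: a_def)
qed

lemma integral_sin_sin:
  assumes "k > 0" "l > 0"
  shows "(LINT v|unif. sin (2 * pi * real k * (v - u)) * sin (2 * pi * real l * (v - u))) = (if k = l then 1 / 2 else 0)"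
proof -
  have eq: "sin (2 * pi * real k * (v - u)) * sin (2 * pi * real l * (v - u)) =
    (cos (2 * pi * ((real l - real k) * u + of_int (int k - int l) * v)) - cos (2 * pi * (- (real k + real l) * u + of_int (int k + int l) * v))) / 2" for v
    unfolding sin_times_sin by (simp add: algebra_simps)
  have i: "integrable unif (\<lambda>v. cos (2 * pi * (\<theta> + of_int m * v)))" for \<theta> m
    by (rule integrable_unif[where B = 1]) auto
  have "(LINT v|unif. sin (2 * pi * real k * (v - u)) * sin (2 * pi * real l * (v - u))) =
     ((LINT v|unif. cos (2 * pi * ((real l - real k) * u + of_int (int k - int l) * v))) - (LINT v|unif. cos (2 * pi * (- (real k + real l) * u + of_int (int k + int l) * v)))) / 2"
    unfolding eq by (simp add: i del: of_int_add of_int_diff)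
  also have "\<dots> = (if k = l then 1 / 2 else 0)"
    unfolding integral_unif_cos using assms by auto
  finally show ?thesis .
qed

lemma integral_sin:
  assumes "k > 0"
  shows "(LINT v|unif. sin (2 * pi * real k * (v - u))) = 0"
proof -
  have "sin (2 * pi * real k * (v - u)) = cos (2 * pi * ((- real k * u - 1 / 4) + of_int (int k) * v))" for v
  proof -
    have "2 * pi * ((- real k * u - 1 / 4) + of_int (int k) * v) = - (pi / 2 - 2 * pi * real k * (v - u))"
      by (simp add: algebra_simps)
    then show ?thesis by (simp only: cos_minus sin_cos_eq of_real_eq_id id_apply)
  qed
  then show ?thesis unfolding integral_unif_cos using assms by (simp only: integral_unif_cos) auto
qed

text \<open>Partial Parseval sum of the sawtooth: half the squared coefficients 2 / (pi k), with
  total 1/3.\<close>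

definition sawtooth_energy :: "nat \<Rightarrow> real" where
  "sawtooth_energy m = (\<Sum>q<m. 2 / (pi * real (Suc q))\<^sup>2)"

text \<open>The truncation is an orthogonal projection of the sawtooth, hence its product with the
  sawtooth and its own square have the same integral.\<close>

lemma
  assumes u: "u \<in> {0..1}"
  shows integral_sawtooth_trunc: "(LINT v|unif. sawtooth_trunc m (v - u)) = 0"
    and integral_sawtooth_sawtooth_trunc: "(LINT v|unif. sawtooth (v - u) * sawtooth_trunc m (v - u)) = sawtooth_energy m"
    and integral_sawtooth_trunc_square: "(LINT v|unif. (sawtooth_trunc m (v - u))\<^sup>2) = sawtooth_energy m"
proof -
  have i: "integrable unif (\<lambda>v. c * sin (2 * pi * real k * (v - u)))" for k c
    by (rule integrable_unif[where B = "\<bar>c\<bar>"]) (auto simp: abs_mult mult_left_le)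
  show "(LINT v|unif. sawtooth_trunc m (v - u)) = 0"
    unfolding sawtooth_trunc_def Bochner_Integration.integral_sum[OF i] integral_mult_right_zero integral_sin[OF zero_less_Suc]
    by simp
  have i2: "integrable unif (\<lambda>v. sawtooth (v - u) * (c * sin (2 * pi * real k * (v - u))))" for k c
  proof (rule integrable_unif[where B = "3 * \<bar>c\<bar>"])
    fix x :: real assume x: "x \<in> {0..1}"
    show "\<bar>sawtooth (x - u) * (c * sin (2 * pi * real k * (x - u)))\<bar> \<le> 3 * \<bar>c\<bar>"
      unfolding abs_mult using sawtooth_abs_le[OF diff_unit[OF u x]] by (intro mult_mono) (auto simp: mult_left_le)
  qed measurable
  have "(LINT v|unif. sawtooth (v - u) * sawtooth_trunc m (v - u)) =
      (\<Sum>q<m. LINT v|unif. sawtooth (v - u) * (2 / (pi * real (Suc q)) * sin (2 * pi * real (Suc q) * (v - u))))"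
    unfolding sawtooth_trunc_def sum_distrib_left by (rule Bochner_Integration.integral_sum[OF i2])
  also have "\<dots> = (\<Sum>q<m. 2 / (pi * real (Suc q)) * (1 / (pi * real (Suc q))))"
  proof (rule sum.cong[OF refl])
    fix q
    have "(LINT v|unif. sawtooth (v - u) * (2 / (pi * real (Suc q)) * sin (2 * pi * real (Suc q) * (v - u))))
      = (LINT v|unif. 2 / (pi * real (Suc q)) * (sawtooth (v - u) * sin (2 * pi * real (Suc q) * (v - u))))"
      by (simp only: mult_ac)
    also have "\<dots> = 2 / (pi * real (Suc q)) * (1 / (pi * real (Suc q)))"
      unfolding integral_mult_right_zero integral_sawtooth_sin[OF u zero_less_Suc] ..
    finally show "(LINT v|unif. sawtooth (v - u) * (2 / (pi * real (Suc q)) * sin (2 * pi * real (Suc q) * (v - u)))) = \<dots>" .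
  qed
  also have "\<dots> = sawtooth_energy m"
    unfolding sawtooth_energy_def by (simp add: power2_eq_square)
  finally show "(LINT v|unif. sawtooth (v - u) * sawtooth_trunc m (v - u)) = sawtooth_energy m" .
  have i3: "integrable unif (\<lambda>v. c * (sin (2 * pi * real k * (v - u)) * sin (2 * pi * real l * (v - u))))" for k l c
  proof (rule integrable_unif[where B = "\<bar>c\<bar> * (1 * 1)"])
    show "\<bar>c * (sin (2 * pi * real k * (x - u)) * sin (2 * pi * real l * (x - u)))\<bar> \<le> \<bar>c\<bar> * (1 * 1)" for x
      unfolding abs_mult by (intro mult_mono) auto
  qed measurable
  have "(LINT v|unif. (sawtooth_trunc m (v - u))\<^sup>2) = (LINT v|unif. (\<Sum>q<m. \<Sum>r<m.
      2 / (pi * real (Suc q)) * (2 / (pi * real (Suc r))) * (sin (2 * pi * real (Suc q) * (v - u)) * sin (2 * pi * real (Suc r) * (v - u)))))"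
    unfolding sawtooth_trunc_def power2_eq_square sum_product by (simp only: mult_ac)
  also have "\<dots> = (\<Sum>q<m. \<Sum>r<m. 2 / (pi * real (Suc q)) * (2 / (pi * real (Suc r))) * (if q = r then 1 / 2 else 0))"
    by (simp only: Bochner_Integration.integral_sum[OF Bochner_Integration.integrable_sum[OF i3]] Bochner_Integration.integral_sum[OF i3]
          integral_mult_right_zero integral_sin_sin[OF zero_less_Suc zero_less_Suc] nat.inject)
  also have "\<dots> = sawtooth_energy m"
    unfolding sawtooth_energy_def by (simp add: power2_eq_square mult_ac if_distrib cong: if_cong)
  finally show "(LINT v|unif. (sawtooth_trunc m (v - u))\<^sup>2) = sawtooth_energy m" .
qed

section \<open>Orthogonality of the pair terms\<close>

lemma sample_diff_le:
  "x \<in> space (sample n) \<Longrightarrow> i \<le> 2 * n \<Longrightarrow> j \<le> 2 * n \<Longrightarrow> \<bar>x j - x i\<bar> \<le> 1"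
  using sample_space[of x n i] sample_space[of x n j] by auto

text \<open>Resampling an endpoint \<open>c\<close> on which \<open>g\<close> does not depend
  averages the kernel to 0. Oddness reduces the case of the first endpoint to the second.\<close>

lemma sample_centered_product:
  fixes k :: "real \<Rightarrow> real" and g :: "(nat \<Rightarrow> real) \<Rightarrow> real"
  assumes ij: "i \<le> 2 * n" "j \<le> 2 * n" "i \<noteq> j" and c: "c = i \<or> c = j"
    and [measurable]: "k \<in> borel_measurable borel" and kB: "\<And>d. \<bar>d\<bar> \<le> 1 \<Longrightarrow> \<bar>k d\<bar> \<le> B"
    and odd: "\<And>d. k (- d) = - k d" and k0: "\<And>u. u \<in> {0..1} \<Longrightarrow> (LINT v|unif. k (v - u)) = 0"
    and [measurable]: "g \<in> borel_measurable (sample n)" and gB: "\<And>x. x \<in> space (sample n) \<Longrightarrow> \<bar>g x\<bar> \<le> B'"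
    and g: "\<And>x u. g (x(c := u)) = g x"
  shows "(LINT x|sample n. k (x j - x i) * g x) = 0"
proof -
  have c': "c \<le> 2 * n" using c ij by auto
  have [measurable]: "(\<lambda>x. x i) \<in> borel_measurable (sample n)" "(\<lambda>x. x j) \<in> borel_measurable (sample n)"
    using ij by simp_all
  have "(LINT x|sample n. k (x j - x i) * g x) =
    (LINT x|sample n. LINT u|unif. k ((x(c := u)) j - (x(c := u)) i) * g (x(c := u)))"
  proof (rule sample_resample[OF c'])
    fix x assume x: "x \<in> space (sample n)"
    show "norm (k (x j - x i) * g x) \<le> B * B'"
      unfolding real_norm_def abs_mult using kB[OF sample_diff_le[OF x ij(1,2)]] gB[OF x]
      by (intro mult_mono) auto
  qed measurable
  also have "\<dots> = (LINT x|sample n. 0)"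
  proof (rule Bochner_Integration.integral_cong[OF refl])
    fix x assume x: "x \<in> space (sample n)"
    show "(LINT u|unif. k ((x(c := u)) j - (x(c := u)) i) * g (x(c := u))) = 0"
    proof (cases "c = j")
      case True
      show ?thesis unfolding g integral_mult_left_zero using ij True k0[OF sample_space[OF x ij(1)]] by simp
    next
      case False
      then have ci: "c = i" using c by auto
      have "(LINT u|unif. k (x j - u)) = 0"
      proof -
        have "k (x j - u) = - k (u - x j)" for u using odd[of "u - x j"] by simp
        then show ?thesis using k0[OF sample_space[OF x ij(2)]] by simp
      qed
      then show ?thesis unfolding g integral_mult_left_zero using ij ci by simp
    qed
  qed
  finally show ?thesis by simp
qed

lemma sample_pair_square:
  fixes k :: "real \<Rightarrow> real"
  assumes ij: "i \<le> 2 * n" "j \<le> 2 * n" "i \<noteq> j"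
    and [measurable]: "k \<in> borel_measurable borel" and kB: "\<And>d. \<bar>d\<bar> \<le> 1 \<Longrightarrow> \<bar>k d\<bar> \<le> B"
    and s: "\<And>u. u \<in> {0..1} \<Longrightarrow> (LINT v|unif. (k (v - u))\<^sup>2) = s"
  shows "(LINT x|sample n. (k (x j - x i))\<^sup>2) = s"
proof -
  have [measurable]: "(\<lambda>x. x i) \<in> borel_measurable (sample n)" "(\<lambda>x. x j) \<in> borel_measurable (sample n)"
    using ij by simp_all
  have "(LINT x|sample n. (k (x j - x i))\<^sup>2) =
    (LINT x|sample n. LINT u|unif. (k ((x(j := u)) j - (x(j := u)) i))\<^sup>2)"
  proof (rule sample_resample[OF ij(2)])
    fix x assume x: "x \<in> space (sample n)"
    show "norm ((k (x j - x i))\<^sup>2) \<le> B\<^sup>2"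
      using power_mono[OF kB[OF sample_diff_le[OF x ij(1,2)]], of 2] by simp
  qed measurable
  also have "\<dots> = (LINT x|sample n. s)"
    using ij s[OF sample_space] by (intro Bochner_Integration.integral_cong refl) auto
  finally show ?thesis by (simp add: sample.prob_space)
qed

lemma sample_sum_square:
  fixes k :: "nat \<times> nat \<Rightarrow> real \<Rightarrow> real"
  assumes J: "finite J" "\<And>i j. (i, j) \<in> J \<Longrightarrow> i \<le> 2 * n \<and> j \<le> 2 * n \<and> i \<noteq> j"
    and dist: "\<And>i j i' j'. (i, j) \<in> J \<Longrightarrow> (i', j') \<in> J \<Longrightarrow> (i, j) \<noteq> (i', j') \<Longrightarrow> {i, j} \<noteq> {i', j'}"
    and k [measurable]: "\<And>r. r \<in> J \<Longrightarrow> k r \<in> borel_measurable borel" and kB: "\<And>r d. r \<in> J \<Longrightarrow> \<bar>d\<bar> \<le> 1 \<Longrightarrow> \<bar>k r d\<bar> \<le> B"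
    and odd: "\<And>r d. r \<in> J \<Longrightarrow> k r (- d) = - k r d"
    and k0: "\<And>r u. r \<in> J \<Longrightarrow> u \<in> {0..1} \<Longrightarrow> (LINT v|unif. k r (v - u)) = 0"
    and s: "\<And>r u. r \<in> J \<Longrightarrow> u \<in> {0..1} \<Longrightarrow> (LINT v|unif. (k r (v - u))\<^sup>2) = s r"
  shows "(LINT x|sample n. (\<Sum>(i, j)\<in>J. k (i, j) (x j - x i))\<^sup>2) = (\<Sum>r\<in>J. s r)"
proof -
  define Y where "Y r x = k r (x (snd r) - x (fst r))" for r and x :: "nat \<Rightarrow> real"
  have Jr: "fst r \<le> 2 * n" "snd r \<le> 2 * n" "fst r \<noteq> snd r" if "r \<in> J" for r
    using J(2)[of "fst r" "snd r"] that by auto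
  have Ym [measurable]: "Y r \<in> borel_measurable (sample n)" if "r \<in> J" for r
  proof -
    have [measurable]: "(\<lambda>x. x (fst r)) \<in> borel_measurable (sample n)" "(\<lambda>x. x (snd r)) \<in> borel_measurable (sample n)"
      using Jr[OF that] by simp_all
    show ?thesis unfolding Y_def using k[OF that] by measurable
  qed
  have YB: "\<bar>Y r x\<bar> \<le> B" if "r \<in> J" "x \<in> space (sample n)" for r x
    unfolding Y_def using kB[OF that(1) sample_diff_le[OF that(2) Jr(1,2)[OF that(1)]]] .
  have int: "integrable (sample n) (\<lambda>x. Y r x * Y r' x)" if "r \<in> J" "r' \<in> J" for r r'
  proof (rule sample.integrable_const_bound[where B = "B * B"])
    show "AE x in sample n. norm (Y r x * Y r' x) \<le> B * B"
      unfolding real_norm_def abs_mult using that by (intro AE_I2 mult_mono YB) (auto intro: order_trans[OF abs_ge_zero YB])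
  qed (use that in measurable)
  have cross: "(LINT x|sample n. Y r x * Y r' x) = 0"
    if r: "r \<in> J" "r' \<in> J" and c: "c = fst r \<or> c = snd r" "c \<noteq> fst r'" "c \<noteq> snd r'" for r r' c
    unfolding Y_def[of r]
    by (rule sample_centered_product[where B = B and B' = B and c = c])
       (use r c Jr[OF r(1)] k[OF r(1)] kB[OF r(1)] odd[OF r(1)] k0[OF r(1)] Ym[OF r(2), unfolded Y_def[abs_def]] YB[OF r(2)] in \<open>auto simp: Y_def\<close>)
  have orth: "(LINT x|sample n. Y r x * Y r' x) = (if r = r' then s r else 0)" if r: "r \<in> J" "r' \<in> J" for r r'
  proof (cases "r = r'")
    case True
    have "(LINT x|sample n. (k r (x (snd r) - x (fst r)))\<^sup>2) = s r"
      by (rule sample_pair_square[where B = B])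
         (use Jr[OF r(1)] k[OF r(1)] kB[OF r(1)] s[OF r(1)] in auto)
    then show ?thesis using True by (simp add: Y_def power2_eq_square)
  next
    case False
    then have "{fst r, snd r} \<noteq> {fst r', snd r'}"
      using dist[of "fst r" "snd r" "fst r'" "snd r'"] r by (auto simp: prod_eq_iff)
    \<comment> \<open>Two different two-element sets: one endpoint of the first lies outside the
      second and can be averaged out.\<close>
    then have "(fst r \<noteq> fst r' \<and> fst r \<noteq> snd r') \<or> (snd r \<noteq> fst r' \<and> snd r \<noteq> snd r')"
      using Jr(3)[OF r(1)] Jr(3)[OF r(2)] by auto
    then have "(LINT x|sample n. Y r x * Y r' x) = 0"
      using cross[OF r, of "fst r"] cross[OF r, of "snd r"] by blast
    then show ?thesis using False by simp
  qed
  have "(LINT x|sample n. (\<Sum>(i, j)\<in>J. k (i, j) (x j - x i))\<^sup>2) = (LINT x|sample n. (\<Sum>r\<in>J. \<Sum>r'\<in>J. Y r x * Y r' x))"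
    unfolding power2_eq_square sum_product Y_def by (simp add: case_prod_unfold)
  also have "\<dots> = (\<Sum>r\<in>J. \<Sum>r'\<in>J. LINT x|sample n. Y r x * Y r' x)"
    by (simp add: Bochner_Integration.integral_sum Bochner_Integration.integrable_sum int)
  also have "\<dots> = (\<Sum>r\<in>J. \<Sum>r'\<in>J. if r = r' then s r else 0)"
    by (intro sum.cong refl orth)
  also have "\<dots> = (\<Sum>r\<in>J. s r)" using J(1) by simp
  finally show ?thesis .
qed

section \<open>Cyclic pairs modulo 2n+1\<close>

text \<open>Every unordered pair of distinct residues modulo $2n+1$ has exactly one of its two orientations in this set.\<close>
definition cyclic_pairs :: "nat \<Rightarrow> (nat \<times> nat) set" where
  "cyclic_pairs n = (\<lambda>(i, j). (i, (i + j) mod (2 * n + 1))) ` ({0..2*n} \<times> {1..n})"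

lemma cyclic_step_mod:
  assumes "i \<le> 2 * n" "1 \<le> j" "j \<le> (n::nat)"
  shows "(i + j) mod (2 * n + 1) = (if i + j \<le> 2 * n then i + j else i + j - (2 * n + 1))"
  using assms by (auto simp: mod_if)

lemma cyclic_step_mod_Suc:
  assumes "i \<le> 2 * n" "1 \<le> j" "j \<le> (n::nat)"
  shows "(i + j) mod Suc (2 * n) = (if i + j \<le> 2 * n then i + j else i + j - Suc (2 * n))"
  using cyclic_step_mod[OF assms] by simp

lemma cyclic_pairs_inj:
  "inj_on (\<lambda>(i, j). (i, (i + j) mod (2 * n + 1))) ({0..2*n} \<times> {1..n::nat})"
  by (intro inj_onI) (auto simp: cyclic_step_mod_Suc simp del: mod_add_left_eq mod_add_right_eq split: if_splits)

lemma finite_cyclic_pairs: "finite (cyclic_pairs n)"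
  by (simp add: cyclic_pairs_def)

lemma cyclic_pairs_le:
  "(i, j) \<in> cyclic_pairs n \<Longrightarrow> i \<le> 2 * n \<and> j \<le> 2 * n \<and> i \<noteq> j"
  by (auto simp: cyclic_pairs_def cyclic_step_mod_Suc split: if_splits)

text \<open>If both orientations occurred, with steps a and b, then a + b would be a multiple of 2 n
  + 1, yet it lies between 2 and 2 n.\<close>

lemma cyclic_pairs_distinct:
  assumes "(i, j) \<in> cyclic_pairs n" "(i', j') \<in> cyclic_pairs n" "(i, j) \<noteq> (i', j')"
  shows "{i, j} \<noteq> {i', j'}"
proof
  assume "{i, j} = {i', j'}"
  with assms(3) have eq: "i' = j" "j' = i" by (auto simp: doubleton_eq_iff)
  from assms(1) obtain a where a: "1 \<le> a" "a \<le> n" "i \<le> 2 * n" "j = (i + a) mod (2 * n + 1)"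
    by (auto simp: cyclic_pairs_def)
  from assms(2) obtain b where b: "1 \<le> b" "b \<le> n" "j \<le> 2 * n" "i = (j + b) mod (2 * n + 1)"
    by (auto simp: cyclic_pairs_def eq)
  have "j = i + a \<or> j + (2 * n + 1) = i + a"
    unfolding a(4) cyclic_step_mod[OF a(3,1,2)] by auto
  moreover have "i = j + b \<or> i + (2 * n + 1) = j + b"
    unfolding b(4) cyclic_step_mod[OF b(3,1,2)] by auto
  ultimately show False using a(1,2) b(1,2) by linarith
qed

lemma sum_cyclic_pairs:
  "(\<Sum>r\<in>cyclic_pairs n. f r) = (\<Sum>i=0..2*n. \<Sum>j=1..n. f (i, (i + j) mod (2 * n + 1)))"
  unfolding cyclic_pairs_def
  by (subst sum.reindex[OF cyclic_pairs_inj]) (simp add: sum.cartesian_product case_prod_unfold comp_def)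

section \<open>Trigonometric sums and the position kernel\<close>

lemma sin_pi_frac_pos:
  assumes "0 < k" "k < real N" shows "sin (pi * k / real N) > 0"
proof (rule sin_gt_zero)
  have "k / real N < 1" "real N > 0" using assms by (auto simp: divide_less_eq)
  then have "pi * (k / real N) < pi * 1" by (intro mult_strict_left_mono) auto
  then show "pi * k / real N < pi" by simp
qed (use assms in auto)

lemma sin_pi_frac_nonzero:
  assumes "k \<noteq> 0" "\<bar>k\<bar> < real N" shows "sin (pi * k / real N) \<noteq> 0"
proof (cases "k > 0")
  case True
  then show ?thesis using sin_pi_frac_pos[of k N] assms by auto
next
  case False
  then have "sin (pi * (- k) / real N) > 0" using assms by (intro sin_pi_frac_pos) auto
  then show ?thesis by auto
qed

text \<open>Each product 2 sin(x/2) cos(\<theta> + b x) is a difference of sines half a step apart.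
  All sums over full and half periods below come from this identity.\<close>

lemma sum_cos_telescope:
  "2 * sin (x / 2) * (\<Sum>b<M. cos (\<theta> + real b * x)) = sin (\<theta> + (real M - 1 / 2) * x) - sin (\<theta> - x / 2)"
proof (induction M)
  case (Suc M)
  have "2 * sin (x / 2) * cos (\<theta> + real M * x) = sin (\<theta> + (real M + 1 / 2) * x) - sin (\<theta> + (real M - 1 / 2) * x)"
  proof -
    have "\<theta> + (real M + 1 / 2) * x = (\<theta> + real M * x) + x / 2" "\<theta> + (real M - 1 / 2) * x = (\<theta> + real M * x) - x / 2"
      by (simp_all add: algebra_simps)
    then show ?thesis by (simp only: sin_add sin_diff) simp
  qed
  then show ?case using Suc by (simp add: algebra_simps)
qed (simp add: algebra_simps)

lemma sum_cos_full_period: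
  assumes "m \<noteq> 0" "\<bar>m\<bar> < int (2 * n + 1)"
  shows "(\<Sum>b=0..2*n. cos (2 * pi * (\<theta> + of_int m * (real b / real (2 * n + 1))))) = 0"
proof -
  let ?N = "real (2 * n + 1)"
  define x where "x = 2 * pi * of_int m / ?N"
  have N0: "?N \<noteq> 0" by simp
  have m': "\<bar>real_of_int m\<bar> < ?N"
    using assms(2) by linarith
  have s: "sin (x / 2) \<noteq> 0"
  proof -
    have "x / 2 = pi * of_int m / ?N" unfolding x_def by (simp only: divide_divide_eq_left) (simp add: field_simps)
    then show ?thesis using sin_pi_frac_nonzero[of "of_int m" "2 * n + 1"] assms m' by (simp only:) simp
  qed
  have Nx: "?N * x = of_int m * (2 * pi)" unfolding x_def using N0 by simp
  have "2 * sin (x / 2) * (\<Sum>b<2*n+1. cos (2 * pi * \<theta> + real b * x)) =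
     sin (2 * pi * \<theta> + (?N - 1 / 2) * x) - sin (2 * pi * \<theta> - x / 2)" by (rule sum_cos_telescope)
  also have "2 * pi * \<theta> + (?N - 1 / 2) * x = (2 * pi * \<theta> - x / 2) + of_int m * (2 * pi)"
    unfolding left_diff_distrib Nx by simp
  also have "sin \<dots> = sin (2 * pi * \<theta> - x / 2)"
    using sin.plus_of_int[of "2 * pi * \<theta> - x / 2" m] by simp
  finally have "(\<Sum>b<2*n+1. cos (2 * pi * \<theta> + real b * x)) = 0" using s by simp
  moreover have "2 * pi * (\<theta> + of_int m * (real b / ?N)) = 2 * pi * \<theta> + real b * x" for b
    by (simp add: x_def algebra_simps)
  moreover have "{0..2*n} = {..<2*n+1}" by auto
  ultimately show ?thesis by (simp only:)
qed

lemma sum_cos_half_period: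
  assumes "m \<noteq> 0" "\<bar>m\<bar> < int (2 * n + 1)"
  shows "(\<Sum>s=1..n. cos (2 * pi * of_int m * (real s / real (2 * n + 1)))) = - 1 / 2"
proof -
  let ?N = "real (2 * n + 1)"
  define x where "x = 2 * pi * of_int m / ?N"
  have m': "\<bar>real_of_int m\<bar> < ?N" using assms(2) by linarith
  have s: "sin (x / 2) \<noteq> 0"
  proof -
    have "x / 2 = pi * of_int m / ?N" unfolding x_def by (simp only: divide_divide_eq_left) (simp add: field_simps)
    then show ?thesis using sin_pi_frac_nonzero[of "of_int m" "2 * n + 1"] assms m' by (simp only:) simp
  qed
  have "2 * sin (x / 2) * (\<Sum>b<n. cos (x + real b * x)) = sin (x + (real n - 1 / 2) * x) - sin (x - x / 2)"
    by (rule sum_cos_telescope)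
  also have "x + (real n - 1 / 2) * x = (?N * x) / 2" by (simp add: algebra_simps add_divide_distrib)
  also have "?N * x = 2 * pi * of_int m" by (simp add: x_def)
  also have "2 * pi * of_int m / 2 = of_int m * pi" by simp
  also have "sin (of_int m * pi) = 0" by (simp add: mult.commute[of _ pi])
  finally have "2 * sin (x / 2) * (\<Sum>b<n. cos (x + real b * x)) = 2 * sin (x / 2) * (- 1 / 2)" by simp
  then have "(\<Sum>b<n. cos (x + real b * x)) = - 1 / 2" using s by (simp only: mult_left_cancel)
  moreover have "(\<Sum>s=1..n. cos (2 * pi * of_int m * (real s / ?N))) = (\<Sum>b<n. cos (x + real b * x))"
  proof (rule sum.reindex_bij_witness[of _ Suc "\<lambda>s. s - 1"])
    fix s assume "s \<in> {1..n}"
    then have "x + real (s - 1) * x = real s * x" by (simp add: of_nat_diff algebra_simps)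
    also have "\<dots> = 2 * pi * of_int m * (real s / ?N)" by (simp add: x_def)
    finally show "cos (x + real (s - 1) * x) = cos (2 * pi * of_int m * (real s / ?N))" by (simp only:)
  qed auto
  ultimately show ?thesis by simp
qed

text \<open>The value is half the cotangent of pi j / (2 (2 n + 1)), so it grows like 2 n / (pi j).
  Oddness of \<open>j\<close> enters through cos(j pi) = -1.\<close>

lemma sum_sin_half_period:
  assumes "odd j" "j < 2 * n + 1"
  shows "(\<Sum>s=1..n. sin (2 * pi * real j * (real s / real (2 * n + 1)))) =
    (1 + cos (pi * real j / real (2 * n + 1))) / (2 * sin (pi * real j / real (2 * n + 1)))"
proof -
  let ?N = "real (2 * n + 1)"
  define x where "x = 2 * pi * real j / ?N"
  have j: "j > 0" using assms by (auto intro: odd_pos)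
  have jN: "real j < ?N" using assms(2) by linarith
  have x2: "x / 2 = pi * real j / ?N"
    unfolding x_def by (simp only: divide_divide_eq_left) (simp add: field_simps)
  have s: "sin (x / 2) > 0"
    unfolding x2 using sin_pi_frac_pos[of "real j" "2 * n + 1"] j jN by (simp only: of_nat_0_less_iff)
  have "2 * sin (x / 2) * (\<Sum>b<n. cos ((x - pi / 2) + real b * x)) = sin ((x - pi / 2) + (real n - 1 / 2) * x) - sin ((x - pi / 2) - x / 2)"
    by (rule sum_cos_telescope)
  also have "(x - pi / 2) + (real n - 1 / 2) * x = (?N * x) / 2 - pi / 2" by (simp add: algebra_simps add_divide_distrib)
  also have "?N * x = 2 * pi * real j" by (simp add: x_def)
  also have "2 * pi * real j / 2 - pi / 2 = real j * pi - pi / 2" by simp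
  also have "sin (real j * pi - pi / 2) = 1"
    using assms(1) by (simp add: sin_diff cos_npi mult.commute[of _ pi])
  also have "(x - pi / 2) - x / 2 = x / 2 - pi / 2" by simp
  also have "sin (x / 2 - pi / 2) = - cos (x / 2)" by (simp add: sin_diff)
  finally have "(\<Sum>b<n. cos ((x - pi / 2) + real b * x)) = (1 + cos (x / 2)) / (2 * sin (x / 2))"
    using s by (simp add: field_simps)
  moreover have "(\<Sum>s=1..n. sin (2 * pi * real j * (real s / ?N))) = (\<Sum>b<n. cos ((x - pi / 2) + real b * x))"
  proof (rule sum.reindex_bij_witness[of _ Suc "\<lambda>s. s - 1"])
    fix s assume "s \<in> {1..n}"
    then have "(x - pi / 2) + real (s - 1) * x = - (pi / 2 - real s * x)" by (simp add: of_nat_diff algebra_simps)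
    also have "real s * x = 2 * pi * real j * (real s / ?N)" by (simp add: x_def)
    finally have "(x - pi / 2) + real (s - 1) * x = - (pi / 2 - 2 * pi * real j * (real s / ?N))" .
    then show "cos ((x - pi / 2) + real (s - 1) * x) = sin (2 * pi * real j * (real s / ?N))"
      by (simp only: cos_minus sin_cos_eq of_real_eq_id id_apply)
  qed auto
  ultimately show ?thesis unfolding x2 by (simp only:)
qed

text \<open>Partial Fourier sum of the wave of period 2 n + 1 that is 1 on its first half-period and
  -1 on the second. The steps 1, ..., n of cyclic pairs lie in the first half.\<close>

definition square_wave :: "nat \<Rightarrow> nat \<Rightarrow> real \<Rightarrow> real" where
  "square_wave m n d = (\<Sum>p<m. 4 / (pi * real (2 * p + 1)) * sin (2 * pi * real (2 * p + 1) * (d / real (2 * n + 1))))"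

definition wave_energy :: "nat \<Rightarrow> real" where
  "wave_energy m = (\<Sum>p<m. 8 / (pi * real (2 * p + 1))\<^sup>2)"

lemma square_wave_mean_tendsto:
  "(\<lambda>n. (\<Sum>s=1..n. square_wave m n (real s)) / real n) \<longlonglongrightarrow> wave_energy m"
proof -
  let ?S = "\<lambda>j n. \<Sum>s=1..n. sin (2 * pi * real j * (real s / real (2 * n + 1)))"
  have lim: "(\<lambda>n. ?S (2 * p + 1) n / real n) \<longlonglongrightarrow> 2 / (pi * real (2 * p + 1))" for p
  proof -
    define c where "c = pi * real (2 * p + 1)"
    have c: "c > 0" by (simp add: c_def)
    have "(\<lambda>n. (1 + cos (c / real (2 * n + 1))) / (2 * sin (c / real (2 * n + 1))) / real n) \<longlonglongrightarrow> 2 * inverse c"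
      using c by real_asymp
    moreover have "\<forall>\<^sub>F n in sequentially. (1 + cos (c / real (2 * n + 1))) / (2 * sin (c / real (2 * n + 1))) / real n = ?S (2 * p + 1) n / real n"
      using eventually_gt_at_top[of p]
      by eventually_elim (subst sum_sin_half_period, auto simp: c_def)
    ultimately show ?thesis unfolding c_def divide_inverse[of 2] by (rule Lim_transform_eventually)
  qed
  have "(\<lambda>n. \<Sum>p<m. 4 / (pi * real (2 * p + 1)) * (?S (2 * p + 1) n / real n)) \<longlonglongrightarrow>
     (\<Sum>p<m. 4 / (pi * real (2 * p + 1)) * (2 / (pi * real (2 * p + 1))))"
    by (intro tendsto_sum tendsto_mult_left lim)
  also have "(\<Sum>p<m. 4 / (pi * real (2 * p + 1)) * (2 / (pi * real (2 * p + 1)))) = wave_energy m"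
    unfolding wave_energy_def by (intro sum.cong refl) (simp add: power2_eq_square)
  also have "(\<lambda>n. \<Sum>p<m. 4 / (pi * real (2 * p + 1)) * (?S (2 * p + 1) n / real n)) = (\<lambda>n. (\<Sum>s=1..n. square_wave m n (real s)) / real n)"
  proof
    fix n
    have "(\<Sum>s=1..n. square_wave m n (real s)) = (\<Sum>p<m. 4 / (pi * real (2 * p + 1)) * ?S (2 * p + 1) n)"
      unfolding square_wave_def sum_distrib_left by (rule sum.swap)
    then show "(\<Sum>p<m. 4 / (pi * real (2 * p + 1)) * (?S (2 * p + 1) n / real n)) = (\<Sum>s=1..n. square_wave m n (real s)) / real n"
      by (simp only: sum_divide_distrib[where A = "{..<m}"] times_divide_eq_right)
  qed
  finally show ?thesis .
qed

text \<open>As \<open>n\<close> grows, averages over the steps become integrals over a half-period,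
  where the truncated wave approximates the constant 1 as a projection. Hence the mean square has
  the same limit as the mean.\<close>

lemma square_wave_square_mean_tendsto:
  "(\<lambda>n. (\<Sum>s=1..n. (square_wave m n (real s))\<^sup>2) / real n) \<longlonglongrightarrow> wave_energy m"
proof -
  let ?a = "\<lambda>p. 4 / (pi * real (2 * p + 1))"
  let ?C = "\<lambda>k n. \<Sum>s=1..n. cos (2 * pi * of_int k * (real s / real (2 * n + 1)))"
  have lim: "(\<lambda>n. ?C k n / real n) \<longlonglongrightarrow> (if k = 0 then 1 else 0)" for k
  proof (cases "k = 0")
    case True
    have "\<forall>\<^sub>F n in sequentially. ?C k n / real n = 1"
      using eventually_gt_at_top[of 0] by eventually_elim (simp add: True)
    then show ?thesis unfolding if_P[OF True] by (rule tendsto_eventually)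
  next
    case False
    have "(\<lambda>n. - 1 / 2 / real n) \<longlonglongrightarrow> 0" by real_asymp
    moreover have "\<forall>\<^sub>F n in sequentially. - 1 / 2 / real n = ?C k n / real n"
      using eventually_gt_at_top[of "nat \<bar>k\<bar>"]
    proof eventually_elim
      case (elim n)
      then have "\<bar>k\<bar> < int (2 * n + 1)" by linarith
      then show ?case using sum_cos_half_period[of k n] False by (simp only:) simp
    qed
    ultimately have "(\<lambda>n. ?C k n / real n) \<longlonglongrightarrow> 0" by (rule Lim_transform_eventually)
    then show ?thesis using False by simp
  qed
  have alg: "(A * S) * (B * T) = A * B / 2 * D" if "S * T = D / 2" for A B S T D :: real
  proof -
    have "(A * S) * (B * T) = (A * B) * (S * T)" by (simp only: mult_ac)
    then show ?thesis unfolding that by simp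
  qed
  \<comment> \<open>The frequencies 2 p + 1 and 2 r + 1 have difference 2 p - 2 r and sum 2 p + 2 r
    + 2. Only the difference with p = r is 0; every other cosine sum is -1/2 for large
    \<open>n\<close> and disappears after division by \<open>n\<close>.\<close>
  have "(\<lambda>n. \<Sum>p<m. \<Sum>r<m. ?a p * ?a r / 2 * (?C (2 * int p - 2 * int r) n / real n - ?C (2 * int p + 2 * int r + 2) n / real n)) \<longlonglongrightarrow>
     (\<Sum>p<m. \<Sum>r<m. ?a p * ?a r / 2 * ((if 2 * int p - 2 * int r = 0 then 1 else 0) - (if 2 * int p + 2 * int r + 2 = 0 then 1 else 0)))"
    by (intro tendsto_sum tendsto_mult_left tendsto_diff lim)
  also have "(\<Sum>p<m. \<Sum>r<m. ?a p * ?a r / 2 * ((if 2 * int p - 2 * int r = 0 then 1 else 0) - (if 2 * int p + 2 * int r + 2 = 0 then 1 else 0)))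
    = (\<Sum>p<m. \<Sum>r<m. if p = r then ?a p * ?a r / 2 else 0)"
    by (intro sum.cong refl) auto
  also have "\<dots> = wave_energy m"
    unfolding wave_energy_def by (simp add: power2_eq_square mult_ac)
  also have "(\<lambda>n. \<Sum>p<m. \<Sum>r<m. ?a p * ?a r / 2 * (?C (2 * int p - 2 * int r) n / real n - ?C (2 * int p + 2 * int r + 2) n / real n))
     = (\<lambda>n. (\<Sum>s=1..n. (square_wave m n (real s))\<^sup>2) / real n)"
  proof
    fix n
    let ?x = "\<lambda>s. real s / real (2 * n + 1)"
    have "(\<Sum>s=1..n. (square_wave m n (real s))\<^sup>2) = (\<Sum>s=1..n. \<Sum>p<m. \<Sum>r<m.
        ?a p * ?a r / 2 * (cos (2 * pi * of_int (2 * int p - 2 * int r) * ?x s) - cos (2 * pi * of_int (2 * int p + 2 * int r + 2) * ?x s)))"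
    proof (rule sum.cong[OF refl])
      fix s
      have "(square_wave m n (real s))\<^sup>2 = (\<Sum>p<m. \<Sum>r<m. (?a p * sin (2 * pi * real (2 * p + 1) * ?x s)) * (?a r * sin (2 * pi * real (2 * r + 1) * ?x s)))"
        unfolding square_wave_def power2_eq_square sum_product ..
      also have "\<dots> = (\<Sum>p<m. \<Sum>r<m. ?a p * ?a r / 2 * (cos (2 * pi * of_int (2 * int p - 2 * int r) * ?x s) - cos (2 * pi * of_int (2 * int p + 2 * int r + 2) * ?x s)))"
      proof (intro sum.cong refl)
        fix p r
        have "sin (2 * pi * real (2 * p + 1) * ?x s) * sin (2 * pi * real (2 * r + 1) * ?x s) =
          (cos (2 * pi * of_int (2 * int p - 2 * int r) * ?x s) - cos (2 * pi * of_int (2 * int p + 2 * int r + 2) * ?x s)) / 2"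
          unfolding sin_times_sin by (simp add: algebra_simps add_divide_distrib diff_divide_distrib)
        then show "(?a p * sin (2 * pi * real (2 * p + 1) * ?x s)) * (?a r * sin (2 * pi * real (2 * r + 1) * ?x s)) =
          ?a p * ?a r / 2 * (cos (2 * pi * of_int (2 * int p - 2 * int r) * ?x s) - cos (2 * pi * of_int (2 * int p + 2 * int r + 2) * ?x s))"
          by (rule alg)
      qed
      finally show "(square_wave m n (real s))\<^sup>2 = \<dots>" .
    qed
    also have "\<dots> = (\<Sum>p<m. \<Sum>r<m. \<Sum>s=1..n. ?a p * ?a r / 2 * (cos (2 * pi * of_int (2 * int p - 2 * int r) * ?x s) - cos (2 * pi * of_int (2 * int p + 2 * int r + 2) * ?x s)))"
      by (rule trans[OF sum.swap], rule sum.cong[OF refl], rule sum.swap)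
    also have "\<dots> = (\<Sum>p<m. \<Sum>r<m. ?a p * ?a r / 2 * (?C (2 * int p - 2 * int r) n - ?C (2 * int p + 2 * int r + 2) n))"
      by (simp only: sum_distrib_left[symmetric] sum_subtractf)
    finally show "(\<Sum>p<m. \<Sum>r<m. ?a p * ?a r / 2 * (?C (2 * int p - 2 * int r) n / real n - ?C (2 * int p + 2 * int r + 2) n / real n))
      = (\<Sum>s=1..n. (square_wave m n (real s))\<^sup>2) / real n"
      by (simp only: sum_divide_distrib[where A = "{..<m}"] times_divide_eq_right[symmetric] diff_divide_distrib)
  qed
  finally show ?thesis .
qed

section \<open>Mean square error of the truncation\<close>

lemma cyclic_shift_bij:
  assumes "1 \<le> s" "s \<le> (n::nat)"
  shows "bij_betw (\<lambda>i. (i + s) mod (2 * n + 1)) {0..2*n} {0..2*n}"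
proof -
  have inj: "inj_on (\<lambda>i. (i + s) mod (2 * n + 1)) {0..2*n}"
  proof (rule inj_onI)
    fix i j assume ij: "i \<in> {0..2*n}" "j \<in> {0..2*n}" "(i + s) mod (2 * n + 1) = (j + s) mod (2 * n + 1)"
    then have "(if i + s \<le> 2 * n then i + s else i + s - (2 * n + 1)) = (if j + s \<le> 2 * n then j + s else j + s - (2 * n + 1))"
      using assms cyclic_step_mod[of i n s] cyclic_step_mod[of j n s] by (simp only: atLeastAtMost_iff)
    then show "i = j" using ij(1,2) by (auto split: if_splits)
  qed
  have "(\<lambda>i. (i + s) mod (2 * n + 1)) ` {0..2*n} \<subseteq> {0..2*n}"
    by (rule image_subsetI) (simp add: less_Suc_eq_le[symmetric])
  from endo_inj_surj[OF _ this inj] inj show ?thesis unfolding bij_betw_def by blast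
qed

text \<open>For each fixed step the cyclic shift permutes the residues, so the differences cancel.
  This allows the linear part to be subtracted without changing the writhe.\<close>

lemma sum_cyclic_differences:
  fixes x :: "nat \<Rightarrow> real"
  shows "(\<Sum>(i, j)\<in>cyclic_pairs n. x j - x i) = 0"
proof -
  have "(\<Sum>(i, j)\<in>cyclic_pairs n. x j - x i) = (\<Sum>i=0..2*n. \<Sum>s=1..n. x ((i + s) mod (2 * n + 1)) - x i)"
    by (simp only: sum_cyclic_pairs prod.case)
  also have "\<dots> = (\<Sum>s=1..n. \<Sum>i=0..2*n. x ((i + s) mod (2 * n + 1)) - x i)" by (rule sum.swap)
  also have "\<dots> = (\<Sum>s=1..n. 0)"
  proof (rule sum.cong[OF refl])
    fix s assume "s \<in> {1..n}"
    then have "(\<Sum>i=0..2*n. x ((i + s) mod (2 * n + 1))) = (\<Sum>i=0..2*n. x i)"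
      by (intro sum.reindex_bij_betw[OF cyclic_shift_bij]) auto
    then show "(\<Sum>i=0..2*n. x ((i + s) mod (2 * n + 1)) - x i) = 0" by (simp only: sum_subtractf diff_self)
  qed
  finally show ?thesis by simp
qed

lemma writhe_eq_sum_sawtooth:
  "writhe n x = (\<Sum>(i, j)\<in>cyclic_pairs n. sawtooth (x j - x i))"
proof -
  have "writhe n x = (\<Sum>(i, j)\<in>cyclic_pairs n. sgn (x j - x i))"
    by (simp only: writhe_def sum_cyclic_pairs prod.case)
  moreover have "(\<Sum>(i, j)\<in>cyclic_pairs n. sawtooth (x j - x i)) =
    (\<Sum>(i, j)\<in>cyclic_pairs n. sgn (x j - x i)) - 2 * (\<Sum>(i, j)\<in>cyclic_pairs n. x j - x i)"
    unfolding sawtooth_def case_prod_unfold sum_subtractf sum_distrib_left[symmetric] ..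
  ultimately show ?thesis unfolding sum_cyclic_differences by simp
qed

definition trunc_writhe :: "nat \<Rightarrow> nat \<Rightarrow> (nat \<Rightarrow> real) \<Rightarrow> real" where
  "trunc_writhe m n x = (\<Sum>(i, j)\<in>cyclic_pairs n. square_wave m n (real j - real i) * sawtooth_trunc m (x j - x i))"

lemma square_wave_minus: "square_wave m n (- d) = - square_wave m n d"
  by (simp add: square_wave_def sum_negf)

lemma square_wave_step:
  assumes "i \<le> 2 * n" "1 \<le> s" "s \<le> n"
  shows "square_wave m n (real ((i + s) mod (2 * n + 1)) - real i) = square_wave m n (real s)"
proof (cases "i + s \<le> 2 * n")
  case True
  then show ?thesis using cyclic_step_mod[OF assms] by simp
next
  case False
  let ?N = "real (2 * n + 1)"
  have e: "real ((i + s) mod (2 * n + 1)) - real i = real s - ?N"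
    using cyclic_step_mod[OF assms] False by (simp add: of_nat_diff)
  have "sin (2 * pi * real (2 * p + 1) * ((real s - ?N) / ?N)) = sin (2 * pi * real (2 * p + 1) * (real s / ?N))" for p
  proof -
    have "2 * pi * real (2 * p + 1) * ((real s - ?N) / ?N) = 2 * pi * real (2 * p + 1) * (real s / ?N) + of_int (- int (2 * p + 1)) * (2 * pi)"
      by (simp add: diff_divide_distrib algebra_simps)
    then show ?thesis
      using sin.plus_of_int[of "2 * pi * real (2 * p + 1) * (real s / ?N)" "- int (2 * p + 1)"] by (simp only: of_real_eq_id id_apply)
  qed
  then show ?thesis unfolding e square_wave_def by (simp only:)
qed

text \<open>The kernels of the error are odd and centered, so the second moments of the pair terms
  simply add up. Expanding one square leaves 1/3 for the sawtooth and the same energy for the mixed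
  and the truncated part.\<close>

lemma writhe_truncation_error:
  "(LINT x|sample n. (writhe n x - trunc_writhe m n x)\<^sup>2) =
    real (2 * n + 1) * (\<Sum>s=1..n. 1 / 3 - 2 * square_wave m n (real s) * sawtooth_energy m + (square_wave m n (real s))\<^sup>2 * sawtooth_energy m)"
proof -
  define a where "a = (\<lambda>(i, j). square_wave m n (real j - real i))"
  define k where "k r d = sawtooth d - a r * sawtooth_trunc m d" for r d
  let ?s = "\<lambda>r. 1 / 3 - 2 * a r * sawtooth_energy m + (a r)\<^sup>2 * sawtooth_energy m"
  define B where "B = (\<Sum>r\<in>cyclic_pairs n. \<bar>a r\<bar>)"
  have aB: "\<bar>a r\<bar> \<le> B" if "r \<in> cyclic_pairs n" for r
    unfolding B_def using that by (intro member_le_sum) (auto simp: finite_cyclic_pairs)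
  have st_bd: "\<bar>sawtooth (x - u)\<bar> \<le> 3" if "x \<in> {0..1}" "u \<in> {0..1}" for x u
    by (rule sawtooth_abs_le[OF diff_unit[OF that(2,1)]])
  have i1: "integrable unif (\<lambda>v. sawtooth (v - u))" if "u \<in> {0..1}" for u
    by (rule integrable_unif[where B = 3]) (use st_bd that in auto)
  have i2: "integrable unif (\<lambda>v. sawtooth_trunc m (v - u))" for u
    by (rule integrable_unif[where B = m]) (auto intro: sawtooth_trunc_abs_le)
  have i3: "integrable unif (\<lambda>v. (sawtooth (v - u))\<^sup>2)" if "u \<in> {0..1}" for u
  proof (rule integrable_unif[where B = "3\<^sup>2"])
    show "abs ((sawtooth (x - u))\<^sup>2) \<le> 3\<^sup>2" if "x \<in> {0..1}" for x
      using st_bd[OF that \<open>u \<in> {0..1}\<close>] abs_le_square_iff[of "sawtooth (x - u)" 3] by simp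
  qed measurable
  have i4: "integrable unif (\<lambda>v. sawtooth (v - u) * sawtooth_trunc m (v - u))" if "u \<in> {0..1}" for u
    by (rule integrable_unif[where B = "3 * m"])
       (use st_bd[OF _ that] sawtooth_trunc_abs_le in \<open>auto simp: abs_mult intro!: mult_mono\<close>)
  have i5: "integrable unif (\<lambda>v. (sawtooth_trunc m (v - u))\<^sup>2)" for u
  proof (rule integrable_unif[where B = "(real m)\<^sup>2"])
    show "abs ((sawtooth_trunc m (x - u))\<^sup>2) \<le> (real m)\<^sup>2" for x
      using sawtooth_trunc_abs_le[of m "x - u"] abs_le_square_iff[of "sawtooth_trunc m (x - u)" "real m"] by simp
  qed measurable
  have "writhe n x - trunc_writhe m n x = (\<Sum>(i, j)\<in>cyclic_pairs n. k (i, j) (x j - x i))" for x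
    unfolding writhe_eq_sum_sawtooth trunc_writhe_def k_def a_def by (simp add: sum_subtractf case_prod_unfold)
  then have "(LINT x|sample n. (writhe n x - trunc_writhe m n x)\<^sup>2) = (LINT x|sample n. (\<Sum>(i, j)\<in>cyclic_pairs n. k (i, j) (x j - x i))\<^sup>2)"
    by simp
  also have "\<dots> = (\<Sum>r\<in>cyclic_pairs n. ?s r)"
  proof (rule sample_sum_square[where B = "3 + B * m"])
    show "k r \<in> borel_measurable borel" for r unfolding k_def by measurable
    show "k r (- d) = - k r d" for r d by (simp add: k_def sawtooth_minus sawtooth_trunc_minus)
    show "\<bar>k r d\<bar> \<le> 3 + B * m" if "r \<in> cyclic_pairs n" "\<bar>d\<bar> \<le> 1" for r d
    proof -
      have "\<bar>k r d\<bar> \<le> \<bar>sawtooth d\<bar> + \<bar>a r\<bar> * \<bar>sawtooth_trunc m d\<bar>"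
        unfolding k_def abs_mult[symmetric] by (rule abs_triangle_ineq4)
      also have "\<dots> \<le> 3 + B * m"
        using sawtooth_abs_le[OF that(2)] aB[OF that(1)] sawtooth_trunc_abs_le[of m d]
        by (intro add_mono mult_mono) (auto intro: order_trans[OF abs_ge_zero])
      finally show ?thesis .
    qed
    fix r u assume u: "u \<in> {0..1::real}"
    show "(LINT v|unif. k r (v - u)) = 0"
      unfolding k_def using i1[OF u] i2 by (simp add: integral_sawtooth[OF u] integral_sawtooth_trunc[OF u])
    have "(k r (v - u))\<^sup>2 = (sawtooth (v - u))\<^sup>2 - 2 * a r * (sawtooth (v - u) * sawtooth_trunc m (v - u)) + (a r)\<^sup>2 * (sawtooth_trunc m (v - u))\<^sup>2" for v
      unfolding k_def by (simp add: power2_eq_square algebra_simps)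
    then show "(LINT v|unif. (k r (v - u))\<^sup>2) = ?s r"
      using i3[OF u] i4[OF u] i5
      by (simp add: integral_sawtooth_square[OF u] integral_sawtooth_sawtooth_trunc[OF u] integral_sawtooth_trunc_square[OF u])
  qed (auto simp: finite_cyclic_pairs dest: cyclic_pairs_le cyclic_pairs_distinct)
  also have "\<dots> = (\<Sum>i=0..2*n. \<Sum>s=1..n. 1 / 3 - 2 * square_wave m n (real s) * sawtooth_energy m + (square_wave m n (real s))\<^sup>2 * sawtooth_energy m)"
    unfolding sum_cyclic_pairs by (intro sum.cong refl) (simp only: a_def prod.case square_wave_step atLeastAtMost_iff)
  finally show ?thesis by simp
qed

text \<open>Mean and mean square of the wave share a limit, so -2 w h + w h collapses to -w h; the
  factor 2 is the limit of (2 n + 1) / n.\<close>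

lemma writhe_truncation_error_tendsto:
  "(\<lambda>n. (LINT x|sample n. (writhe n x - trunc_writhe m n x)\<^sup>2) / (real n)\<^sup>2) \<longlonglongrightarrow> 2 * (1 / 3 - wave_energy m * sawtooth_energy m)"
proof -
  let ?H = "sawtooth_energy m"
  let ?A = "\<lambda>n. (\<Sum>s=1..n. square_wave m n (real s)) / real n"
  let ?Q = "\<lambda>n. (\<Sum>s=1..n. (square_wave m n (real s))\<^sup>2) / real n"
  have "(\<lambda>n. real (2 * n + 1) / real n) \<longlonglongrightarrow> 2" by real_asymp
  then have "(\<lambda>n. real (2 * n + 1) / real n * (1 / 3 - 2 * ?A n * ?H + ?Q n * ?H)) \<longlonglongrightarrow> 2 * (1 / 3 - 2 * wave_energy m * ?H + wave_energy m * ?H)"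
    by (intro tendsto_intros square_wave_mean_tendsto square_wave_square_mean_tendsto)
  moreover have "\<forall>\<^sub>F n in sequentially. real (2 * n + 1) / real n * (1 / 3 - 2 * ?A n * ?H + ?Q n * ?H) =
     (LINT x|sample n. (writhe n x - trunc_writhe m n x)\<^sup>2) / (real n)\<^sup>2"
    using eventually_gt_at_top[of 0]
  proof eventually_elim
    case (elim n)
    have "(\<Sum>s=1..n. 1 / 3 - 2 * square_wave m n (real s) * ?H + (square_wave m n (real s))\<^sup>2 * ?H)
      = real n / 3 - 2 * (\<Sum>s=1..n. square_wave m n (real s)) * ?H + (\<Sum>s=1..n. (square_wave m n (real s))\<^sup>2) * ?H"
      by (simp add: sum.distrib sum_subtractf sum_distrib_left sum_distrib_right)
    also have "\<dots> = real n * (1 / 3 - 2 * ?A n * ?H + ?Q n * ?H)" using elim by (simp add: field_simps)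
    finally show ?case unfolding writhe_truncation_error using elim by (simp add: power2_eq_square)
  qed
  ultimately have "(\<lambda>n. (LINT x|sample n. (writhe n x - trunc_writhe m n x)\<^sup>2) / (real n)\<^sup>2) \<longlonglongrightarrow>
      2 * (1 / 3 - 2 * wave_energy m * ?H + wave_energy m * ?H)" by (rule Lim_transform_eventually)
  then show ?thesis by (simp add: algebra_simps)
qed

section \<open>Joint Gaussian limit of the Fourier modes\<close>

text \<open>Second-order expansion: A^3 bounds the cubic remainder of the exponential, and A^4
  bounds the gap between 1 - v/2 and exp(-v/2), as the variance v is at most A^2.\<close>

lemma iexp_expectation_approx:
  fixes g :: "'a \<Rightarrow> real"
  assumes "prob_space M" and [measurable]: "g \<in> borel_measurable M"
    and A: "\<And>x. x \<in> space M \<Longrightarrow> \<bar>g x\<bar> \<le> A" and A0: "A \<ge> 0" and mean: "(LINT x|M. g x) = 0"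
  shows "norm ((CLINT x|M. iexp (g x)) - of_real (exp (- (LINT x|M. (g x)\<^sup>2) / 2))) \<le> A ^ 3 + A ^ 4"
proof -
  interpret prob_space M by fact
  define v where "v = (LINT x|M. (g x)\<^sup>2)"
  have A2: "(g x)\<^sup>2 \<le> A\<^sup>2" if "x \<in> space M" for x
    using A[OF that] A0 abs_le_square_iff[of "g x" A] by simp
  have ig: "integrable M g" by (rule integrable_const_bound[where B = A]) (use A in \<open>auto intro: AE_I2\<close>)
  have ig2: "integrable M (\<lambda>x. (g x)\<^sup>2)" by (rule integrable_const_bound[where B = "A\<^sup>2"]) (use A2 in \<open>auto intro: AE_I2\<close>)
  have ie: "integrable M (\<lambda>x. iexp (g x))" by (rule integrable_const_bound[where B = 1]) auto
  have v: "0 \<le> v" "v \<le> A\<^sup>2"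
  proof -
    show "0 \<le> v" unfolding v_def by (intro integral_nonneg_AE AE_I2) auto
    have "v \<le> (LINT x|M. A\<^sup>2)" unfolding v_def by (intro integral_mono' A2) auto
    then show "v \<le> A\<^sup>2" by (simp add: prob_space)
  qed
  have "(CLINT x|M. iexp (g x)) - (1 - of_real v / 2) = (CLINT x|M. iexp (g x) - (1 + \<i> * of_real (g x) - of_real ((g x)\<^sup>2) / 2))"
  proof -
    have "(CLINT x|M. 1 + \<i> * of_real (g x) - of_real ((g x)\<^sup>2) / 2) = 1 + \<i> * of_real (LINT x|M. g x) - of_real v / 2"
      using ig ig2 by (simp add: prob_space v_def del: of_real_power)
    then have "(CLINT x|M. 1 + \<i> * of_real (g x) - of_real ((g x)\<^sup>2) / 2) = 1 - of_real v / 2" using mean by simp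
    then show ?thesis using ig ig2 ie by (subst Bochner_Integration.integral_diff) (auto simp del: of_real_power)
  qed
  also have "norm \<dots> \<le> (LINT x|M. norm (iexp (g x) - (1 + \<i> * of_real (g x) - of_real ((g x)\<^sup>2) / 2)))"
    by (rule integral_norm_bound)
  also have "\<dots> \<le> (LINT x|M. A ^ 3)"
  proof (rule integral_mono')
    fix x assume x: "x \<in> space M"
    have "(\<Sum>k\<le>2. (\<i> * of_real (g x)) ^ k / fact k) = 1 + \<i> * of_real (g x) - of_real ((g x)\<^sup>2) / 2"
      by (simp add: numeral_2_eq_2 power_mult_distrib power2_eq_square)
    then have "norm (iexp (g x) - (1 + \<i> * of_real (g x) - of_real ((g x)\<^sup>2) / 2)) \<le> \<bar>g x\<bar> ^ Suc 2 / fact (Suc 2)"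
      using iexp_approx1[of "g x" 2] by (simp only:)
    also have "\<dots> \<le> \<bar>g x\<bar> ^ Suc 2 / 1" by (intro divide_left_mono fact_ge_1) auto
    also have "\<dots> = \<bar>g x\<bar> ^ 3" by (simp add: numeral_3_eq_3 numeral_2_eq_2)
    also have "\<dots> \<le> A ^ 3" using A[OF x] by (intro power_mono) auto
    finally show "norm (iexp (g x) - (1 + \<i> * of_real (g x) - of_real ((g x)\<^sup>2) / 2)) \<le> A ^ 3" .
  qed (use A0 in auto)
  finally have 1: "norm ((CLINT x|M. iexp (g x)) - (1 - of_real v / 2)) \<le> A ^ 3" by (simp add: prob_space)
  have "\<bar>exp (- v / 2) - (1 - v / 2)\<bar> \<le> A ^ 4"
  proof -
    have "exp (- v / 2) \<ge> 1 - v / 2" using exp_ge_add_one_self[of "- v / 2"] by simp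
    moreover have "exp (- v / 2) \<le> 1 - v / 2 + v\<^sup>2"
    proof -
      \<comment> \<open>Multiplying by 1 + v/2 <= exp(v/2) reduces the upper bound for exp(-v/2) to
        a polynomial inequality.\<close>
      have "(1 - v / 2 + v\<^sup>2) * (1 + v / 2) = 1 + v\<^sup>2 * (3 / 4) + v ^ 3 / 2"
        by (simp add: power2_eq_square power3_eq_cube algebra_simps)
      also have "\<dots> \<ge> 1" using v by simp
      finally have "1 \<le> (1 - v / 2 + v\<^sup>2) * (1 + v / 2)" .
      also have "\<dots> \<le> (1 - v / 2 + v\<^sup>2) * exp (v / 2)"
      proof (intro mult_left_mono exp_ge_add_one_self)
        have "0 \<le> (1 - v / 4)\<^sup>2 + v\<^sup>2 * (15 / 16)" by simp
        then show "0 \<le> 1 - v / 2 + v\<^sup>2" by (simp add: power2_eq_square algebra_simps)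
      qed
      finally show ?thesis by (simp add: exp_minus field_simps)
    qed
    moreover have "v\<^sup>2 \<le> (A\<^sup>2)\<^sup>2" using v by (intro power_mono) auto
    ultimately show ?thesis by simp
  qed
  then have 2: "norm ((1 - of_real v / 2) - complex_of_real (exp (- v / 2))) \<le> A ^ 4"
  proof -
    have "(1 - of_real v / 2) - complex_of_real (exp (- v / 2)) = of_real ((1 - v / 2) - exp (- v / 2))" by simp
    also have "norm \<dots> = \<bar>exp (- v / 2) - (1 - v / 2)\<bar>" by (simp only: norm_of_real abs_minus_commute)
    finally show ?thesis using \<open>\<bar>exp (- v / 2) - (1 - v / 2)\<bar> \<le> A ^ 4\<close> by simp
  qed
  show ?thesis
    unfolding v_def[symmetric] using norm_diff_triangle_le[OF 1 2] .
qed

section \<open>Fourier modes and their covariance\<close>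

text \<open>The flag $s$ is the sign of the frequency in $u$; the flag $c$ selects the cosine, its negation the sine
  (a quarter period shift).\<close>
definition wave :: "nat \<Rightarrow> nat \<times> nat \<times> bool \<times> bool \<Rightarrow> nat \<Rightarrow> real \<Rightarrow> real" where
  "wave n = (\<lambda>(p, q, s, c) b u. cos (2 * pi * ((of_int (int (2 * p + 1)) * (real b / real (2 * n + 1)) - (if c then 0 else 1 / 4))
     + of_int (if s then int (Suc q) else - int (Suc q)) * u)))"

text \<open>Real or imaginary part, according to the last flag, of an exponential sum Z over sqrt n.
  Its variance is (2 n + 1) / (2 n) for large \<open>n\<close>, which tends to 1.\<close>

definition lin_stat :: "nat \<Rightarrow> nat \<times> nat \<times> bool \<times> bool \<Rightarrow> (nat \<Rightarrow> real) \<Rightarrow> real" where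
  "lin_stat n r x = (\<Sum>b=0..2*n. wave n r b (x b)) / sqrt (real n)"

definition modes :: "nat \<Rightarrow> (nat \<times> nat \<times> bool \<times> bool) set" where
  "modes m = {..<m} \<times> {..<m} \<times> UNIV \<times> UNIV"

lemma finite_modes: "finite (modes m)" by (simp add: modes_def)

lemma wave_abs_le: "\<bar>wave n r b u\<bar> \<le> 1"
  by (simp add: wave_def split: prod.splits)

lemma borel_measurable_wave [measurable]: "wave n r b \<in> borel_measurable borel"
  unfolding wave_def by (cases r) simp

lemma wave_mean: "(LINT u|unif. wave n r b u) = 0"
  by (cases r) (simp only: wave_def prod.case integral_unif_cos, simp)

text \<open>Integration over \<open>u\<close> keeps equal or opposite value frequencies, and the sum
  over positions kills every nonzero position frequency. Opposite value frequencies come with the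
  position frequency j + j', which is never 0, so only equal modes remain correlated.\<close>

lemma wave_covariance:
  assumes r: "r \<in> modes m" "r' \<in> modes m" and n: "n \<ge> 2 * m"
  shows "(\<Sum>b=0..2*n. LINT u|unif. wave n r b u * wave n r' b u) = (if r = r' then real (2 * n + 1) / 2 else 0)"
proof -
  obtain p q s c where r1: "r = (p, q, s, c)" "p < m" using r(1) by (auto simp: modes_def)
  obtain p' q' s' c' where r2: "r' = (p', q', s', c')" "p' < m" using r(2) by (auto simp: modes_def)
  define k where "k = (if s then int (Suc q) else - int (Suc q))"
  define k' where "k' = (if s' then int (Suc q') else - int (Suc q'))"
  define f where "f = (if c then 0 else 1 / 4 :: real)"
  define f' where "f' = (if c' then 0 else 1 / 4 :: real)"
  define j where "j = int (2 * p + 1)"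
  define j' where "j' = int (2 * p' + 1)"
  let ?N = "real (2 * n + 1)"
  let ?D = "\<lambda>b u. 2 * pi * ((of_int (j - j') * (real b / ?N) - (f - f')) + of_int (k - k') * u)"
  let ?S = "\<lambda>b u. 2 * pi * ((of_int (j + j') * (real b / ?N) - (f + f')) + of_int (k + k') * u)"
  have i: "integrable unif (\<lambda>v. cos (2 * pi * (\<theta> + of_int m * v)))" for \<theta> m
    by (rule integrable_unif[where B = 1]) auto
  have w: "wave n r b u * wave n r' b u = (cos (?D b u) + cos (?S b u)) / 2" for b u
  proof -
    have "wave n r b u = cos (2 * pi * ((of_int j * (real b / ?N) - f) + of_int k * u))"
      "wave n r' b u = cos (2 * pi * ((of_int j' * (real b / ?N) - f') + of_int k' * u))"
      by (simp_all only: wave_def r1 r2 prod.case j_def j'_def f_def f'_def k_def k'_def)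
    moreover have "?D b u = 2 * pi * ((of_int j * (real b / ?N) - f) + of_int k * u) - 2 * pi * ((of_int j' * (real b / ?N) - f') + of_int k' * u)"
      by (simp add: algebra_simps diff_divide_distrib)
    moreover have "?S b u = 2 * pi * ((of_int j * (real b / ?N) - f) + of_int k * u) + 2 * pi * ((of_int j' * (real b / ?N) - f') + of_int k' * u)"
      by (simp add: algebra_simps add_divide_distrib)
    ultimately show ?thesis by (simp only: cos_times_cos)
  qed
  have L: "(LINT u|unif. wave n r b u * wave n r' b u) =
     ((if k - k' = 0 then cos (2 * pi * (of_int (j - j') * (real b / ?N) - (f - f'))) else 0)
     + (if k + k' = 0 then cos (2 * pi * (of_int (j + j') * (real b / ?N) - (f + f'))) else 0)) / 2" for b
  proof -
    have "(LINT u|unif. wave n r b u * wave n r' b u) = ((LINT u|unif. cos (?D b u)) + (LINT u|unif. cos (?S b u))) / 2"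
      unfolding w using i by (simp del: of_int_add of_int_diff)
    then show ?thesis unfolding integral_unif_cos .
  qed
  have full: "(\<Sum>b=0..2*n. cos (2 * pi * (of_int l * (real b / ?N) - \<theta>))) = 0" if "l \<noteq> 0" "\<bar>l\<bar> < int (2 * n + 1)" for l \<theta>
    using sum_cos_full_period[OF that, of "- \<theta>"] by (simp add: algebra_simps)
  \<comment> \<open>j + j' is at most 4 m - 2, which \<open>n >= 2 * m\<close> keeps below the
    period 2 n + 1, so no aliasing occurs.\<close>
  have jj: "\<bar>j + j'\<bar> < int (2 * n + 1)" "j + j' \<noteq> 0" "\<bar>j - j'\<bar> < int (2 * n + 1)"
    using r1 r2 n by (auto simp: j_def j'_def)
  have "(\<Sum>b=0..2*n. LINT u|unif. wave n r b u * wave n r' b u) =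
     ((if k = k' then (\<Sum>b=0..2*n. cos (2 * pi * (of_int (j - j') * (real b / ?N) - (f - f')))) else 0)
     + (if k + k' = 0 then (\<Sum>b=0..2*n. cos (2 * pi * (of_int (j + j') * (real b / ?N) - (f + f')))) else 0)) / 2"
    unfolding L by (auto simp: sum_divide_distrib[symmetric] sum.distrib simp del: of_int_add of_int_diff)
  also have "\<dots> = (if k = k' then (\<Sum>b=0..2*n. cos (2 * pi * (of_int (j - j') * (real b / ?N) - (f - f')))) else 0) / 2"
    using full[OF jj(2,1)] by simp
  also have "\<dots> = (if r = r' then ?N / 2 else 0)"
  proof (cases "k = k'")
    case k: True
    have qs: "q = q' \<and> s = s'" using k by (auto simp: k_def k'_def split: if_splits)
    show ?thesis
    proof (cases "j = j'")
      case True
      then have p: "p = p'" by (simp add: j_def j'_def)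
      show ?thesis
      proof (cases "c = c'")
        case True
        then show ?thesis using k qs p \<open>j = j'\<close> r1 r2 by (simp add: f_def f'_def)
      next
        case False
        \<comment> \<open>Cosine and sine of the same frequency are a quarter period apart.\<close>
        then have "cos (2 * pi * (0 - (f - f'))) = 0" by (auto simp: f_def f'_def cos_pi_half)
        then show ?thesis using k False \<open>j = j'\<close> r1 r2 by simp
      qed
    next
      case False
      then have "r \<noteq> r'" using r1 r2 by (auto simp: j_def j'_def)
      then show ?thesis using full[of "j - j'" "f - f'"] jj False by simp
    qed
  next
    case False
    have "r \<noteq> r'"
    proof
      assume "r = r'"
      then have "q = q'" "s = s'" using r1 r2 by auto
      then have "k = k'" by (simp only: k_def k'_def)
      then show False using False by simp
    qed
    then show ?thesis using False by simp
  qed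
  finally show ?thesis .
qed

lemma borel_measurable_lin_stat [measurable]: "lin_stat n r \<in> borel_measurable (sample n)"
  unfolding lin_stat_def[abs_def]
  by (intro borel_measurable_divide borel_measurable_sum measurable_compose[OF measurable_sample_component borel_measurable_wave]) auto

text \<open>Distinct positions are independent and centered, which leaves 2 n + 1 diagonal terms of
  size at most 1. The constant 3 bounds (2 n + 1) / n for \<open>n >= 1\<close>; at
  \<open>n = 0\<close> the quotient is 0. Uniformity in \<open>n\<close> is what the damping
  argument needs.\<close>

lemma lin_stat_second_moment:
  shows "integrable (sample n) (\<lambda>x. (lin_stat n r x)\<^sup>2)" and "(LINT x|sample n. (lin_stat n r x)\<^sup>2) \<le> 3"
proof -
  let ?w = "\<lambda>b x. wave n r b (x b)"
  have wm [measurable]: "?w b \<in> borel_measurable (sample n)" if "b \<le> 2 * n" for b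
    by (rule measurable_compose[OF measurable_sample_component[OF that] borel_measurable_wave])
  have i: "integrable (sample n) (\<lambda>x. ?w b x * ?w b' x)" if "b \<le> 2 * n" "b' \<le> 2 * n" for b b'
    by (rule sample.integrable_const_bound[where B = 1])
       (use that in \<open>auto simp: abs_mult intro!: AE_I2 mult_le_one wave_abs_le\<close>)
  have sq: "(lin_stat n r x)\<^sup>2 = (\<Sum>b=0..2*n. \<Sum>b'=0..2*n. ?w b x * ?w b' x) / real n" for x
    unfolding lin_stat_def power_divide by (simp add: power2_eq_square sum_product)
  show "integrable (sample n) (\<lambda>x. (lin_stat n r x)\<^sup>2)"
    unfolding sq by (intro integrable_divide Bochner_Integration.integrable_sum i) auto
  have "(LINT x|sample n. (lin_stat n r x)\<^sup>2) = (\<Sum>b=0..2*n. \<Sum>b'=0..2*n. LINT x|sample n. ?w b x * ?w b' x) / real n"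
  proof -
    have "(LINT x|sample n. (\<Sum>b=0..2*n. \<Sum>b'=0..2*n. ?w b x * ?w b' x)) = (\<Sum>b=0..2*n. LINT x|sample n. (\<Sum>b'=0..2*n. ?w b x * ?w b' x))"
      by (rule Bochner_Integration.integral_sum) (auto intro!: Bochner_Integration.integrable_sum i)
    also have "\<dots> = (\<Sum>b=0..2*n. \<Sum>b'=0..2*n. LINT x|sample n. ?w b x * ?w b' x)"
      by (intro sum.cong refl Bochner_Integration.integral_sum i) auto
    finally show ?thesis unfolding sq by simp
  qed
  also have "\<dots> \<le> (\<Sum>b=0..2*n. \<Sum>b'=0..2*n. if b = b' then 1 else 0) / real n"
  proof (intro divide_right_mono sum_mono)
    fix b b' assume b: "b \<in> {0..2*n}" "b' \<in> {0..2*n}"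
    show "(LINT x|sample n. ?w b x * ?w b' x) \<le> (if b = b' then 1 else 0)"
    proof (cases "b = b'")
      case True
      have "(LINT x|sample n. ?w b x * ?w b' x) \<le> (LINT x|sample n. 1)"
      proof (rule integral_mono')
        show "?w b x * ?w b' x \<le> 1" for x
          using mult_le_one[OF wave_abs_le[of n r b "x b"] abs_ge_zero wave_abs_le[of n r b' "x b'"]]
          by (simp add: abs_mult[symmetric])
      qed auto
      then show ?thesis using True by (simp add: sample.prob_space)
    next
      case False
      have "(LINT x|sample n. ?w b x * ?w b' x) = (LINT x|sample n. LINT u|unif. wave n r b ((x(b := u)) b) * wave n r b' ((x(b := u)) b'))"
        by (rule sample_resample[where B = 1])
           (use b in \<open>auto simp: abs_mult intro!: mult_le_one wave_abs_le borel_measurable_times wm\<close>)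
      also have "\<dots> = 0" using False by (simp add: wave_mean)
      finally show ?thesis using False by simp
    qed
  qed simp
  also have "\<dots> = real (2 * n + 1) / real n" by simp
  also have "\<dots> \<le> 3" by (cases n) (auto simp: field_simps)
  finally show "(LINT x|sample n. (lin_stat n r x)\<^sup>2) \<le> 3" .
qed

text \<open>For each \<open>n\<close> the linear form is a sum of independent centered terms bounded
  by A / sqrt n. Its characteristic function factorizes over the positions, and comparing the
  factors with Gaussian ones costs at most the sum of the individual errors.\<close>

lemma lin_stat_char_bound:
  fixes y :: "nat \<times> nat \<times> bool \<times> bool \<Rightarrow> real"
  assumes n: "n \<ge> 2 * m" "n > 0"
  defines "A \<equiv> \<Sum>r\<in>modes m. \<bar>y r\<bar>"
  shows "norm ((CLINT x|sample n. iexp (\<Sum>r\<in>modes m. y r * lin_stat n r x)) -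
      of_real (exp (- (real (2 * n + 1) / (2 * real n) * (\<Sum>r\<in>modes m. (y r)\<^sup>2)) / 2)))
    \<le> real (2 * n + 1) * ((A / sqrt (real n)) ^ 3 + (A / sqrt (real n)) ^ 4)"
proof -
  define g where "g b u = (\<Sum>r\<in>modes m. y r * wave n r b u) / sqrt (real n)" for b u
  define v where "v b = (LINT u|unif. (g b u)\<^sup>2)" for b
  define \<psi> where "\<psi> b = (CLINT u|unif. iexp (g b u))" for b
  have A0: "A \<ge> 0" by (simp add: A_def sum_nonneg)
  have gm [measurable]: "g b \<in> borel_measurable borel" for b unfolding g_def by measurable
  have gmu: "g b \<in> borel_measurable unif" for b by (rule borel_measurable_unif) measurable
  have gA: "\<bar>g b u\<bar> \<le> A / sqrt (real n)" for b u
  proof -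
    have "\<bar>\<Sum>r\<in>modes m. y r * wave n r b u\<bar> \<le> (\<Sum>r\<in>modes m. \<bar>y r * wave n r b u\<bar>)" by (rule sum_abs)
    also have "\<dots> \<le> A" unfolding A_def abs_mult by (intro sum_mono mult_left_le wave_abs_le) auto
    finally show ?thesis unfolding g_def by (simp add: abs_divide divide_right_mono)
  qed
  have wi: "integrable unif (\<lambda>u. c * wave n r b u)" for r b c
    by (rule integrable_unif[where B = "\<bar>c\<bar> * 1"]) (auto simp: abs_mult intro!: mult_left_le wave_abs_le)
  have wwi: "integrable unif (\<lambda>u. c * (wave n r b u * wave n r' b u))" for r r' b c
    by (rule integrable_unif[where B = "\<bar>c\<bar> * (1 * 1)"]) (unfold abs_mult, measurable, intro mult_left_mono mult_mono wave_abs_le, auto)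
  have g0: "(LINT u|unif. g b u) = 0" for b
    unfolding g_def by (simp add: Bochner_Integration.integral_sum[OF wi] wave_mean)
  have sv: "(\<Sum>b=0..2*n. v b) = real (2 * n + 1) / (2 * real n) * (\<Sum>r\<in>modes m. (y r)\<^sup>2)"
  proof -
    have v: "v b = (\<Sum>r\<in>modes m. \<Sum>r'\<in>modes m. y r * y r' * (LINT u|unif. wave n r b u * wave n r' b u)) / real n" for b
    proof -
      have "(g b u)\<^sup>2 = (\<Sum>r\<in>modes m. \<Sum>r'\<in>modes m. y r * y r' * (wave n r b u * wave n r' b u)) / real n" for u
        unfolding g_def power_divide by (simp add: power2_eq_square sum_product mult_ac)
      then have "v b = (LINT u|unif. (\<Sum>r\<in>modes m. \<Sum>r'\<in>modes m. y r * y r' * (wave n r b u * wave n r' b u))) / real n"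
        unfolding v_def by simp
      also have "(LINT u|unif. (\<Sum>r\<in>modes m. \<Sum>r'\<in>modes m. y r * y r' * (wave n r b u * wave n r' b u)))
        = (\<Sum>r\<in>modes m. \<Sum>r'\<in>modes m. y r * y r' * (LINT u|unif. wave n r b u * wave n r' b u))"
        by (simp only: Bochner_Integration.integral_sum[OF Bochner_Integration.integrable_sum[OF wwi]] Bochner_Integration.integral_sum[OF wwi] integral_mult_right_zero)
      finally show ?thesis .
    qed
    have "(\<Sum>b=0..2*n. v b) = (\<Sum>r\<in>modes m. \<Sum>r'\<in>modes m. \<Sum>b=0..2*n. y r * y r' * (LINT u|unif. wave n r b u * wave n r' b u)) / real n"
      unfolding v sum_divide_distrib[symmetric]
      by (intro arg_cong[where f = "\<lambda>x. x / real n"]) (rule trans[OF sum.swap], rule sum.cong[OF refl], rule sum.swap)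
    also have "\<dots> = (\<Sum>r\<in>modes m. \<Sum>r'\<in>modes m. y r * y r' * (if r = r' then real (2 * n + 1) / 2 else 0)) / real n"
      unfolding sum_distrib_left[symmetric] using wave_covariance[OF _ _ n(1)] by (intro arg_cong[where f = "\<lambda>x. x / real n"] sum.cong refl) simp
    also have "\<dots> = real (2 * n + 1) / (2 * real n) * (\<Sum>r\<in>modes m. (y r)\<^sup>2)"
      by (simp add: finite_modes if_distrib power2_eq_square sum_distrib_left sum_distrib_right sum_divide_distrib mult_ac cong: if_cong)
    finally show ?thesis .
  qed
  have "(\<Sum>r\<in>modes m. y r * lin_stat n r x) = (\<Sum>b=0..2*n. g b (x b))" for x
    unfolding lin_stat_def g_def times_divide_eq_right sum_divide_distrib[symmetric] sum_distrib_left
    by (intro arg_cong[where f = "\<lambda>x. x / sqrt (real n)"] sum.swap)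
  then have "(CLINT x|sample n. iexp (\<Sum>r\<in>modes m. y r * lin_stat n r x)) = (CLINT x|sample n. (\<Prod>b\<in>{0..2*n}. iexp (g b (x b))))"
    by (simp add: sum_distrib_left exp_sum)
  also have "\<dots> = (\<Prod>b\<in>{0..2*n}. \<psi> b)"
    unfolding sample_def \<psi>_def
    by (rule unif_product.product_integral_prod) (auto intro!: unif.integrable_const_bound[where B = 1] gmu measurable_compose[OF gmu])
  finally have E: "(CLINT x|sample n. iexp (\<Sum>r\<in>modes m. y r * lin_stat n r x)) = (\<Prod>b\<in>{0..2*n}. \<psi> b)" .
  have \<psi>1: "norm (\<psi> b) \<le> 1" for b
  proof -
    have "norm (\<psi> b) \<le> (LINT u|unif. norm (iexp (g b u)))" unfolding \<psi>_def by (rule integral_norm_bound)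
    then show ?thesis by (simp add: unif.prob_space)
  qed
  have v0: "v b \<ge> 0" for b unfolding v_def by (intro integral_nonneg_AE AE_I2) auto
  have "norm ((\<Prod>b\<in>{0..2*n}. \<psi> b) - (\<Prod>b\<in>{0..2*n}. complex_of_real (exp (- v b / 2)))) \<le>
      (\<Sum>b\<in>{0..2*n}. norm (\<psi> b - complex_of_real (exp (- v b / 2))))"
    by (rule norm_prod_diff) (use \<psi>1 v0 in auto)
  also have "\<dots> \<le> (\<Sum>b\<in>{0..2*n}. (A / sqrt (real n)) ^ 3 + (A / sqrt (real n)) ^ 4)"
    unfolding \<psi>_def v_def
    by (intro sum_mono iexp_expectation_approx[OF prob_space_unif gmu gA]) (use A0 g0 in auto)
  also have "\<dots> = real (2 * n + 1) * ((A / sqrt (real n)) ^ 3 + (A / sqrt (real n)) ^ 4)" by simp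
  also have "(\<Prod>b\<in>{0..2*n}. complex_of_real (exp (- v b / 2))) = of_real (exp (- (\<Sum>b=0..2*n. v b) / 2))"
    by (simp add: exp_sum[symmetric] sum_negf sum_divide_distrib flip: of_real_prod)
  finally show ?thesis unfolding E sv .
qed

lemma lin_stat_clt:
  "(\<lambda>n. CLINT x|sample n. iexp (\<Sum>r\<in>modes m. y r * lin_stat n r x)) \<longlonglongrightarrow> of_real (exp (- (\<Sum>r\<in>modes m. (y r)\<^sup>2) / 2))"
proof -
  define A where "A = (\<Sum>r\<in>modes m. \<bar>y r\<bar>)"
  define Y where "Y = (\<Sum>r\<in>modes m. (y r)\<^sup>2)"
  let ?E = "\<lambda>n. CLINT x|sample n. iexp (\<Sum>r\<in>modes m. y r * lin_stat n r x)"
  let ?G = "\<lambda>n. complex_of_real (exp (- (real (2 * n + 1) / (2 * real n) * Y) / 2))"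
  have "(\<lambda>n. real (2 * n + 1) * (1 / sqrt (real n)) ^ 3) \<longlonglongrightarrow> 0" "(\<lambda>n. real (2 * n + 1) * (1 / sqrt (real n)) ^ 4) \<longlonglongrightarrow> 0"
    by real_asymp+
  then have "(\<lambda>n. A ^ 3 * (real (2 * n + 1) * (1 / sqrt (real n)) ^ 3) + A ^ 4 * (real (2 * n + 1) * (1 / sqrt (real n)) ^ 4)) \<longlonglongrightarrow> A ^ 3 * 0 + A ^ 4 * 0"
    by (intro tendsto_intros)
  then have b: "(\<lambda>n. real (2 * n + 1) * ((A / sqrt (real n)) ^ 3 + (A / sqrt (real n)) ^ 4)) \<longlonglongrightarrow> 0"
    by (simp add: power_divide algebra_simps)
  have "\<forall>\<^sub>F n in sequentially. norm (?E n - ?G n) \<le> real (2 * n + 1) * ((A / sqrt (real n)) ^ 3 + (A / sqrt (real n)) ^ 4)"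
    using eventually_ge_at_top[of "2 * m"] eventually_gt_at_top[of 0]
  proof eventually_elim
    case (elim n)
    show ?case unfolding A_def Y_def by (rule lin_stat_char_bound[OF elim])
  qed
  then have 1: "(\<lambda>n. ?E n - ?G n) \<longlonglongrightarrow> 0" by (rule Lim_null_comparison[OF _ b])
  have "(\<lambda>n. real (2 * n + 1) / (2 * real n)) \<longlonglongrightarrow> 1" by real_asymp
  then have "(\<lambda>n. exp (- (real (2 * n + 1) / (2 * real n) * Y) / 2)) \<longlonglongrightarrow> exp (- (1 * Y) / 2)"
    by (intro tendsto_intros) auto
  then have "?G \<longlonglongrightarrow> of_real (exp (- Y / 2))" by (intro tendsto_of_real) simp
  from tendsto_add[OF 1 this] show ?thesis by (simp add: Y_def)
qed

text \<open>The sign comes from sin a sin b = (cos(a - b) - cos(a + b)) / 2: modes with positive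
  value frequency belong to the second cosine. In absolute value this is
  \<open>writhe_scale (p, q)\<close>.\<close>

definition mode_coeff :: "nat \<times> nat \<times> bool \<times> bool \<Rightarrow> real" where
  "mode_coeff = (\<lambda>(p, q, s, c). (if s then - 1 else 1) * (4 / pi\<^sup>2 * (1 / (2 * real p + 1)) * (1 / (real q + 1))))"

text \<open>Cosine and sine modes share a coefficient, so every \<open>chi_mgf\<close> occurs
  squared and becomes rational. The two opposite signs then combine into (1 + \<epsilon>)^2 - z^2
  with imaginary z.\<close>

lemma chi_mgf_product:
  assumes "\<epsilon> > 0"
  shows "(\<Prod>r\<in>modes m. chi_mgf (of_real \<epsilon> - \<i> * of_real (t * mode_coeff r))) =
    (\<Prod>q\<in>{..<m}\<times>{..<m}. 1 / ((1 + of_real \<epsilon>)\<^sup>2 + of_real ((mode_coeff (fst q, snd q, False, False) * t)\<^sup>2)))"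
proof -
  let ?a = "\<lambda>q. mode_coeff (fst q, snd q, False, False)"
  have bij: "(\<Prod>r\<in>modes m. f r) = (\<Prod>q\<in>{..<m}\<times>{..<m}. \<Prod>s\<in>UNIV. \<Prod>c\<in>UNIV. f (fst q, snd q, s, c))" for f :: "_ \<Rightarrow> complex"
    unfolding prod.cartesian_product
    by (rule prod.reindex_bij_witness[of _ "\<lambda>((p, q), s, c). (p, q, s, c)" "\<lambda>(p, q, s, c). ((p, q), s, c)"])
       (auto simp: modes_def)
  have "(\<Prod>s\<in>UNIV. \<Prod>c\<in>UNIV. chi_mgf (of_real \<epsilon> - \<i> * of_real (t * mode_coeff (fst q, snd q, s, c))))
     = 1 / ((1 + of_real \<epsilon>)\<^sup>2 + of_real ((?a q * t)\<^sup>2))" for q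
  proof -
    define z where "z = \<i> * of_real (t * ?a q)"
    have "chi_mgf (of_real \<epsilon> - z) * chi_mgf (of_real \<epsilon> - z) = 1 / (1 + (of_real \<epsilon> - z))"
      "chi_mgf (of_real \<epsilon> + z) * chi_mgf (of_real \<epsilon> + z) = 1 / (1 + (of_real \<epsilon> + z))"
      using chi_mgf_power2[of "of_real \<epsilon> - z"] chi_mgf_power2[of "of_real \<epsilon> + z"] assms
      by (simp_all add: power2_eq_square z_def)
    moreover have "(\<Prod>s\<in>UNIV. \<Prod>c\<in>UNIV. chi_mgf (of_real \<epsilon> - \<i> * of_real (t * mode_coeff (fst q, snd q, s, c))))
      = (chi_mgf (of_real \<epsilon> + z) * chi_mgf (of_real \<epsilon> + z)) * (chi_mgf (of_real \<epsilon> - z) * chi_mgf (of_real \<epsilon> - z))"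
      by (simp add: UNIV_bool mode_coeff_def z_def mult_ac)
    ultimately have "(\<Prod>s\<in>UNIV. \<Prod>c\<in>UNIV. chi_mgf (of_real \<epsilon> - \<i> * of_real (t * mode_coeff (fst q, snd q, s, c))))
      = 1 / ((1 + (of_real \<epsilon> + z)) * (1 + (of_real \<epsilon> - z)))" by simp
    also have "(1 + (of_real \<epsilon> + z)) * (1 + (of_real \<epsilon> - z)) = (1 + of_real \<epsilon>)\<^sup>2 - z\<^sup>2"
      by (simp add: power2_eq_square algebra_simps)
    also have "z\<^sup>2 = - of_real ((?a q * t)\<^sup>2)" by (simp add: z_def power_mult_distrib mult_ac)
    finally show ?thesis by simp
  qed
  then show ?thesis unfolding bij by simp
qed

lemma quadratic_stat_limit:
  "(\<lambda>n. CLINT x|sample n. iexp (\<Sum>r\<in>modes m. (t * mode_coeff r) * ((lin_stat n r x)\<^sup>2 / 2))) \<longlonglongrightarrow>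
    of_real (\<Prod>q\<in>{..<m}\<times>{..<m}. 1 / (1 + (mode_coeff (fst q, snd q, False, False) * t)\<^sup>2))"
proof (rule quadratic_char_limit[where K = 3])
  let ?f = "\<lambda>\<epsilon>. \<Prod>q\<in>{..<m}\<times>{..<m}. 1 / ((1 + complex_of_real \<epsilon>)\<^sup>2 + of_real ((mode_coeff (fst q, snd q, False, False) * t)\<^sup>2))"
  have nz: "(1 + complex_of_real 0)\<^sup>2 + of_real (x\<^sup>2) \<noteq> 0" for x
  proof -
    have "1 + x\<^sup>2 \<noteq> 0" by (simp add: add_nonneg_eq_0_iff)
    then have "complex_of_real (1 + x\<^sup>2) \<noteq> 0" by (simp only: of_real_eq_0_iff not_False_eq_True)
    then show ?thesis by simp
  qed
  have "(?f \<longlongrightarrow> ?f 0) (at_right 0)"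
    by (intro tendsto_prod tendsto_divide tendsto_const tendsto_add tendsto_power tendsto_of_real tendsto_ident_at nz)
  moreover have "\<forall>\<^sub>F \<epsilon> in at_right 0. ?f \<epsilon> = (\<Prod>r\<in>modes m. chi_mgf (of_real \<epsilon> - \<i> * of_real (t * mode_coeff r)))"
    using eventually_at_right_less[of "0::real"] by eventually_elim (rule chi_mgf_product[symmetric])
  ultimately have "((\<lambda>\<epsilon>. \<Prod>r\<in>modes m. chi_mgf (of_real \<epsilon> - \<i> * of_real (t * mode_coeff r))) \<longlongrightarrow> ?f 0) (at_right 0)"
    by (rule Lim_transform_eventually)
  then show "((\<lambda>\<epsilon>. \<Prod>r\<in>modes m. chi_mgf (of_real \<epsilon> - \<i> * of_real (t * mode_coeff r))) \<longlongrightarrow>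
     of_real (\<Prod>q\<in>{..<m}\<times>{..<m}. 1 / (1 + (mode_coeff (fst q, snd q, False, False) * t)\<^sup>2))) (at_right 0)"
    by (simp add: power_mult_distrib)
qed (rule prob_space_sample finite_modes borel_measurable_lin_stat lin_stat_clt lin_stat_second_moment)+

section \<open>Convergence of the writhe\<close>

text \<open>The full square of index pairs splits into the cyclic pairs, their mirror images and the
  diagonal. Over the full square the double sums factorize into squares of single sums.\<close>

lemma sum_all_pairs:
  fixes F :: "nat \<Rightarrow> nat \<Rightarrow> real"
  assumes sym: "\<And>i j. F i j = F j i" and diag: "\<And>i. F i i = 0"
  shows "(\<Sum>i=0..2*n. \<Sum>j=0..2*n. F i j) = 2 * (\<Sum>(i, j)\<in>cyclic_pairs n. F i j)"
proof -
  let ?I = "{0..2*n}"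
  let ?J = "cyclic_pairs n"
  let ?f = "\<lambda>(i, j). F i j"
  have cover: "?I \<times> ?I = (?J \<union> prod.swap ` ?J) \<union> (\<lambda>i. (i, i)) ` ?I"
  proof (intro equalityI subsetI)
    fix r assume "r \<in> ?I \<times> ?I"
    then obtain i j where r: "r = (i, j)" "i \<le> 2 * n" "j \<le> 2 * n" by auto
    have J: "(i, j) \<in> ?J" if "i \<le> 2 * n" "1 \<le> s" "s \<le> n" "(if i + s \<le> 2 * n then i + s else i + s - (2 * n + 1)) = j" for i j s
    proof -
      have "(i, j) = (\<lambda>(i, j). (i, (i + j) mod (2 * n + 1))) (i, s)"
        using cyclic_step_mod[OF that(1,2,3)] that(4) by (simp only: prod.case)
      then show ?thesis unfolding cyclic_pairs_def using that by (intro image_eqI[of _ _ "(i, s)"]) auto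
    qed
    \<comment> \<open>A gap of at most n is a cyclic step itself; a larger gap is traversed the
      other way round, by 2 n + 1 minus the gap.\<close>
    consider "i = j" | "i < j" "j - i \<le> n" | "i < j" "j - i > n" | "j < i" "i - j \<le> n" | "j < i" "i - j > n" by linarith
    then have "i = j \<or> (i, j) \<in> ?J \<or> (j, i) \<in> ?J"
    proof cases
      case 1 then show ?thesis by simp
    next
      case 2 then show ?thesis using J[of i "j - i" j] r by simp
    next
      case 3 then show ?thesis using J[of j "2 * n + 1 - (j - i)" i] r by simp
    next
      case 4 then show ?thesis using J[of j "i - j" i] r by simp
    next
      case 5 then show ?thesis using J[of i "2 * n + 1 - (i - j)" j] r by simp
    qed
    then show "r \<in> (?J \<union> prod.swap ` ?J) \<union> (\<lambda>i. (i, i)) ` ?I"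
      using r by (force simp: image_iff)
  qed (auto dest: cyclic_pairs_le)
  have disj: "?J \<inter> prod.swap ` ?J = {}"
  proof (rule ccontr)
    assume "?J \<inter> prod.swap ` ?J \<noteq> {}"
    then obtain i j where "(i, j) \<in> ?J" "(j, i) \<in> ?J" by auto
    then show False using cyclic_pairs_distinct[of i j n j i] cyclic_pairs_le[of i j n] by auto
  qed
  have "(\<Sum>i=0..2*n. \<Sum>j=0..2*n. F i j) = (\<Sum>r\<in>?I \<times> ?I. ?f r)" by (simp add: sum.cartesian_product)
  also have "\<dots> = (\<Sum>r\<in>?J \<union> prod.swap ` ?J. ?f r) + (\<Sum>r\<in>(\<lambda>i. (i, i)) ` ?I. ?f r)"
    unfolding cover by (rule sum.union_disjoint) (auto simp: finite_cyclic_pairs dest: cyclic_pairs_le)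
  also have "(\<Sum>r\<in>(\<lambda>i. (i, i)) ` ?I. ?f r) = 0" by (rule sum.neutral) (auto simp: diag)
  also have "(\<Sum>r\<in>?J \<union> prod.swap ` ?J. ?f r) = (\<Sum>r\<in>?J. ?f r) + (\<Sum>r\<in>prod.swap ` ?J. ?f r)"
    by (rule sum.union_disjoint) (use disj in \<open>auto simp: finite_cyclic_pairs\<close>)
  also have "(\<Sum>r\<in>prod.swap ` ?J. ?f r) = (\<Sum>r\<in>?J. ?f r)"
    by (subst sum.reindex) (auto simp: inj_on_def sym comp_def case_prod_unfold intro!: sum.cong)
  finally show ?thesis by simp
qed

text \<open>Both sides are the squared modulus of the sum of exp(i \<alpha>) over
  \<open>I\<close>.\<close>

lemma sum_cos_differences:
  fixes \<alpha> :: "'a \<Rightarrow> real"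
  shows "(\<Sum>i\<in>I. \<Sum>b\<in>I. cos (\<alpha> b - \<alpha> i)) = (\<Sum>b\<in>I. cos (\<alpha> b))\<^sup>2 + (\<Sum>b\<in>I. sin (\<alpha> b))\<^sup>2"
  unfolding power2_eq_square sum_product sum.distrib[symmetric] cos_diff by (intro sum.cong refl) simp

text \<open>The Fourier coefficients multiply to 8 / (pi^2 j k). One half is lost to the product of
  sines and another to counting every pair twice; the remaining 2 / (pi^2 j k) is 4 / (pi^2 j k)
  times the 1/2 that accompanies each squared mode.\<close>

lemma trunc_writhe_decomposition:
  assumes n: "n > 0"
  shows "trunc_writhe m n x / real n = (\<Sum>r\<in>modes m. mode_coeff r * ((lin_stat n r x)\<^sup>2 / 2))"
proof -
  let ?I = "{0..2*n}" and ?N = "real (2 * n + 1)"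
  let ?j = "\<lambda>p. real (2 * p + 1)" and ?k = "\<lambda>q. real (Suc q)"
  define V where "V r = (\<Sum>b=0..2*n. wave n r b (x b))" for r
  define F where "F i b = square_wave m n (real b - real i) * sawtooth_trunc m (x b - x i)" for i b
  have F: "(\<Sum>i\<in>?I. \<Sum>b\<in>?I. F i b) = 2 * trunc_writhe m n x"
    unfolding trunc_writhe_def F_def[symmetric]
  proof (rule sum_all_pairs)
    show "F i j = F j i" for i j
      unfolding F_def using square_wave_minus[of m n "real j - real i"] sawtooth_trunc_minus[of m "x j - x i"] by simp
    show "F i i = 0" for i by (simp add: F_def square_wave_def)
  qed
  have inner: "(\<Sum>i\<in>?I. \<Sum>b\<in>?I. sin (2 * pi * ?j p * ((real b - real i) / ?N)) * sin (2 * pi * ?k q * (x b - x i))) =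
     ((V (p, q, False, True))\<^sup>2 + (V (p, q, False, False))\<^sup>2 - (V (p, q, True, True))\<^sup>2 - (V (p, q, True, False))\<^sup>2) / 2" for p q
  proof -
    define \<alpha> where "\<alpha> b = 2 * pi * (?j p * (real b / ?N) - ?k q * x b)" for b
    define \<beta> where "\<beta> b = 2 * pi * (?j p * (real b / ?N) + ?k q * x b)" for b
    have s: "sin (2 * pi * ?j p * ((real b - real i) / ?N)) * sin (2 * pi * ?k q * (x b - x i)) = (cos (\<alpha> b - \<alpha> i) - cos (\<beta> b - \<beta> i)) / 2" for i b
    proof -
      have "2 * pi * ?j p * ((real b - real i) / ?N) - 2 * pi * ?k q * (x b - x i) = \<alpha> b - \<alpha> i"
        "2 * pi * ?j p * ((real b - real i) / ?N) + 2 * pi * ?k q * (x b - x i) = \<beta> b - \<beta> i"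
        unfolding \<alpha>_def \<beta>_def diff_divide_distrib by (simp_all only: algebra_simps)
      then show ?thesis by (simp only: sin_times_sin)
    qed
    have w: "wave n (p, q, False, True) b u = cos (2 * pi * (?j p * (real b / ?N) - ?k q * u))"
      "wave n (p, q, True, True) b u = cos (2 * pi * (?j p * (real b / ?N) + ?k q * u))" for b u
      by (simp_all add: wave_def algebra_simps)
    have cs: "cos (2 * pi * (y - 1 / 4)) = sin (2 * pi * y)" for y
    proof -
      have "2 * pi * (y - 1 / 4) = - (pi / 2 - 2 * pi * y)" by (simp add: algebra_simps)
      then show ?thesis by (simp only: cos_minus sin_cos_eq of_real_eq_id id_apply)
    qed
    have w': "wave n (p, q, False, False) b u = sin (2 * pi * (?j p * (real b / ?N) - ?k q * u))"
      "wave n (p, q, True, False) b u = sin (2 * pi * (?j p * (real b / ?N) + ?k q * u))" for b u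
      unfolding cs[symmetric] by (simp_all add: wave_def algebra_simps)
    have V: "V (p, q, False, True) = (\<Sum>b\<in>?I. cos (\<alpha> b))" "V (p, q, False, False) = (\<Sum>b\<in>?I. sin (\<alpha> b))"
      "V (p, q, True, True) = (\<Sum>b\<in>?I. cos (\<beta> b))" "V (p, q, True, False) = (\<Sum>b\<in>?I. sin (\<beta> b))"
      by (simp_all only: V_def w w' \<alpha>_def \<beta>_def)
    show ?thesis
      unfolding s sum_divide_distrib[symmetric] sum_subtractf sum_cos_differences V by simp
  qed
  have "(\<Sum>i\<in>?I. \<Sum>b\<in>?I. F i b) = (\<Sum>i\<in>?I. \<Sum>b\<in>?I. \<Sum>p<m. \<Sum>q<m. (4 / (pi * ?j p)) * (2 / (pi * ?k q)) *
      (sin (2 * pi * ?j p * ((real b - real i) / ?N)) * sin (2 * pi * ?k q * (x b - x i))))"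
    unfolding F_def square_wave_def sawtooth_trunc_def sum_product by (simp only: mult_ac)
  also have "\<dots> = (\<Sum>p<m. \<Sum>q<m. \<Sum>i\<in>?I. \<Sum>b\<in>?I. (4 / (pi * ?j p)) * (2 / (pi * ?k q)) *
      (sin (2 * pi * ?j p * ((real b - real i) / ?N)) * sin (2 * pi * ?k q * (x b - x i))))"
    (is "(\<Sum>i\<in>?I. \<Sum>b\<in>?I. \<Sum>p<m. \<Sum>q<m. ?t i b p q) = _")
  proof -
    have "(\<Sum>i\<in>?I. \<Sum>b\<in>?I. \<Sum>p<m. \<Sum>q<m. ?t i b p q) = (\<Sum>i\<in>?I. \<Sum>p<m. \<Sum>q<m. \<Sum>b\<in>?I. ?t i b p q)"
      by (rule sum.cong[OF refl], rule trans[OF sum.swap], rule sum.cong[OF refl], rule sum.swap)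
    also have "\<dots> = (\<Sum>p<m. \<Sum>q<m. \<Sum>i\<in>?I. \<Sum>b\<in>?I. ?t i b p q)"
      by (rule trans[OF sum.swap], rule sum.cong[OF refl], rule sum.swap)
    finally show ?thesis .
  qed
  also have "\<dots> = (\<Sum>p<m. \<Sum>q<m. (4 / (pi * ?j p)) * (2 / (pi * ?k q)) *
     (((V (p, q, False, True))\<^sup>2 + (V (p, q, False, False))\<^sup>2 - (V (p, q, True, True))\<^sup>2 - (V (p, q, True, False))\<^sup>2) / 2))"
    unfolding sum_distrib_left[symmetric] inner ..
  finally have T: "2 * trunc_writhe m n x = (\<Sum>p<m. \<Sum>q<m. (4 / (pi * ?j p)) * (2 / (pi * ?k q)) *
     (((V (p, q, False, True))\<^sup>2 + (V (p, q, False, False))\<^sup>2 - (V (p, q, True, True))\<^sup>2 - (V (p, q, True, False))\<^sup>2) / 2))"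
    unfolding F .
  have "(\<Sum>r\<in>modes m. mode_coeff r * ((lin_stat n r x)\<^sup>2 / 2)) =
     (\<Sum>p<m. \<Sum>q<m. \<Sum>s\<in>UNIV. \<Sum>c\<in>UNIV. mode_coeff (p, q, s, c) * ((lin_stat n (p, q, s, c) x)\<^sup>2 / 2))"
    unfolding sum.cartesian_product modes_def by (rule sum.cong) (auto simp: split_def)
  also have "\<dots> = (\<Sum>p<m. \<Sum>q<m. ((4 / (pi * ?j p)) * (2 / (pi * ?k q)) *
     (((V (p, q, False, True))\<^sup>2 + (V (p, q, False, False))\<^sup>2 - (V (p, q, True, True))\<^sup>2 - (V (p, q, True, False))\<^sup>2) / 2)) / (2 * real n))"
  proof (intro sum.cong refl)
    fix p q
    have l: "(lin_stat n r x)\<^sup>2 = (V r)\<^sup>2 / real n" for r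
      by (simp add: lin_stat_def V_def power_divide)
    define c where "c = 4 / pi\<^sup>2 * (1 / (2 * real p + 1)) * (1 / (real q + 1))"
    have c: "(4 / (pi * ?j p)) * (2 / (pi * ?k q)) = 2 * c"
      by (simp add: c_def power2_eq_square add.commute)
    show "(\<Sum>s\<in>UNIV. \<Sum>c\<in>UNIV. mode_coeff (p, q, s, c) * ((lin_stat n (p, q, s, c) x)\<^sup>2 / 2)) =
      ((4 / (pi * ?j p)) * (2 / (pi * ?k q)) *
     (((V (p, q, False, True))\<^sup>2 + (V (p, q, False, False))\<^sup>2 - (V (p, q, True, True))\<^sup>2 - (V (p, q, True, False))\<^sup>2) / 2)) / (2 * real n)"
      unfolding c UNIV_bool mode_coeff_def l prod.case c_def[symmetric] using n by (simp add: field_simps)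
  qed
  also have "\<dots> = 2 * trunc_writhe m n x / (2 * real n)"
    unfolding T sum_divide_distrib ..
  finally show ?thesis by simp
qed

text \<open>The sums of 1/j^2 over odd j and of 1/k^2 over all k are pi^2/8 and pi^2/6, so the
  energies tend to 1 and 1/3.\<close>

lemma truncation_energy_tendsto:
  "(\<lambda>m. 2 * (1 / 3 - wave_energy m * sawtooth_energy m)) \<longlonglongrightarrow> 0"
proof -
  have "even_zeta 1 = pi\<^sup>2 / 6"
    by (rule sums_unique2[OF _ sums_inverse_Suc_square]) (use even_zeta_sums[of 1] in simp)
  then have "(1 - (1 / 2) ^ (2 * 1)) * even_zeta 1 = pi\<^sup>2 / 8" by (simp only:) (simp add: power2_eq_square)
  then have "(\<lambda>m. \<Sum>p<m. (1 / (2 * real p + 1))\<^sup>2) \<longlonglongrightarrow> pi\<^sup>2 / 8"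
    using odd_zeta_limit[of 1] by (simp only: mult_1_right zero_less_one)
  then have "(\<lambda>m. 8 / pi\<^sup>2 * (\<Sum>p<m. (1 / (2 * real p + 1))\<^sup>2)) \<longlonglongrightarrow> 8 / pi\<^sup>2 * (pi\<^sup>2 / 8)"
    by (rule tendsto_mult_left)
  then have w: "wave_energy \<longlonglongrightarrow> 1"
    by (simp add: wave_energy_def[abs_def] sum_distrib_left power_divide power_mult_distrib add.commute)
  have "(\<lambda>m. 2 / pi\<^sup>2 * (\<Sum>q<m. (1 / (real q + 1))\<^sup>2)) \<longlonglongrightarrow> 2 / pi\<^sup>2 * (pi\<^sup>2 / 6)"
    using sums_inverse_Suc_square unfolding sums_def by (rule tendsto_mult_left)
  then have s: "sawtooth_energy \<longlonglongrightarrow> 1 / 3"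
    by (simp add: sawtooth_energy_def[abs_def] sum_distrib_left power_divide power_mult_distrib add.commute)
  have "(\<lambda>m. 2 * (1 / 3 - wave_energy m * sawtooth_energy m)) \<longlonglongrightarrow> 2 * (1 / 3 - 1 * (1 / 3))"
    by (intro tendsto_intros w s)
  then show ?thesis by simp
qed

section \<open>Comparison of characteristic functions\<close>

lemma real_distribution_normalized_writhe: "real_distribution (normalized_writhe_distr n)"
  unfolding normalized_writhe_distr_def
  by (rule prob_space.real_distribution_distr[OF measure_pmf.prob_space_axioms]) simp

lemma char_normalized_writhe:
  "char (normalized_writhe_distr n) t = (CLINT x|sample n. iexp (t * (writhe n x / real n)))"
proof -
  have "char (normalized_writhe_distr n) t =
    (CLINT p|measure_pmf (pmf_of_set {p. p permutes {0..2*n}}). iexp (t * (writhe n (\<lambda>i. real (p i)) / real n)))"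
    unfolding char_def normalized_writhe_distr_def by (subst integral_distr) auto
  also have "\<dots> = (CLINT x|sample n. iexp (t * (writhe n x / real n)))"
    by (rule expectation_writhe_permutation[symmetric, of "\<lambda>w. iexp (t * (w / real n))" 1]) auto
  finally show ?thesis .
qed

lemma trunc_writhe_measurable [measurable]: "trunc_writhe m n \<in> borel_measurable (sample n)"
  unfolding trunc_writhe_def[abs_def] case_prod_unfold
  by (intro borel_measurable_sum borel_measurable_times borel_measurable_const
        measurable_compose[OF borel_measurable_diff[OF measurable_sample_component measurable_sample_component] borel_measurable_sawtooth_trunc])
     (auto dest: cyclic_pairs_le)

lemma integrable_writhe_error:
  "integrable (sample n) (\<lambda>x. (writhe n x - trunc_writhe m n x)\<^sup>2)"
proof -
  define B where "B = (\<Sum>(i, j)\<in>cyclic_pairs n. 3 + \<bar>square_wave m n (real j - real i)\<bar> * m)"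
  have B: "\<bar>writhe n x - trunc_writhe m n x\<bar> \<le> B" if x: "x \<in> space (sample n)" for x
  proof -
    have "writhe n x - trunc_writhe m n x =
      (\<Sum>(i, j)\<in>cyclic_pairs n. sawtooth (x j - x i) - square_wave m n (real j - real i) * sawtooth_trunc m (x j - x i))"
      unfolding writhe_eq_sum_sawtooth trunc_writhe_def by (simp add: sum_subtractf case_prod_unfold)
    also have "\<bar>\<dots>\<bar> \<le> (\<Sum>(i, j)\<in>cyclic_pairs n. \<bar>sawtooth (x j - x i) - square_wave m n (real j - real i) * sawtooth_trunc m (x j - x i)\<bar>)"
      unfolding case_prod_unfold by (rule sum_abs)
    also have "\<dots> \<le> B" unfolding B_def
    proof (intro sum_mono, clarify)
      fix i j assume "(i, j) \<in> cyclic_pairs n"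
      then have "\<bar>sawtooth (x j - x i)\<bar> \<le> 3" using sample_diff_le[OF x] by (auto dest: cyclic_pairs_le intro: sawtooth_abs_le)
      moreover have "\<bar>square_wave m n (real j - real i) * sawtooth_trunc m (x j - x i)\<bar> \<le> \<bar>square_wave m n (real j - real i)\<bar> * m"
        unfolding abs_mult by (intro mult_left_mono sawtooth_trunc_abs_le) auto
      ultimately show "\<bar>sawtooth (x j - x i) - square_wave m n (real j - real i) * sawtooth_trunc m (x j - x i)\<bar>
          \<le> 3 + \<bar>square_wave m n (real j - real i)\<bar> * m" by linarith
    qed
    finally show ?thesis .
  qed
  show ?thesis
  proof (rule sample.integrable_const_bound[where B = "B\<^sup>2"])
    show "AE x in sample n. norm ((writhe n x - trunc_writhe m n x)\<^sup>2) \<le> B\<^sup>2"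
    proof (rule AE_I2)
      fix x assume "x \<in> space (sample n)"
      from power_mono[OF B[OF this], of 2] show "norm ((writhe n x - trunc_writhe m n x)\<^sup>2) \<le> B\<^sup>2" by simp
    qed
  qed measurable
qed

text \<open>The inequality is nonnegativity of the variance of |Y|.\<close>

lemma (in prob_space) expectation_abs_le_sqrt:
  fixes Y :: "'a \<Rightarrow> real"
  assumes [measurable]: "Y \<in> borel_measurable M" and sq: "integrable M (\<lambda>x. (Y x)\<^sup>2)"
  shows "integrable M Y" "expectation (\<lambda>x. \<bar>Y x\<bar>) \<le> sqrt (expectation (\<lambda>x. (Y x)\<^sup>2))"
proof -
  show i: "integrable M Y" by (rule square_integrable_imp_integrable[OF _ sq]) simp
  have "0 \<le> variance (\<lambda>x. \<bar>Y x\<bar>)" by (rule variance_positive)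
  also have "\<dots> = expectation (\<lambda>x. \<bar>Y x\<bar>\<^sup>2) - (expectation (\<lambda>x. \<bar>Y x\<bar>))\<^sup>2"
    by (rule variance_eq) (use i sq in auto)
  finally show "expectation (\<lambda>x. \<bar>Y x\<bar>) \<le> sqrt (expectation (\<lambda>x. (Y x)\<^sup>2))"
    by (intro real_le_rsqrt) simp
qed

lemma norm_iexp_diff_le: "norm (iexp a - iexp b) \<le> \<bar>a - b\<bar>"
proof -
  have "iexp a - iexp b = iexp b * (iexp (a - b) - 1)"
    by (simp add: algebra_simps exp_diff)
  then show ?thesis using iexp_approx1[of "a - b" 0] by (simp add: norm_mult)
qed

text \<open>The phase is a 1-Lipschitz function of its real argument, and the L^1 norm of the error
  is at most its L^2 norm.\<close>

lemma char_truncation_error: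
  assumes n: "n > 0"
  shows "norm ((CLINT x|sample n. iexp (t * (writhe n x / real n))) - (CLINT x|sample n. iexp (t * (trunc_writhe m n x / real n))))
    \<le> \<bar>t\<bar> * sqrt ((LINT x|sample n. (writhe n x - trunc_writhe m n x)\<^sup>2) / (real n)\<^sup>2)"
proof -
  let ?Y = "\<lambda>x. writhe n x - trunc_writhe m n x"
  have Y: "integrable (sample n) ?Y" "(LINT x|sample n. \<bar>?Y x\<bar>) \<le> sqrt (LINT x|sample n. (?Y x)\<^sup>2)"
    by (rule sample.expectation_abs_le_sqrt[OF _ integrable_writhe_error]; measurable)+
  have i: "integrable (sample n) (\<lambda>x. iexp (t * (writhe n x / real n)))" "integrable (sample n) (\<lambda>x. iexp (t * (trunc_writhe m n x / real n)))"
    by (auto intro!: sample.integrable_const_bound[where B = 1])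
  have "norm ((CLINT x|sample n. iexp (t * (writhe n x / real n))) - (CLINT x|sample n. iexp (t * (trunc_writhe m n x / real n))))
     = norm (CLINT x|sample n. iexp (t * (writhe n x / real n)) - iexp (t * (trunc_writhe m n x / real n)))"
    by (subst Bochner_Integration.integral_diff[OF i]) simp
  also have "\<dots> \<le> (LINT x|sample n. norm (iexp (t * (writhe n x / real n)) - iexp (t * (trunc_writhe m n x / real n))))"
    by (rule integral_norm_bound)
  also have "\<dots> \<le> (LINT x|sample n. \<bar>t\<bar> / real n * \<bar>?Y x\<bar>)"
  proof (rule integral_mono')
    show "integrable (sample n) (\<lambda>x. \<bar>t\<bar> / real n * \<bar>?Y x\<bar>)" using Y(1) by (intro integrable_mult_right integrable_abs)
    fix x
    have "\<bar>t * (writhe n x / real n) - t * (trunc_writhe m n x / real n)\<bar> = \<bar>t\<bar> / real n * \<bar>?Y x\<bar>"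
      by (simp add: right_diff_distrib[symmetric] diff_divide_distrib[symmetric] abs_mult abs_divide)
    then show "norm (iexp (t * (writhe n x / real n)) - iexp (t * (trunc_writhe m n x / real n))) \<le> \<bar>t\<bar> / real n * \<bar>?Y x\<bar>"
      using norm_iexp_diff_le[of "t * (writhe n x / real n)" "t * (trunc_writhe m n x / real n)"] by (simp only:)
  qed simp
  also have "\<dots> = \<bar>t\<bar> / real n * (LINT x|sample n. \<bar>?Y x\<bar>)" by simp
  also have "\<dots> \<le> \<bar>t\<bar> / real n * sqrt (LINT x|sample n. (?Y x)\<^sup>2)"
    by (intro mult_left_mono Y(2)) simp
  also have "\<dots> = \<bar>t\<bar> * sqrt ((LINT x|sample n. (?Y x)\<^sup>2) / (real n)\<^sup>2)"
    using n by (simp add: real_sqrt_divide)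
  finally show ?thesis .
qed

lemma char_trunc_writhe_tendsto:
  "(\<lambda>n. CLINT x|sample n. iexp (t * (trunc_writhe m n x / real n))) \<longlonglongrightarrow> of_real (box_cf writhe_scale m t)"
proof -
  have b: "box_cf writhe_scale m t = (\<Prod>q\<in>{..<m}\<times>{..<m}. 1 / (1 + (mode_coeff (fst q, snd q, False, False) * t)\<^sup>2))"
    unfolding box_cf_def by (intro prod.cong refl) (auto simp: writhe_scale_def mode_coeff_def)
  have "\<forall>\<^sub>F n in sequentially. (CLINT x|sample n. iexp (\<Sum>r\<in>modes m. (t * mode_coeff r) * ((lin_stat n r x)\<^sup>2 / 2))) =
     (CLINT x|sample n. iexp (t * (trunc_writhe m n x / real n)))"
    using eventually_gt_at_top[of 0]
    by eventually_elim (simp only: trunc_writhe_decomposition sum_distrib_left mult.assoc)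
  then show ?thesis unfolding b by (rule Lim_transform_eventually[OF quadratic_stat_limit])
qed

lemma char_normalized_writhe_tendsto:
  assumes W: "(\<lambda>m. complex_of_real (box_cf writhe_scale m t)) \<longlonglongrightarrow> L"
  shows "(\<lambda>n. char (normalized_writhe_distr n) t) \<longlonglongrightarrow> L"
proof (rule tendstoI)
  fix e :: real assume e: "e > 0"
  let ?d = "\<lambda>m. 2 * (1 / 3 - wave_energy m * sawtooth_energy m)"
  have "(\<lambda>m. \<bar>t\<bar> * sqrt (?d m)) \<longlonglongrightarrow> \<bar>t\<bar> * sqrt 0"
    by (intro tendsto_mult_left tendsto_real_sqrt truncation_energy_tendsto)
  then have "\<forall>\<^sub>F m in sequentially. \<bar>t\<bar> * sqrt (?d m) < e / 3"
    using e by (intro order_tendstoD(2)) auto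
  moreover have "\<forall>\<^sub>F m in sequentially. dist (complex_of_real (box_cf writhe_scale m t)) L < e / 3"
    using e by (intro tendstoD[OF W]) auto
  ultimately have "\<forall>\<^sub>F m in sequentially. \<bar>t\<bar> * sqrt (?d m) < e / 3 \<and> dist (complex_of_real (box_cf writhe_scale m t)) L < e / 3"
    by eventually_elim auto
  \<comment> \<open>\<open>m\<close> is fixed before \<open>n\<close>: the bound on the truncation
    error is an asymptotic one in \<open>n\<close> for each \<open>m\<close>, and
    \<open>?d m\<close> is only its limit.\<close>
  then obtain m where m: "\<bar>t\<bar> * sqrt (?d m) < e / 3" "dist (complex_of_real (box_cf writhe_scale m t)) L < e / 3"
    using eventually_happens'[OF sequentially_bot] by blast
  let ?D = "\<lambda>n. \<bar>t\<bar> * sqrt ((LINT x|sample n. (writhe n x - trunc_writhe m n x)\<^sup>2) / (real n)\<^sup>2)"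
  have "?D \<longlonglongrightarrow> \<bar>t\<bar> * sqrt (?d m)"
    by (intro tendsto_mult_left tendsto_real_sqrt writhe_truncation_error_tendsto)
  then have "\<forall>\<^sub>F n in sequentially. ?D n < e / 3" using m(1) by (rule order_tendstoD(2))
  moreover have "\<forall>\<^sub>F n in sequentially. dist (CLINT x|sample n. iexp (t * (trunc_writhe m n x / real n))) (of_real (box_cf writhe_scale m t)) < e / 3"
    using e by (intro tendstoD[OF char_trunc_writhe_tendsto]) auto
  ultimately show "\<forall>\<^sub>F n in sequentially. dist (char (normalized_writhe_distr n) t) L < e"
    using eventually_gt_at_top[of 0]
  proof eventually_elim
    case (elim n)
    have "dist (char (normalized_writhe_distr n) t) (CLINT x|sample n. iexp (t * (trunc_writhe m n x / real n))) < e / 3"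
      unfolding char_normalized_writhe dist_norm using char_truncation_error[OF elim(3), of t m] elim(1) by linarith
    with elim(2) m(2) show ?case
      using dist_triangle[of "char (normalized_writhe_distr n) t" L "CLINT x|sample n. iexp (t * (trunc_writhe m n x / real n))"]
        dist_triangle[of "CLINT x|sample n. iexp (t * (trunc_writhe m n x / real n))" L "of_real (box_cf writhe_scale m t)"]
      by linarith
  qed
qed

theorem corollary2:
  shows "\<exists>W :: real measure.
           real_distribution W \<and>
           absolutely_continuous lborel W \<and>
           weak_conv_m normalized_writhe_distr W \<and>
           has_writhe_mgf W \<and>
           (\<forall>W'. real_distribution W' \<and> has_writhe_mgf W' \<longrightarrow> W' = W)"
proof -
  obtain W where W: "real_distribution W" "absolutely_continuous lborel W" "has_writhe_mgf W"
      "\<forall>W'. real_distribution W' \<and> has_writhe_mgf W' \<longrightarrow> W' = W"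
    and cf: "\<And>t. (\<lambda>m. complex_of_real (box_cf writhe_scale m t)) \<longlonglongrightarrow> char W t"
    using exists_writhe_limit_law by blast
  have "weak_conv_m normalized_writhe_distr W"
    by (rule levy_continuity[OF real_distribution_normalized_writhe W(1) char_normalized_writhe_tendsto[OF cf]])
  with W show ?thesis by blast
qed

end
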